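(* Let $H=(H,m,\Delta,\varepsilon,S)$ be a Hopf algebra over a field $\Bbbk$, let $\mathscr C$ be a category of left $H$-modules with finite duality as in the context, and let $P\in\mathscr A(H)$. Then $\Phi_P:H^*_{\mathscr C}\to H$ is a homomorphism of left $H$-modules, where $H$ acts on $H^*_{\mathscr C}$ via $\diamond$ and on $H$ via $\mathrm{ad}$. Moreover, $\Phi_P((H^*_{\mathscr C})^H)\subset Z(H)$, where $Z(H)$ is the center of $H$, and the assignment $|V|\mapsto c_V=c_{V,P}:=\Phi_P(z_V)$, for $V$ in $\mathscr C^{fin}$, defines a homomorphism of abelian groups $\mathrm{ch}_{\mathscr C}:K_0(\mathscr C^{fin})\to Z(H)$.
   Context: The left (resp. right) action of $H$ is denoted $\triangleright$ (resp. $\triangleleft$). $\mathscr C$ is a full abelian tensor subcategory of left $H$-modules, closed under submodules, with a finite duality functor: a (contravariant, additive) functor ${}^\star$ from $\mathscr C$ to right $H$-modules, acting on morphisms by transposition, such that $V^\star$ is a right $H$-submodule of $V^*=\mathrm{Hom}_\Bbbk(V,\Bbbk)$ (where $\langle v,f\triangleleft h\rangle_V=\langle h\triangleright v,f\rangle_V$), with $V^\star=V^*$ iff $V$ is finite dimensional, the evaluation pairing on $V\otimes V^\star$ is non-degenerate, and there is a natural pairing-compatible isomorphism $(V\otimes V')^\star\cong V'{}^\star\otimes V^\star$. $D(V):=\mathrm{End}_HV^\star=(\mathrm{End}_HV)^{op}$. $\mathscr C^{fin}$ is the full subcategory of finite dimensional objects, $K_0(\mathscr C^{fin})$ its Grothendieck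 group, $|V|$ the class of $V$. $H^*=\mathrm{Hom}_\Bbbk(H,\Bbbk)$ is an $H$-bimodule via $(h\triangleright\xi\triangleleft h')(x)=\xi(h'xh)$. For $V\in\mathscr C$, $\beta_V:V\otimes_{D(V)}V^\star\to H^*$, $\beta_V(v\otimes f)(h)=\langle h\triangleright v,f\rangle_V$; $H_V^*=\mathrm{Im}\,\beta_V$; $H^*_{\mathscr C}=\sum_{V\in\mathscr C}H^*_V$. For $V\in\mathscr C^{fin}$, $z_V=\beta_V(1_V)$ with $1_V\in V\otimes V^*$ the canonical element, i.e. $z_V(h)$ is the trace of $h$ on $V$. For an $H$-bimodule $B$: $B^H=\{b: h\triangleright b=b\triangleleft h\ \forall h\in H\}$; $(\mathrm{ad}\,h)(b)=h_{(1)}\triangleright b\triangleleft S(h_{(2)})$; $h\diamond b=S^2(h_{(2)})\triangleright b\triangleleft S(h_{(1)})$, where $\Delta(h)=h_{(1)}\otimes h_{(2)}$. Fix a completion $H\widehat\otimes H$ of $H\otimes H$ (an algebra containing $H\otimes H$, to which the usual operations of $H\otimes H$ extend) such that $(f\otimes1)(H\widehat\otimes H)\subset H$ for all $f\in H^*_{\mathscr C}$, where $f\otimes 1$ is the extension of $a\otimes b\mapsto f(a)b$, satisfying $(f\otimes1)((a\otimes b)X(c\otimes d))=b\cdot((c\triangleright f\triangleleft a)\otimes1)(X)\cdot d$ for $a,b,c,d\in H$. For $P\in H\widehat\otimes H$ let $\Phi_P:H^*_{\mathscr C}\to H$, $\Phi_P(f)=(f\otimes1)(P)$. $\mathscr A(H)$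 is the set of $P\in H\widehat\otimes H$ such that $P\cdot(S^2\otimes1)(\Delta(h))=\Delta(h)\cdot P$ for all $h\in H$. *)

theory Defs
  imports
    Complex_Main
    "HOL-Library.Function_Algebras"
    "HOL-Algebra.Module"
    "HOL-Algebra.Free_Abelian_Groups"
begin

text \<open>
  Conventions. The field is a type \<open>'k :: field\<close>, and the Hopf algebra is a type
  \<open>'h :: ring_1\<close> together with its remaining structure maps. Modules, which occur as objects of a
  category, are records with explicit carriers. An abelian group that occurs as an object is a
  (multiplicatively written) \<open>monoid\<close> record, as for free Abelian groups in \<open>HOL-Algebra\<close>.
\<close>

definition additive_group :: "'a::ab_group_add set \<Rightarrow> 'a monoid" where
  "additive_group A = \<lparr>carrier = A, monoid.mult = (+), monoid.one = 0\<rparr>"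


section \<open>Tensor products\<close>

text \<open>
  \<open>A \<otimes>\<^bsub>D\<^esub> B\<close> for abelian groups \<open>A\<close>, \<open>B\<close>, a set of scalars \<open>D\<close> acting on the right on \<open>A\<close> (by \<open>ra\<close>)
  and on the left on \<open>B\<close> (by \<open>la\<close>): the free abelian group on the set of pairs modulo the subgroup
  generated by the usual relations. Its elements are cosets of formal sums.
\<close>

definition tensor_relators ::
  "('a, 'm) monoid_scheme \<Rightarrow> ('b, 'n) monoid_scheme \<Rightarrow> 'd set \<Rightarrow> ('a \<Rightarrow> 'd \<Rightarrow> 'a) \<Rightarrow> ('d \<Rightarrow> 'b \<Rightarrow> 'b)
    \<Rightarrow> ('a \<times> 'b \<Rightarrow>\<^sub>0 int) set" where
  "tensor_relators A B D ra la =
     {frag_of (a \<otimes>\<^bsub>A\<^esub> a', b) - frag_of (a, b) - frag_of (a', b) | a a' b.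
        a \<in> carrier A \<and> a' \<in> carrier A \<and> b \<in> carrier B} \<union>
     {frag_of (a, b \<otimes>\<^bsub>B\<^esub> b') - frag_of (a, b) - frag_of (a, b') | a b b'.
        a \<in> carrier A \<and> b \<in> carrier B \<and> b' \<in> carrier B} \<union>
     {frag_of (ra a d, b) - frag_of (a, la d b) | a d b.
        a \<in> carrier A \<and> d \<in> D \<and> b \<in> carrier B}"

definition tensor_null ::
  "('a, 'm) monoid_scheme \<Rightarrow> ('b, 'n) monoid_scheme \<Rightarrow> 'd set \<Rightarrow> ('a \<Rightarrow> 'd \<Rightarrow> 'a) \<Rightarrow> ('d \<Rightarrow> 'b \<Rightarrow> 'b)
    \<Rightarrow> ('a \<times> 'b \<Rightarrow>\<^sub>0 int) set" where
  "tensor_null A B D ra la =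
     generate (free_Abelian_group (carrier A \<times> carrier B)) (tensor_relators A B D ra la)"

definition tensor ::
  "('a, 'm) monoid_scheme \<Rightarrow> ('b, 'n) monoid_scheme \<Rightarrow> 'd set \<Rightarrow> ('a \<Rightarrow> 'd \<Rightarrow> 'a) \<Rightarrow> ('d \<Rightarrow> 'b \<Rightarrow> 'b)
    \<Rightarrow> ('a \<times> 'b \<Rightarrow>\<^sub>0 int) set monoid" where
  "tensor A B D ra la =
     free_Abelian_group (carrier A \<times> carrier B) Mod tensor_null A B D ra la"

definition pure_tensor ::
  "('a, 'm) monoid_scheme \<Rightarrow> ('b, 'n) monoid_scheme \<Rightarrow> 'd set \<Rightarrow> ('a \<Rightarrow> 'd \<Rightarrow> 'a) \<Rightarrow> ('d \<Rightarrow> 'b \<Rightarrow> 'b)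
    \<Rightarrow> 'a \<Rightarrow> 'b \<Rightarrow> ('a \<times> 'b \<Rightarrow>\<^sub>0 int) set" where
  "pure_tensor A B D ra la a b =
     tensor_null A B D ra la #>\<^bsub>free_Abelian_group (carrier A \<times> carrier B)\<^esub> frag_of (a, b)"

text \<open>
  For a balanced biadditive \<open>F\<close> with values in \<open>G\<close>, the induced homomorphism
  \<open>a \<otimes> b \<mapsto> F a b\<close> on the tensor product: evaluate any formal sum in the given coset.
\<close>

definition tensor_lift ::
  "('g, 'm) monoid_scheme \<Rightarrow> ('a \<Rightarrow> 'b \<Rightarrow> 'g) \<Rightarrow> ('a \<times> 'b \<Rightarrow>\<^sub>0 int) set \<Rightarrow> 'g" where
  "tensor_lift G F X = the_elem
     ((\<lambda>p. \<Otimes>\<^bsub>G\<^esub>x\<in>Poly_Mapping.keys p. F (fst x) (snd x) [^]\<^bsub>G\<^esub> Poly_Mapping.lookup p x) ` X)"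


section \<open>Hopf algebras\<close>

record ('k, 'h) hopf =
  hscale :: "'k \<Rightarrow> 'h \<Rightarrow> 'h"
  comult :: "'h \<Rightarrow> ('h \<times> 'h \<Rightarrow>\<^sub>0 int) set"
  counit :: "'h \<Rightarrow> 'k"
  antipode :: "'h \<Rightarrow> 'h"

definition HH :: "('k::field, 'h::ring_1) hopf \<Rightarrow> ('h \<times> 'h \<Rightarrow>\<^sub>0 int) set monoid" where
  "HH H = tensor (additive_group UNIV) (additive_group UNIV) UNIV (\<lambda>a c. hscale H c a) (hscale H)"

definition hpure :: "('k::field, 'h::ring_1) hopf \<Rightarrow> 'h \<Rightarrow> 'h \<Rightarrow> ('h \<times> 'h \<Rightarrow>\<^sub>0 int) set" where
  "hpure H = pure_tensor (additive_group UNIV) (additive_group UNIV) UNIV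
     (\<lambda>a c. hscale H c a) (hscale H)"

definition HH_scale ::
  "('k::field, 'h::ring_1) hopf \<Rightarrow> 'k \<Rightarrow> ('h \<times> 'h \<Rightarrow>\<^sub>0 int) set \<Rightarrow> ('h \<times> 'h \<Rightarrow>\<^sub>0 int) set" where
  "HH_scale H c = tensor_lift (HH H) (\<lambda>a b. hpure H (hscale H c a) b)"

definition HH_mult ::
  "('k::field, 'h::ring_1) hopf \<Rightarrow> ('h \<times> 'h \<Rightarrow>\<^sub>0 int) set \<Rightarrow> ('h \<times> 'h \<Rightarrow>\<^sub>0 int) set
    \<Rightarrow> ('h \<times> 'h \<Rightarrow>\<^sub>0 int) set" where
  "HH_mult H X Y =
     tensor_lift (HH H) (\<lambda>a b. tensor_lift (HH H) (\<lambda>c d. hpure H (a * c) (b * d)) Y) X"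

text \<open>\<open>H \<otimes> (H \<otimes> H)\<close>\<close>

definition HHH :: "('k::field, 'h::ring_1) hopf
    \<Rightarrow> ('h \<times> ('h \<times> 'h \<Rightarrow>\<^sub>0 int) set \<Rightarrow>\<^sub>0 int) set monoid" where
  "HHH H = tensor (additive_group UNIV) (HH H) UNIV (\<lambda>a c. hscale H c a) (HH_scale H)"

definition hpure3 :: "('k::field, 'h::ring_1) hopf \<Rightarrow> 'h \<Rightarrow> ('h \<times> 'h \<Rightarrow>\<^sub>0 int) set
    \<Rightarrow> ('h \<times> ('h \<times> 'h \<Rightarrow>\<^sub>0 int) set \<Rightarrow>\<^sub>0 int) set" where
  "hpure3 H = pure_tensor (additive_group UNIV) (HH H) UNIV (\<lambda>a c. hscale H c a) (HH_scale H)"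

text \<open>Sweedler notation: \<open>sweedler H G F h\<close> is \<open>F h\<^sub>(\<^sub>1\<^sub>) h\<^sub>(\<^sub>2\<^sub>)\<close>, for bilinear \<open>F\<close> with values in \<open>G\<close>.\<close>

definition sweedler ::
  "('k::field, 'h::ring_1) hopf \<Rightarrow> ('g, 'm) monoid_scheme \<Rightarrow> ('h \<Rightarrow> 'h \<Rightarrow> 'g) \<Rightarrow> 'h \<Rightarrow> 'g" where
  "sweedler H G F h = tensor_lift G F (comult H h)"

locale hopf_algebra = vector_space "hscale H"
  for H :: "('k::field, 'h::ring_1) hopf" +
  assumes hscale_mult_left: "hscale H c (a * b) = hscale H c a * b"
    and hscale_mult_right: "hscale H c (a * b) = a * hscale H c b"
    and comult_hom: "comult H \<in> hom (additive_group UNIV) (HH H)"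
    and comult_hscale: "comult H (hscale H c a) = HH_scale H c (comult H a)"
    and comult_mult: "comult H (a * b) = HH_mult H (comult H a) (comult H b)"
    and comult_one: "comult H 1 = hpure H 1 1"
    and counit_linear: "Vector_Spaces.linear (hscale H) (*) (counit H)"
    and counit_mult: "counit H (a * b) = counit H a * counit H b"
    and counit_one: "counit H 1 = 1"
    and coassoc:
      "sweedler H (HHH H) (\<lambda>a b. sweedler H (HHH H) (\<lambda>c d. hpure3 H c (hpure H d b)) a) h
       = sweedler H (HHH H) (\<lambda>a b. hpure3 H a (comult H b)) h"
    and counit_left: "sweedler H (additive_group UNIV) (\<lambda>a b. hscale H (counit H a) b) h = h"
    and counit_right: "sweedler H (additive_group UNIV) (\<lambda>a b. hscale H (counit H b) a) h = h"
    and antipode_linear: "Vector_Spaces.linear (hscale H) (hscale H) (antipode H)"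
    and antipode_left:
      "sweedler H (additive_group UNIV) (\<lambda>a b. antipode H a * b) h = hscale H (counit H h) 1"
    and antipode_right:
      "sweedler H (additive_group UNIV) (\<lambda>a b. a * antipode H b) h = hscale H (counit H h) 1"


section \<open>Left modules over \<open>H\<close>\<close>

text \<open>
  The library locale \<open>module\<close> is for commutative rings of scalars only; its record is used with
  \<open>smult\<close> for the action and with the fields \<open>mult\<close> and \<open>one\<close> ignored.
\<close>

locale left_module = abelian_group V
  for V :: "('h::ring_1, 'v) module" (structure) +
  assumes act_closed: "v \<in> carrier V \<Longrightarrow> h \<odot> v \<in> carrier V"
    and act_add_left: "v \<in> carrier V \<Longrightarrow> (g + h) \<odot> v = g \<odot> v \<oplus> h \<odot> v"
    and act_add_right:
      "v \<in> carrier V \<Longrightarrow> w \<in> carrier V \<Longrightarrow> h \<odot> (v \<oplus> w) = h \<odot> v \<oplus> h \<odot> w"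
    and act_mult: "v \<in> carrier V \<Longrightarrow> (g * h) \<odot> v = g \<odot> (h \<odot> v)"
    and act_one: "v \<in> carrier V \<Longrightarrow> 1 \<odot> v = v"

definition lmod_hom :: "('h, 'v) module \<Rightarrow> ('h, 'w) module \<Rightarrow> ('v \<Rightarrow> 'w) set" where
  "lmod_hom V W = {\<phi> \<in> carrier V \<rightarrow> carrier W.
     (\<forall>v\<in>carrier V. \<forall>v'\<in>carrier V. \<phi> (v \<oplus>\<^bsub>V\<^esub> v') = \<phi> v \<oplus>\<^bsub>W\<^esub> \<phi> v') \<and>
     (\<forall>h. \<forall>v\<in>carrier V. \<phi> (h \<odot>\<^bsub>V\<^esub> v) = h \<odot>\<^bsub>W\<^esub> \<phi> v)}"

definition lmod_iso :: "('h, 'v) module \<Rightarrow> ('h, 'w) module \<Rightarrow> ('v \<Rightarrow> 'w) set" where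
  "lmod_iso V W = {\<phi> \<in> lmod_hom V W. bij_betw \<phi> (carrier V) (carrier W)}"

definition is_submodule :: "'v set \<Rightarrow> ('h, 'v) module \<Rightarrow> bool" where
  "is_submodule U V \<longleftrightarrow> subgroup U (add_monoid V) \<and> (\<forall>h. \<forall>u\<in>U. h \<odot>\<^bsub>V\<^esub> u \<in> U)"

definition short_exact ::
  "('h, 'u) module \<Rightarrow> ('u \<Rightarrow> 'v) \<Rightarrow> ('h, 'v) module \<Rightarrow> ('v \<Rightarrow> 'w) \<Rightarrow> ('h, 'w) module \<Rightarrow> bool" where
  "short_exact U i V p W \<longleftrightarrow>
     i \<in> lmod_hom U V \<and> p \<in> lmod_hom V W \<and> inj_on i (carrier U) \<and> p ` carrier V = carrier W \<and>
     i ` carrier U = {v \<in> carrier V. p v = \<zero>\<^bsub>W\<^esub>}"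

text \<open>The \<open>\<bbbk>\<close>-vector space structure of an \<open>H\<close>-module comes from \<open>\<bbbk> \<rightarrow> H\<close>.\<close>

definition ksmult :: "('k, 'h::ring_1) hopf \<Rightarrow> ('h, 'v) module \<Rightarrow> 'k \<Rightarrow> 'v \<Rightarrow> 'v" where
  "ksmult H V c v = hscale H c 1 \<odot>\<^bsub>V\<^esub> v"

definition fin_dim :: "('k, 'h::ring_1) hopf \<Rightarrow> ('h, 'v) module \<Rightarrow> bool" where
  "fin_dim H V \<longleftrightarrow> (\<exists>(n::nat) e. e \<in> {..<n} \<rightarrow> carrier V \<and>
     (\<forall>v\<in>carrier V. \<exists>c. v = (\<Oplus>\<^bsub>V\<^esub>i\<in>{..<n}. ksmult H V (c i) (e i))))"

definition trivial_module :: "('k::field, 'h::ring_1) hopf \<Rightarrow> ('h, 'k) module" where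
  "trivial_module H = \<lparr>carrier = UNIV,
     monoid.mult = undefined, monoid.one = undefined, ring.zero = 0, ring.add = (+),
     smult = (\<lambda>h x. counit H h * x)\<rparr>"

definition direct_sum :: "('h, 'v) module \<Rightarrow> ('h, 'w) module \<Rightarrow> ('h, 'v \<times> 'w) module" where
  "direct_sum V W = \<lparr>carrier = carrier V \<times> carrier W,
     monoid.mult = undefined, monoid.one = undefined,
     ring.zero = (\<zero>\<^bsub>V\<^esub>, \<zero>\<^bsub>W\<^esub>),
     ring.add = (\<lambda>x y. (fst x \<oplus>\<^bsub>V\<^esub> fst y, snd x \<oplus>\<^bsub>W\<^esub> snd y)),
     smult = (\<lambda>h x. (h \<odot>\<^bsub>V\<^esub> fst x, h \<odot>\<^bsub>W\<^esub> snd x))\<rparr>"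

definition mod_tensor :: "('k::field, 'h::ring_1) hopf \<Rightarrow> ('h, 'v) module \<Rightarrow> ('h, 'w) module
    \<Rightarrow> ('v \<times> 'w \<Rightarrow>\<^sub>0 int) set monoid" where
  "mod_tensor H V W = tensor (add_monoid V) (add_monoid W) UNIV
     (\<lambda>v c. ksmult H V c v) (ksmult H W)"

definition mod_pure :: "('k::field, 'h::ring_1) hopf \<Rightarrow> ('h, 'v) module \<Rightarrow> ('h, 'w) module
    \<Rightarrow> 'v \<Rightarrow> 'w \<Rightarrow> ('v \<times> 'w \<Rightarrow>\<^sub>0 int) set" where
  "mod_pure H V W = pure_tensor (add_monoid V) (add_monoid W) UNIV
     (\<lambda>v c. ksmult H V c v) (ksmult H W)"

definition tensor_module :: "('k::field, 'h::ring_1) hopf \<Rightarrow> ('h, 'v) module \<Rightarrow> ('h, 'w) module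
    \<Rightarrow> ('h, ('v \<times> 'w \<Rightarrow>\<^sub>0 int) set) module" where
  "tensor_module H V W = \<lparr>carrier = carrier (mod_tensor H V W),
     monoid.mult = undefined, monoid.one = undefined,
     ring.zero = \<one>\<^bsub>mod_tensor H V W\<^esub>,
     ring.add = (\<otimes>\<^bsub>mod_tensor H V W\<^esub>),
     smult = (\<lambda>h X. sweedler H (mod_tensor H V W)
       (\<lambda>a b. tensor_lift (mod_tensor H V W)
          (\<lambda>v w. mod_pure H V W (a \<odot>\<^bsub>V\<^esub> v) (b \<odot>\<^bsub>W\<^esub> w)) X) h)\<rparr>"


section \<open>Duals\<close>

text \<open>Functionals on \<open>V\<close> are normalised to be \<open>undefined\<close> outside the carrier.\<close>

definition dual :: "('k::field, 'h::ring_1) hopf \<Rightarrow> ('h, 'v) module \<Rightarrow> ('v \<Rightarrow> 'k) set" where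
  "dual H V = {f \<in> extensional (carrier V).
     (\<forall>v\<in>carrier V. \<forall>w\<in>carrier V. f (v \<oplus>\<^bsub>V\<^esub> w) = f v + f w) \<and>
     (\<forall>c. \<forall>v\<in>carrier V. f (ksmult H V c v) = c * f v)}"

definition functional_group ::
  "('h, 'v) module \<Rightarrow> ('v \<Rightarrow> 'k::field) set \<Rightarrow> ('v \<Rightarrow> 'k) monoid" where
  "functional_group V F = \<lparr>carrier = F, monoid.mult = (\<lambda>f g. \<lambda>v\<in>carrier V. f v + g v),
     monoid.one = (\<lambda>v\<in>carrier V. 0)\<rparr>"

definition functional_scale ::
  "('h, 'v) module \<Rightarrow> 'k::field \<Rightarrow> ('v \<Rightarrow> 'k) \<Rightarrow> 'v \<Rightarrow> 'k" where
  "functional_scale V c f = (\<lambda>v\<in>carrier V. c * f v)"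

definition dual_ract :: "('h, 'v) module \<Rightarrow> ('v \<Rightarrow> 'k::field) \<Rightarrow> 'h \<Rightarrow> 'v \<Rightarrow> 'k" where
  "dual_ract V f h = (\<lambda>v\<in>carrier V. f (h \<odot>\<^bsub>V\<^esub> v))"

definition transpose_map :: "('h, 'v) module \<Rightarrow> ('v \<Rightarrow> 'w) \<Rightarrow> ('w \<Rightarrow> 'k::field) \<Rightarrow> 'v \<Rightarrow> 'k" where
  "transpose_map V \<phi> f = (\<lambda>v\<in>carrier V. f (\<phi> v))"


section \<open>Module categories with finite duality\<close>

text \<open>
  A full subcategory is given by its class \<open>C\<close> of objects, with carriers in a type \<open>'v\<close>. All
  closure properties are up to isomorphism. Kernels are covered by closure under submodules;
  \<open>abelian_cokernel\<close> says that cokernels taken among all \<open>H\<close>-modules lie in \<open>C\<close>.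

  \<open>V\<^sup>\<star>\<close> is \<open>star V\<close>. On morphisms the functor is transposition, so it is additive and functorial as
  soon as transposes map \<open>star W\<close> to \<open>star V\<close>. In \<open>star_tensor\<close>, \<open>T\<close> is a realisation of
  \<open>V \<otimes> V'\<close> in \<open>C\<close> and the pairing of \<open>V \<otimes> V'\<close> with \<open>V'\<^sup>\<star> \<otimes> V\<^sup>\<star>\<close> is
  \<open>\<langle>v \<otimes> v', f' \<otimes> f\<rangle> = \<langle>v, f\<rangle> \<langle>v', f'\<rangle>\<close>. The inverse of \<open>\<tau>\<close> is determined by compatibility with the
  pairings, because the elements of \<open>star T\<close> are functionals; hence \<open>\<tau>\<close> is unique, \<open>\<bbbk>\<close>-linear, and
  natural.
\<close>

locale finite_duality_category = hopf_algebra H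
  for H :: "('k::field, 'h::ring_1) hopf" +
  fixes C :: "('h, 'v) module set"
    and star :: "('h, 'v) module \<Rightarrow> ('v \<Rightarrow> 'k) set"
  assumes objects: "V \<in> C \<Longrightarrow> left_module V"
    and zero_object: "\<exists>N\<in>C. carrier N = {\<zero>\<^bsub>N\<^esub>}"
    and direct_sums: "V \<in> C \<Longrightarrow> W \<in> C \<Longrightarrow> \<exists>N\<in>C. lmod_iso (direct_sum V W) N \<noteq> {}"
    and submodules:
      "V \<in> C \<Longrightarrow> is_submodule U V \<Longrightarrow> \<exists>N\<in>C. lmod_iso (V\<lparr>carrier := U\<rparr>) N \<noteq> {}"
    and abelian_cokernel:
      "V \<in> C \<Longrightarrow> W \<in> C \<Longrightarrow> \<phi> \<in> lmod_hom V W \<Longrightarrow>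
       \<exists>Q\<in>C. \<exists>p\<in>lmod_hom W Q. p ` carrier W = carrier Q \<and>
         {w \<in> carrier W. p w = \<zero>\<^bsub>Q\<^esub>} = \<phi> ` carrier V"
    and unit_object: "\<exists>N\<in>C. lmod_iso (trivial_module H) N \<noteq> {}"
    and tensors: "V \<in> C \<Longrightarrow> W \<in> C \<Longrightarrow> \<exists>N\<in>C. lmod_iso (tensor_module H V W) N \<noteq> {}"
    and star_subgroup: "V \<in> C \<Longrightarrow> subgroup (star V) (functional_group V (dual H V))"
    and star_ract: "V \<in> C \<Longrightarrow> f \<in> star V \<Longrightarrow> dual_ract V f h \<in> star V"
    and star_transpose:
      "V \<in> C \<Longrightarrow> W \<in> C \<Longrightarrow> \<phi> \<in> lmod_hom V W \<Longrightarrow> f \<in> star W \<Longrightarrow> transpose_map V \<phi> f \<in> star V"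
    and star_full_iff: "V \<in> C \<Longrightarrow> star V = dual H V \<longleftrightarrow> fin_dim H V"
    and star_nondegenerate_left:
      "V \<in> C \<Longrightarrow> v \<in> carrier V \<Longrightarrow> (\<And>f. f \<in> star V \<Longrightarrow> f v = 0) \<Longrightarrow> v = \<zero>\<^bsub>V\<^esub>"
    and star_nondegenerate_right:
      "V \<in> C \<Longrightarrow> f \<in> star V \<Longrightarrow> (\<And>v. v \<in> carrier V \<Longrightarrow> f v = 0) \<Longrightarrow>
       f = \<one>\<^bsub>functional_group V (star V)\<^esub>"
    and star_tensor:
      "V \<in> C \<Longrightarrow> V' \<in> C \<Longrightarrow> T \<in> C \<Longrightarrow> \<theta> \<in> lmod_iso (tensor_module H V V') T \<Longrightarrow>
       \<exists>\<tau> \<in> iso (functional_group T (star T))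
              (tensor (functional_group V' (star V')) (functional_group V (star V))
                 UNIV (\<lambda>f c. functional_scale V' c f) (functional_scale V)).
         \<forall>F\<in>star T. \<forall>v\<in>carrier V. \<forall>v'\<in>carrier V'.
           F (\<theta> (mod_pure H V V' v v'))
           = tensor_lift (additive_group UNIV) (\<lambda>f' f. f v * f' v') (\<tau> F)"


section \<open>\<open>H\<^sup>*\<close> and matrix coefficients\<close>

definition H_dual :: "('k::field, 'h::ring_1) hopf \<Rightarrow> ('h \<Rightarrow> 'k) set" where
  "H_dual H = {\<xi>. Vector_Spaces.linear (hscale H) (*) \<xi>}"

text \<open>\<open>(h \<triangleright> \<xi> \<triangleleft> h')(x) = \<xi> (h' x h)\<close>\<close>

definition dual_left :: "'h::ring_1 \<Rightarrow> ('h \<Rightarrow> 'k) \<Rightarrow> 'h \<Rightarrow> 'k" where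
  "dual_left h \<xi> = (\<lambda>x. \<xi> (x * h))"

definition dual_right :: "('h::ring_1 \<Rightarrow> 'k) \<Rightarrow> 'h \<Rightarrow> 'h \<Rightarrow> 'k" where
  "dual_right \<xi> h = (\<lambda>x. \<xi> (h * x))"

text \<open>
  \<open>D(V) = (End\<^sub>H V)\<^sup>o\<^sup>p\<close> acts on \<open>V\<close> on the right by \<open>v \<triangleleft> \<phi> = \<phi> v\<close> and on \<open>V\<^sup>\<star>\<close> on the left by
  transposition.
\<close>

definition D_tensor :: "('h::ring_1, 'v) module \<Rightarrow> (('h, 'v) module \<Rightarrow> ('v \<Rightarrow> 'k::field) set)
    \<Rightarrow> ('v \<times> ('v \<Rightarrow> 'k) \<Rightarrow>\<^sub>0 int) set monoid" where
  "D_tensor V star = tensor (add_monoid V) (functional_group V (star V))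
     (lmod_hom V V) (\<lambda>v \<phi>. \<phi> v) (transpose_map V)"

definition D_pure :: "('h::ring_1, 'v) module \<Rightarrow> (('h, 'v) module \<Rightarrow> ('v \<Rightarrow> 'k::field) set)
    \<Rightarrow> 'v \<Rightarrow> ('v \<Rightarrow> 'k) \<Rightarrow> ('v \<times> ('v \<Rightarrow> 'k) \<Rightarrow>\<^sub>0 int) set" where
  "D_pure V star = pure_tensor (add_monoid V) (functional_group V (star V))
     (lmod_hom V V) (\<lambda>v \<phi>. \<phi> v) (transpose_map V)"

definition beta :: "('k::field, 'h::ring_1) hopf \<Rightarrow> ('h, 'v) module
    \<Rightarrow> ('v \<times> ('v \<Rightarrow> 'k) \<Rightarrow>\<^sub>0 int) set \<Rightarrow> 'h \<Rightarrow> 'k" where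
  "beta H V = tensor_lift (additive_group (H_dual H)) (\<lambda>v f. \<lambda>h. f (h \<odot>\<^bsub>V\<^esub> v))"

definition coeffs :: "('k::field, 'h::ring_1) hopf \<Rightarrow> (('h, 'v) module \<Rightarrow> ('v \<Rightarrow> 'k) set)
    \<Rightarrow> ('h, 'v) module \<Rightarrow> ('h \<Rightarrow> 'k) set" where
  "coeffs H star V = beta H V ` carrier (D_tensor V star)"

text \<open>\<open>H\<^sup>*\<^sub>C\<close>, the sum of the subspaces \<open>coeffs H star V\<close>; functions are added pointwise.\<close>

definition coeffs_cat :: "('k::field, 'h::ring_1) hopf \<Rightarrow> ('h, 'v) module set
    \<Rightarrow> (('h, 'v) module \<Rightarrow> ('v \<Rightarrow> 'k) set) \<Rightarrow> ('h \<Rightarrow> 'k) set" where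
  "coeffs_cat H C star =
     {\<Sum>V\<in>F. g V | F g. finite F \<and> F \<subseteq> C \<and> (\<forall>V\<in>F. g V \<in> coeffs H star V)}"

definition dual_bases :: "('k::field, 'h::ring_1) hopf \<Rightarrow> ('h, 'v) module
    \<Rightarrow> nat \<Rightarrow> (nat \<Rightarrow> 'v) \<Rightarrow> (nat \<Rightarrow> 'v \<Rightarrow> 'k) \<Rightarrow> bool" where
  "dual_bases H V n e f \<longleftrightarrow> e \<in> {..<n} \<rightarrow> carrier V \<and> f \<in> {..<n} \<rightarrow> dual H V \<and>
     (\<forall>i<n. \<forall>j<n. f i (e j) = (if i = j then 1 else 0)) \<and>
     (\<forall>v\<in>carrier V. v = (\<Oplus>\<^bsub>V\<^esub>i\<in>{..<n}. ksmult H V (f i v) (e i)))"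

text \<open>
  The image in \<open>V \<otimes>\<^bsub>D(V)\<^esub> V\<^sup>\<star>\<close> of the canonical element of \<open>V \<otimes> V\<^sup>*\<close>, for \<open>V\<close> finite dimensional:
  \<open>\<Sum>\<^sub>i e\<^sub>i \<otimes> f\<^sub>i\<close> for any pair of dual bases.
\<close>

definition canonical_elem :: "('k::field, 'h::ring_1) hopf
    \<Rightarrow> (('h, 'v) module \<Rightarrow> ('v \<Rightarrow> 'k) set) \<Rightarrow> ('h, 'v) module
    \<Rightarrow> ('v \<times> ('v \<Rightarrow> 'k) \<Rightarrow>\<^sub>0 int) set" where
  "canonical_elem H star V = (THE X. \<exists>n e f. dual_bases H V n e f \<and>
     X = (\<Otimes>\<^bsub>D_tensor V star\<^esub>i\<in>{..<n}. D_pure V star (e i) (f i)))"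

definition z_elem :: "('k::field, 'h::ring_1) hopf
    \<Rightarrow> (('h, 'v) module \<Rightarrow> ('v \<Rightarrow> 'k) set) \<Rightarrow> ('h, 'v) module \<Rightarrow> 'h \<Rightarrow> 'k" where
  "z_elem H star V = beta H V (canonical_elem H star V)"


section \<open>Bimodule actions\<close>

text \<open>An \<open>H\<close>-bimodule \<open>B\<close> is given by its additive group and the two actions \<open>l\<close> and \<open>r\<close>.\<close>

definition bimod_invariants ::
  "'b set \<Rightarrow> ('h \<Rightarrow> 'b \<Rightarrow> 'b) \<Rightarrow> ('b \<Rightarrow> 'h \<Rightarrow> 'b) \<Rightarrow> 'b set" where
  "bimod_invariants B l r = {b \<in> B. \<forall>h. l h b = r b h}"

definition ad_act :: "('k::field, 'h::ring_1) hopf \<Rightarrow> ('b, 'm) monoid_scheme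
    \<Rightarrow> ('h \<Rightarrow> 'b \<Rightarrow> 'b) \<Rightarrow> ('b \<Rightarrow> 'h \<Rightarrow> 'b) \<Rightarrow> 'h \<Rightarrow> 'b \<Rightarrow> 'b" where
  "ad_act H B l r h b = sweedler H B (\<lambda>h1 h2. r (l h1 b) (antipode H h2)) h"

definition diamond_act :: "('k::field, 'h::ring_1) hopf \<Rightarrow> ('b, 'm) monoid_scheme
    \<Rightarrow> ('h \<Rightarrow> 'b \<Rightarrow> 'b) \<Rightarrow> ('b \<Rightarrow> 'h \<Rightarrow> 'b) \<Rightarrow> 'h \<Rightarrow> 'b \<Rightarrow> 'b" where
  "diamond_act H B l r h b =
     sweedler H B (\<lambda>h1 h2. r (l (antipode H (antipode H h2)) b) (antipode H h1)) h"

definition adjoint_module :: "('k::field, 'h::ring_1) hopf \<Rightarrow> ('h, 'h) module" where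
  "adjoint_module H = \<lparr>carrier = UNIV,
     monoid.mult = undefined, monoid.one = undefined, ring.zero = 0, ring.add = (+),
     smult = ad_act H (additive_group UNIV) (*) (*)\<rparr>"

definition diamond_module :: "('k::field, 'h::ring_1) hopf \<Rightarrow> ('h, 'v) module set
    \<Rightarrow> (('h, 'v) module \<Rightarrow> ('v \<Rightarrow> 'k) set) \<Rightarrow> ('h, 'h \<Rightarrow> 'k) module" where
  "diamond_module H C star = \<lparr>carrier = coeffs_cat H C star,
     monoid.mult = undefined, monoid.one = undefined,
     ring.zero = 0, ring.add = (+),
     smult = diamond_act H (additive_group (coeffs_cat H C star)) dual_left dual_right\<rparr>"

definition ring_center :: "'h::ring_1 set" where
  "ring_center = {z. \<forall>x. z * x = x * z}"


section \<open>Completions of \<open>H \<otimes> H\<close>\<close>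

text \<open>
  A completion is a \<open>\<bbbk>\<close>-algebra \<open>'c\<close> with an embedding \<open>incl\<close> of \<open>H \<otimes> H\<close>; \<open>slice f\<close> is the extension
  \<open>f \<otimes> 1\<close> of \<open>a \<otimes> b \<mapsto> f(a) b\<close>. That \<open>(f, X) \<mapsto> (f \<otimes> 1)(X)\<close> stays bilinear on the completion is part
  of the extension of the operations of \<open>H \<otimes> H\<close>.
\<close>

record ('k, 'h, 'c) completion =
  cscale :: "'k \<Rightarrow> 'c \<Rightarrow> 'c"
  incl :: "('h \<times> 'h \<Rightarrow>\<^sub>0 int) set \<Rightarrow> 'c"
  slice :: "('h \<Rightarrow> 'k) \<Rightarrow> 'c \<Rightarrow> 'h"

locale completed_square = hopf_algebra H + compl: vector_space "cscale K"
  for H :: "('k::field, 'h::ring_1) hopf"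
    and C :: "('h, 'v) module set"
    and star :: "('h, 'v) module \<Rightarrow> ('v \<Rightarrow> 'k) set"
    and K :: "('k, 'h, 'c::ring_1) completion" +
  assumes cscale_mult_left: "cscale K c (X * Y) = cscale K c X * Y"
    and cscale_mult_right: "cscale K c (X * Y) = X * cscale K c Y"
    and incl_hom: "incl K \<in> hom (HH H) (additive_group UNIV)"
    and incl_inj: "inj_on (incl K) (carrier (HH H))"
    and incl_scale: "x \<in> carrier (HH H) \<Longrightarrow> incl K (HH_scale H c x) = cscale K c (incl K x)"
    and incl_mult: "x \<in> carrier (HH H) \<Longrightarrow> y \<in> carrier (HH H) \<Longrightarrow>
      incl K (HH_mult H x y) = incl K x * incl K y"
    and incl_one: "incl K (hpure H 1 1) = 1"
    and slice_linear: "f \<in> coeffs_cat H C star \<Longrightarrow>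
      Vector_Spaces.linear (cscale K) (hscale H) (slice K f)"
    and slice_add: "f \<in> coeffs_cat H C star \<Longrightarrow> g \<in> coeffs_cat H C star \<Longrightarrow>
      slice K (f + g) X = slice K f X + slice K g X"
    and slice_scale: "f \<in> coeffs_cat H C star \<Longrightarrow>
      slice K (\<lambda>x. c * f x) X = hscale H c (slice K f X)"
    and slice_incl: "f \<in> coeffs_cat H C star \<Longrightarrow>
      slice K f (incl K (hpure H a b)) = hscale H (f a) b"
    and slice_mult: "f \<in> coeffs_cat H C star \<Longrightarrow>
      slice K f (incl K (hpure H a b) * X * incl K (hpure H a' b'))
      = b * slice K (dual_left a' (dual_right f a)) X * b'"

definition A_set :: "('k::field, 'h::ring_1) hopf \<Rightarrow> ('k, 'h, 'c::ring_1) completion \<Rightarrow> 'c set" where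
  "A_set H K = {P. \<forall>h.
     P * incl K (sweedler H (HH H) (\<lambda>a b. hpure H (antipode H (antipode H a)) b) h)
     = incl K (comult H h) * P}"

definition Phi :: "('k, 'h, 'c) completion \<Rightarrow> 'c \<Rightarrow> ('h \<Rightarrow> 'k) \<Rightarrow> 'h" where
  "Phi K P f = slice K f P"


section \<open>The Grothendieck group of \<open>C\<^sup>f\<^sup>i\<^sup>n\<close>\<close>

definition fin_objects :: "('k::field, 'h::ring_1) hopf \<Rightarrow> ('h, 'v) module set
    \<Rightarrow> ('h, 'v) module set" where
  "fin_objects H C = {V \<in> C. fin_dim H V}"

definition K0_null :: "('h, 'v) module set \<Rightarrow> (('h, 'v) module \<Rightarrow>\<^sub>0 int) set" where
  "K0_null E = generate (free_Abelian_group E)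
     {frag_of V - frag_of U - frag_of W | U V W.
        U \<in> E \<and> V \<in> E \<and> W \<in> E \<and> (\<exists>i p. short_exact U i V p W)}"

definition K0 :: "('h, 'v) module set \<Rightarrow> (('h, 'v) module \<Rightarrow>\<^sub>0 int) set monoid" where
  "K0 E = free_Abelian_group E Mod K0_null E"

definition K0_class :: "('h, 'v) module set \<Rightarrow> ('h, 'v) module \<Rightarrow> (('h, 'v) module \<Rightarrow>\<^sub>0 int) set" where
  "K0_class E V = K0_null E #>\<^bsub>free_Abelian_group E\<^esub> frag_of V"

end

theory Submission
  imports Defs
begin

text \<open>
  Sweedler sums of balanced maps are finite list sums, so identities in Hopf algebras reduce to
  coassociativity for trilinear maps. Write \<open>E a b\<close> for \<open>a \<otimes> b\<close> in the completion. Inserting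
  \<open>h\<^sub>(\<^sub>2\<^sub>) S(h\<^sub>(\<^sub>3\<^sub>))\<close> and using \<open>P \<in> A(H)\<close> gives
  \<open>P (S\<^sup>2(h) \<otimes> 1) = \<Delta>(h\<^sub>(\<^sub>1\<^sub>)) P (1 \<otimes> S(h\<^sub>(\<^sub>2\<^sub>)))\<close>, and multiplying by \<open>S(h\<^sub>(\<^sub>1\<^sub>)) \<otimes> 1\<close> from the left
  yields \<open>(S(h\<^sub>(\<^sub>1\<^sub>)) \<otimes> 1) P (S\<^sup>2(h\<^sub>(\<^sub>2\<^sub>)) \<otimes> 1) = (1 \<otimes> h\<^sub>(\<^sub>1\<^sub>)) P (1 \<otimes> S(h\<^sub>(\<^sub>2\<^sub>)))\<close>. Applying \<open>f \<otimes> 1\<close> is the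
  equivariance of \<open>\<Phi>\<^sub>P\<close>. If \<open>f\<close> is invariant, then \<open>h \<diamond> f = \<epsilon>(h) f\<close>, so \<open>z = \<Phi>\<^sub>P(f)\<close> is
  \<open>ad\<close>-invariant and \<open>h z = h\<^sub>(\<^sub>1\<^sub>) z S(h\<^sub>(\<^sub>2\<^sub>)) h\<^sub>(\<^sub>3\<^sub>) = z h\<close>. Finally \<open>z\<^sub>V\<close> is the trace on \<open>V\<close>: it is
  invariant because traces are symmetric, and it is additive on short exact sequences.
\<close>

section \<open>Balanced maps and tensor products\<close>

text \<open>Elements of tensor products are cosets of formal sums, and \<open>tensor_lift\<close> is
  meaningful only for balanced maps into a commutative group. So every map placed under a coproduct
  has to be shown balanced, nested ones included; the tensor and Sweedler lemmas exist to make this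
  cheap.

  The twist by S^2 matches \<open>slice_mult\<close>: left multiplication by x \<otimes> 1 becomes
  the right action of x on f, and right multiplication becomes the left action. Hence S^2(h2) acting
  on f from the left and S(h1) from the right correspond to (S(h1) \<otimes> 1) P (S^2(h2) \<otimes>
  1), and the factor S(h1) \<otimes> 1 is the one that cancels the first leg of a coproduct: S(h1)
  h2 \<otimes> h3 = 1 \<otimes> h.

  Two points about traces need care. The canonical element is formed over D(V), where scalars can be
  moved across the tensor sign because multiplication by a scalar is H-linear. And the section of a
  short exact sequence is only k-linear, so H acts on the middle term by block triangular matrices;
  the off-diagonal block does not meet the trace.\<close>

lemma (in comm_group) frag_eval_hom:
  assumes "F \<in> S \<rightarrow> carrier G"
  shows "(\<lambda>p. \<Otimes>x\<in>Poly_Mapping.keys p. F x [^] Poly_Mapping.lookup p x) \<in> hom (free_Abelian_group S) G"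
    (is "?E \<in> _")
proof (rule homI)
  \<comment> \<open>Each product runs over the support of its own formal sum, and the supports of p,
    q and p + q differ. Off the support the exponent is 0, so all three can be taken over one common
    finite set.\<close>
  have ext: "?E p = (\<Otimes>x\<in>K. F x [^] Poly_Mapping.lookup p x)"
    if "finite K" "Poly_Mapping.keys p \<subseteq> K" "K \<subseteq> S" for p K
    by (rule finprod_mono_neutral_cong_left)
      (use that assms in \<open>auto simp: in_keys_iff intro!: int_pow_closed\<close>)
  fix p q
  assume p: "p \<in> carrier (free_Abelian_group S)" and q: "q \<in> carrier (free_Abelian_group S)"
  from ext[of "Poly_Mapping.keys p" p] p assms show "?E p \<in> carrier G"
    by (auto intro!: finprod_closed int_pow_closed)
  let ?K = "Poly_Mapping.keys p \<union> Poly_Mapping.keys q"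
  have K: "finite ?K" "?K \<subseteq> S" using p q by auto
  have FK: "F x \<in> carrier G" if "x \<in> ?K" for x using that K assms by auto
  have "?E (p + q) = (\<Otimes>x\<in>?K. F x [^] Poly_Mapping.lookup (p + q) x)"
    by (rule ext) (use K keys_add[of p q] in auto)
  also have "\<dots> = (\<Otimes>x\<in>?K. F x [^] Poly_Mapping.lookup p x \<otimes> F x [^] Poly_Mapping.lookup q x)"
    using FK by (intro finprod_cong') (auto simp: lookup_add int_pow_mult intro!: m_closed int_pow_closed)
  also have "\<dots> = (\<Otimes>x\<in>?K. F x [^] Poly_Mapping.lookup p x) \<otimes> (\<Otimes>x\<in>?K. F x [^] Poly_Mapping.lookup q x)"
    using FK by (intro finprod_multf) (auto intro!: int_pow_closed)
  also have "(\<Otimes>x\<in>?K. F x [^] Poly_Mapping.lookup p x) = ?E p" by (rule ext[symmetric]) (use K in auto)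
  also have "(\<Otimes>x\<in>?K. F x [^] Poly_Mapping.lookup q x) = ?E q" by (rule ext[symmetric]) (use K in auto)
  finally show "?E (p \<otimes>\<^bsub>free_Abelian_group S\<^esub> q) = ?E p \<otimes> ?E q" by simp
qed

lemma (in comm_group) frag_eval_of:
  assumes "F x \<in> carrier G"
  shows "(\<Otimes>y\<in>Poly_Mapping.keys (frag_of x). F y [^] Poly_Mapping.lookup (frag_of x) y) = F x"
  using assms by (simp add: finprod_singleton)

text \<open>These conditions make evaluation of formal sums kill \<open>tensor_relators\<close>, so
  that the image of a coset in \<open>tensor_lift\<close> is a singleton and \<open>the_elem\<close>
  returns a definite value.\<close>

definition balanced :: "('a, 'm) monoid_scheme \<Rightarrow> ('b, 'n) monoid_scheme \<Rightarrow> 'd set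
    \<Rightarrow> ('a \<Rightarrow> 'd \<Rightarrow> 'a) \<Rightarrow> ('d \<Rightarrow> 'b \<Rightarrow> 'b) \<Rightarrow> ('g, 'l) monoid_scheme \<Rightarrow> ('a \<Rightarrow> 'b \<Rightarrow> 'g) \<Rightarrow> bool" where
  "balanced A B D ra la G F \<longleftrightarrow>
     (\<forall>a\<in>carrier A. \<forall>b\<in>carrier B. F a b \<in> carrier G) \<and>
     (\<forall>a\<in>carrier A. \<forall>a'\<in>carrier A. \<forall>b\<in>carrier B. F (a \<otimes>\<^bsub>A\<^esub> a') b = F a b \<otimes>\<^bsub>G\<^esub> F a' b) \<and>
     (\<forall>a\<in>carrier A. \<forall>b\<in>carrier B. \<forall>b'\<in>carrier B. F a (b \<otimes>\<^bsub>B\<^esub> b') = F a b \<otimes>\<^bsub>G\<^esub> F a b') \<and>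
     (\<forall>a\<in>carrier A. \<forall>d\<in>D. \<forall>b\<in>carrier B. F (ra a d) b = F a (la d b))"

lemma balancedI:
  assumes "\<And>a b. a \<in> carrier A \<Longrightarrow> b \<in> carrier B \<Longrightarrow> F a b \<in> carrier G"
    and "\<And>a a' b. a \<in> carrier A \<Longrightarrow> a' \<in> carrier A \<Longrightarrow> b \<in> carrier B \<Longrightarrow>
      F (a \<otimes>\<^bsub>A\<^esub> a') b = F a b \<otimes>\<^bsub>G\<^esub> F a' b"
    and "\<And>a b b'. a \<in> carrier A \<Longrightarrow> b \<in> carrier B \<Longrightarrow> b' \<in> carrier B \<Longrightarrow>
      F a (b \<otimes>\<^bsub>B\<^esub> b') = F a b \<otimes>\<^bsub>G\<^esub> F a b'"
    and "\<And>a d b. a \<in> carrier A \<Longrightarrow> d \<in> D \<Longrightarrow> b \<in> carrier B \<Longrightarrow> F (ra a d) b = F a (la d b)"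
  shows "balanced A B D ra la G F"
  using assms by (simp add: balanced_def)

lemma balancedD:
  assumes "balanced A B D ra la G F"
  shows "a \<in> carrier A \<Longrightarrow> b \<in> carrier B \<Longrightarrow> F a b \<in> carrier G"
    and "a \<in> carrier A \<Longrightarrow> a' \<in> carrier A \<Longrightarrow> b \<in> carrier B \<Longrightarrow>
      F (a \<otimes>\<^bsub>A\<^esub> a') b = F a b \<otimes>\<^bsub>G\<^esub> F a' b"
    and "a \<in> carrier A \<Longrightarrow> b \<in> carrier B \<Longrightarrow> b' \<in> carrier B \<Longrightarrow>
      F a (b \<otimes>\<^bsub>B\<^esub> b') = F a b \<otimes>\<^bsub>G\<^esub> F a b'"
    and "a \<in> carrier A \<Longrightarrow> d \<in> D \<Longrightarrow> b \<in> carrier B \<Longrightarrow> F (ra a d) b = F a (la d b)"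
  using assms by (simp_all add: balanced_def)

locale tensor_product = A: comm_group A + B: comm_group B
  for A :: "('a, 'm) monoid_scheme" and B :: "('b, 'n) monoid_scheme" +
  fixes D :: "'d set" and ra :: "'a \<Rightarrow> 'd \<Rightarrow> 'a" and la :: "'d \<Rightarrow> 'b \<Rightarrow> 'b"
  assumes ra_closed: "a \<in> carrier A \<Longrightarrow> d \<in> D \<Longrightarrow> ra a d \<in> carrier A"
    and la_closed: "b \<in> carrier B \<Longrightarrow> d \<in> D \<Longrightarrow> la d b \<in> carrier B"
begin

abbreviation "AB \<equiv> carrier A \<times> carrier B"
abbreviation "N \<equiv> tensor_null A B D ra la"
abbreviation "T \<equiv> tensor A B D ra la"
abbreviation "tens \<equiv> pure_tensor A B D ra la"

interpretation free: comm_group "free_Abelian_group AB"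
  by (rule abelian_free_Abelian_group)

lemma relators_closed: "tensor_relators A B D ra la \<subseteq> carrier (free_Abelian_group AB)"
  unfolding tensor_relators_def
  by (auto simp: ra_closed la_closed dest!: subsetD[OF keys_diff] split: if_splits)

lemma N_subgroup: "subgroup N (free_Abelian_group AB)"
  unfolding tensor_null_def by (rule free.generate_is_subgroup[OF relators_closed])

lemma N_normal: "N \<lhd> free_Abelian_group AB"
  using N_subgroup by (simp add: free.normal_iff_subgroup)

lemma tensor_comm_group: "comm_group T"
  unfolding tensor_def by (rule free.abelian_FactGroup[OF N_subgroup])

lemma T_carrierE:
  assumes "X \<in> carrier T"
  obtains p where "Poly_Mapping.keys p \<subseteq> AB" "X = N #>\<^bsub>free_Abelian_group AB\<^esub> p"
  using assms unfolding tensor_def by (auto simp: carrier_FactGroup)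

lemma coset_closed: "Poly_Mapping.keys p \<subseteq> AB \<Longrightarrow> N #>\<^bsub>free_Abelian_group AB\<^esub> p \<in> carrier T"
  by (auto simp: tensor_def carrier_FactGroup)

lemma coset_mult:
  "Poly_Mapping.keys p \<subseteq> AB \<Longrightarrow> Poly_Mapping.keys q \<subseteq> AB \<Longrightarrow>
   (N #>\<^bsub>free_Abelian_group AB\<^esub> p) \<otimes>\<^bsub>T\<^esub> (N #>\<^bsub>free_Abelian_group AB\<^esub> q)
     = N #>\<^bsub>free_Abelian_group AB\<^esub> (p + q)"
  using normal.rcos_sum[OF N_normal, of p q] by (simp add: tensor_def)

lemma coset_eqI:
  assumes "Poly_Mapping.keys p \<subseteq> AB" "Poly_Mapping.keys q \<subseteq> AB" "p - q \<in> N"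
  shows "N #>\<^bsub>free_Abelian_group AB\<^esub> p = N #>\<^bsub>free_Abelian_group AB\<^esub> q"
proof -
  have "p \<in> N #>\<^bsub>free_Abelian_group AB\<^esub> q"
    using assms(3) by (force simp: r_coset_def)
  then show ?thesis
    using free.repr_independence[OF _ _ N_subgroup] assms(2) by simp
qed

lemma tens_closed: "a \<in> carrier A \<Longrightarrow> b \<in> carrier B \<Longrightarrow> tens a b \<in> carrier T"
  unfolding pure_tensor_def by (rule coset_closed) simp

lemma relator_in_N: "x \<in> tensor_relators A B D ra la \<Longrightarrow> x \<in> N"
  unfolding tensor_null_def by (rule generate.incl)

lemma tens_balanced: "balanced A B D ra la T tens"
proof (rule balancedI)
  fix a a' b assume *: "a \<in> carrier A" "a' \<in> carrier A" "b \<in> carrier B"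
  have "frag_of (a \<otimes>\<^bsub>A\<^esub> a', b) - frag_of (a, b) - frag_of (a', b) \<in> N"
    by (rule relator_in_N) (use * in \<open>auto simp: tensor_relators_def\<close>)
  then have "N #>\<^bsub>free_Abelian_group AB\<^esub> frag_of (a \<otimes>\<^bsub>A\<^esub> a', b)
      = N #>\<^bsub>free_Abelian_group AB\<^esub> (frag_of (a, b) + frag_of (a', b))"
    by (intro coset_eqI) (use * keys_add in \<open>force simp: algebra_simps\<close>)+
  with * show "tens (a \<otimes>\<^bsub>A\<^esub> a') b = tens a b \<otimes>\<^bsub>T\<^esub> tens a' b"
    by (simp add: pure_tensor_def coset_mult)
next
  fix a b b' assume *: "a \<in> carrier A" "b \<in> carrier B" "b' \<in> carrier B"
  have "frag_of (a, b \<otimes>\<^bsub>B\<^esub> b') - frag_of (a, b) - frag_of (a, b') \<in> N"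
    by (rule relator_in_N) (use * in \<open>auto simp: tensor_relators_def\<close>)
  then have "N #>\<^bsub>free_Abelian_group AB\<^esub> frag_of (a, b \<otimes>\<^bsub>B\<^esub> b')
      = N #>\<^bsub>free_Abelian_group AB\<^esub> (frag_of (a, b) + frag_of (a, b'))"
    by (intro coset_eqI) (use * keys_add in \<open>force simp: algebra_simps\<close>)+
  with * show "tens a (b \<otimes>\<^bsub>B\<^esub> b') = tens a b \<otimes>\<^bsub>T\<^esub> tens a b'"
    by (simp add: pure_tensor_def coset_mult)
next
  fix a d b assume *: "a \<in> carrier A" "d \<in> D" "b \<in> carrier B"
  have "frag_of (ra a d, b) - frag_of (a, la d b) \<in> N"
    by (rule relator_in_N) (use * in \<open>unfold tensor_relators_def, blast\<close>)
  with * show "tens (ra a d) b = tens a (la d b)"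
    unfolding pure_tensor_def by (intro coset_eqI) (auto simp: ra_closed la_closed)
qed (rule tens_closed)

text \<open>Inverses of pure tensors are pure, which is why \<open>tensor_induct\<close> has no case
  for inverses.\<close>

lemma inv_tens:
  assumes "a \<in> carrier A" "b \<in> carrier B"
  shows "inv\<^bsub>T\<^esub> (tens a b) = tens (inv\<^bsub>A\<^esub> a) b"
proof -
  interpret T: comm_group T by (rule tensor_comm_group)
  have o: "tens \<one>\<^bsub>A\<^esub> b = \<one>\<^bsub>T\<^esub>"
    using balancedD(2)[OF tens_balanced, of "\<one>\<^bsub>A\<^esub>" "\<one>\<^bsub>A\<^esub>" b] assms tens_closed[of "\<one>\<^bsub>A\<^esub>" b]
    by (simp add: T.l_cancel_one)
  have "tens (inv\<^bsub>A\<^esub> a) b \<otimes>\<^bsub>T\<^esub> tens a b = \<one>\<^bsub>T\<^esub>"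
    using balancedD(2)[OF tens_balanced, of "inv\<^bsub>A\<^esub> a" a b] assms by (simp add: o)
  then show ?thesis
    using assms by (intro T.inv_equality) (auto simp: tens_closed)
qed

lemma tensor_induct [consumes 1, case_names one mult]:
  assumes "X \<in> carrier T"
    and one: "P \<one>\<^bsub>T\<^esub>"
    and mult: "\<And>a b X. a \<in> carrier A \<Longrightarrow> b \<in> carrier B \<Longrightarrow> X \<in> carrier T \<Longrightarrow> P X \<Longrightarrow>
      P (tens a b \<otimes>\<^bsub>T\<^esub> X)"
  shows "P X"
proof -
  interpret T: comm_group T by (rule tensor_comm_group)
  \<comment> \<open>Induction on formal sums proceeds by differences. The claim is therefore
    strengthened: translation by the class of p and translation by its inverse both preserve
    P.\<close>
  define Q where "Q p \<longleftrightarrow> (\<forall>Y\<in>carrier T. P Y \<longrightarrow>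
      P ((N #>\<^bsub>free_Abelian_group AB\<^esub> p) \<otimes>\<^bsub>T\<^esub> Y) \<and>
      P (inv\<^bsub>T\<^esub> (N #>\<^bsub>free_Abelian_group AB\<^esub> p) \<otimes>\<^bsub>T\<^esub> Y))" for p
  obtain p where p: "Poly_Mapping.keys p \<subseteq> AB" "X = N #>\<^bsub>free_Abelian_group AB\<^esub> p"
    using assms(1) by (rule T_carrierE)
  have N: "N #>\<^bsub>free_Abelian_group AB\<^esub> 0 = \<one>\<^bsub>T\<^esub>"
    using free.coset_mult_one[OF subgroup.subset[OF N_subgroup]] by (simp add: tensor_def)
  have "Q p"
  proof (rule free_Abelian_group_induct[OF p(1)])
    show "Q 0" by (simp add: Q_def N)
  next
    fix x y :: "'a \<times> 'b \<Rightarrow>\<^sub>0 int"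
    assume xy: "Poly_Mapping.keys x \<subseteq> AB" "Poly_Mapping.keys y \<subseteq> AB" "Q x" "Q y"
    have [simp]: "N #>\<^bsub>free_Abelian_group AB\<^esub> x \<in> carrier T" "N #>\<^bsub>free_Abelian_group AB\<^esub> y \<in> carrier T"
      using xy by (simp_all add: coset_closed)
    have d: "Poly_Mapping.keys (x - y) \<subseteq> AB" using xy keys_diff[of x y] by auto
    have "(N #>\<^bsub>free_Abelian_group AB\<^esub> (x - y)) \<otimes>\<^bsub>T\<^esub> (N #>\<^bsub>free_Abelian_group AB\<^esub> y)
        = N #>\<^bsub>free_Abelian_group AB\<^esub> x"
      using xy d by (simp add: coset_mult)
    then have e: "N #>\<^bsub>free_Abelian_group AB\<^esub> (x - y)
       = (N #>\<^bsub>free_Abelian_group AB\<^esub> x) \<otimes>\<^bsub>T\<^esub> inv\<^bsub>T\<^esub> (N #>\<^bsub>free_Abelian_group AB\<^esub> y)"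
      using coset_closed[OF d] by (metis T.inv_solve_right \<open>N #>\<^bsub>free_Abelian_group AB\<^esub> x \<in> carrier T\<close> \<open>N #>\<^bsub>free_Abelian_group AB\<^esub> y \<in> carrier T\<close>)
    show "Q (x - y)"
      using xy(3,4) unfolding Q_def e
      by (simp add: T.m_assoc T.inv_mult_group T.m_lcomm)
  next
    fix x assume x: "x \<in> AB"
    obtain a b where [simp]: "x = (a, b)" and ab: "a \<in> carrier A" "b \<in> carrier B"
      using x by (cases x) auto
    have "N #>\<^bsub>free_Abelian_group AB\<^esub> frag_of x = tens a b" by (simp add: pure_tensor_def)
    then show "Q (frag_of x)"
      using mult ab by (simp add: Q_def inv_tens)
  qed
  then show ?thesis
    using one p coset_closed[OF p(1)] unfolding Q_def by (metis T.one_closed T.r_one)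
qed

section \<open>Universal property of the tensor product\<close>

context
  fixes G :: "('g, 'l) monoid_scheme" and F
  assumes G: "comm_group G" and F: "balanced A B D ra la G F"
begin

interpretation G: comm_group G by (rule G)

private definition E :: "('a \<times> 'b \<Rightarrow>\<^sub>0 int) \<Rightarrow> 'g" where
  "E p = (\<Otimes>\<^bsub>G\<^esub>x\<in>Poly_Mapping.keys p. F (fst x) (snd x) [^]\<^bsub>G\<^esub> Poly_Mapping.lookup p x)"

private lemma E_hom: "E \<in> hom (free_Abelian_group AB) G"
  using G.frag_eval_hom[of "\<lambda>x. F (fst x) (snd x)" AB] balancedD(1)[OF F]
  by (auto simp: E_def[abs_def] Pi_iff)

private lemma E_frag_of: "a \<in> carrier A \<Longrightarrow> b \<in> carrier B \<Longrightarrow> E (frag_of (a, b)) = F a b"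
  using G.frag_eval_of[of "\<lambda>x. F (fst x) (snd x)" "(a, b)"] balancedD(1)[OF F]
  by (simp add: E_def)

interpretation E: group_hom "free_Abelian_group AB" G E
  by unfold_locales (rule E_hom)

private lemma E_diff:
  assumes "Poly_Mapping.keys p \<subseteq> AB" "Poly_Mapping.keys q \<subseteq> AB"
  shows "E (p - q) = E p \<otimes>\<^bsub>G\<^esub> inv\<^bsub>G\<^esub> E q"
  using E.hom_mult[of p "-q"] E.hom_inv[of q] assms by simp

text \<open>The kernel of E is a subgroup, so only the generating relators have to be checked; each
  family of relators is one of the balancedness conditions.\<close>

private lemma E_N: "N \<subseteq> kernel (free_Abelian_group AB) G E"
  unfolding tensor_null_def
proof (rule free.generate_subgroup_incl[OF _ E.subgroup_kernel], rule subsetI)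
  fix x assume x: "x \<in> tensor_relators A B D ra la"
  then have "Poly_Mapping.keys x \<subseteq> AB" using relators_closed[THEN subsetD, OF x] by simp
  moreover from x have "E x = \<one>\<^bsub>G\<^esub>"
  proof -
    have aux: "E (frag_of (a, b) - frag_of (c, d) - frag_of (e, f)) = F a b \<otimes>\<^bsub>G\<^esub> inv\<^bsub>G\<^esub> F c d \<otimes>\<^bsub>G\<^esub> inv\<^bsub>G\<^esub> F e f"
      if "a \<in> carrier A" "c \<in> carrier A" "e \<in> carrier A" "b \<in> carrier B" "d \<in> carrier B" "f \<in> carrier B"
      for a b c d e f
    proof -
      have "Poly_Mapping.keys (frag_of (a, b) - frag_of (c, d)) \<subseteq> AB"
        using that keys_diff[of "frag_of (a,b)" "frag_of (c,d)"] by auto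
      then show ?thesis using that by (simp add: E_diff E_frag_of)
    qed
    have can: "x \<otimes>\<^bsub>G\<^esub> y \<otimes>\<^bsub>G\<^esub> inv\<^bsub>G\<^esub> x \<otimes>\<^bsub>G\<^esub> inv\<^bsub>G\<^esub> y = \<one>\<^bsub>G\<^esub>"
      if "x \<in> carrier G" "y \<in> carrier G" for x y
      using that by (simp add: G.m_assoc G.inv_mult_group G.m_comm[of y])
    from x show ?thesis
      unfolding tensor_relators_def
    proof (elim UnE CollectE exE conjE)
      fix a a' b assume "x = frag_of (a \<otimes>\<^bsub>A\<^esub> a', b) - frag_of (a, b) - frag_of (a', b)"
        "a \<in> carrier A" "a' \<in> carrier A" "b \<in> carrier B"
      then show ?thesis by (simp add: aux balancedD[OF F] can)
    next
      fix a b b' assume "x = frag_of (a, b \<otimes>\<^bsub>B\<^esub> b') - frag_of (a, b) - frag_of (a, b')"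
        "a \<in> carrier A" "b \<in> carrier B" "b' \<in> carrier B"
      then show ?thesis by (simp add: aux balancedD[OF F] can)
    next
      fix a d b assume "x = frag_of (ra a d, b) - frag_of (a, la d b)"
        "a \<in> carrier A" "d \<in> D" "b \<in> carrier B"
      then show ?thesis
        by (simp add: E_diff E_frag_of ra_closed la_closed balancedD(1,4)[OF F])
    qed
  qed
  ultimately show "x \<in> kernel (free_Abelian_group AB) G E" by (simp add: kernel_def)
qed

text \<open>By \<open>E_N\<close> the evaluation is constant on cosets, so the image taken in
  \<open>tensor_lift\<close> is the singleton of E p.\<close>

private lemma lift_coset:
  assumes "Poly_Mapping.keys p \<subseteq> AB"
  shows "tensor_lift G F (N #>\<^bsub>free_Abelian_group AB\<^esub> p) = E p"
proof -
  have "E y = E p" if "y \<in> N #>\<^bsub>free_Abelian_group AB\<^esub> p" for y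
  proof -
    from that obtain n where n: "n \<in> N" "y = n + p" unfolding r_coset_def by auto
    then have "n \<in> kernel (free_Abelian_group AB) G E" using E_N by blast
    then show ?thesis using n E.hom_mult[of n p] E.hom_closed[of p] assms by (auto simp: kernel_def)
  qed
  moreover have "p \<in> N #>\<^bsub>free_Abelian_group AB\<^esub> p"
    using free.rcos_self[OF _ N_subgroup] assms by simp
  ultimately have "E ` (N #>\<^bsub>free_Abelian_group AB\<^esub> p) = {E p}" by blast
  moreover have "tensor_lift G F X = the_elem (E ` X)" for X
    unfolding tensor_lift_def E_def ..
  ultimately show ?thesis by simp
qed

lemma lift_tens:
  "a \<in> carrier A \<Longrightarrow> b \<in> carrier B \<Longrightarrow> tensor_lift G F (tens a b) = F a b"
  unfolding pure_tensor_def by (simp add: lift_coset E_frag_of)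

lemma lift_hom: "tensor_lift G F \<in> hom T G"
proof (rule homI)
  fix X Y assume X: "X \<in> carrier T" and Y: "Y \<in> carrier T"
  from X obtain p where p: "Poly_Mapping.keys p \<subseteq> AB" "X = N #>\<^bsub>free_Abelian_group AB\<^esub> p"
    by (rule T_carrierE)
  from Y obtain q where q: "Poly_Mapping.keys q \<subseteq> AB" "Y = N #>\<^bsub>free_Abelian_group AB\<^esub> q"
    by (rule T_carrierE)
  have "Poly_Mapping.keys (p + q) \<subseteq> AB" using p q keys_add[of p q] by auto
  then show "tensor_lift G F (X \<otimes>\<^bsub>T\<^esub> Y) = tensor_lift G F X \<otimes>\<^bsub>G\<^esub> tensor_lift G F Y"
    using E.hom_mult[of p q] p q by (simp add: coset_mult lift_coset)
next
  fix X assume "X \<in> carrier T"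
  then obtain p where "Poly_Mapping.keys p \<subseteq> AB" "X = N #>\<^bsub>free_Abelian_group AB\<^esub> p"
    by (rule T_carrierE)
  then show "tensor_lift G F X \<in> carrier G" using E.hom_closed by (simp add: lift_coset)
qed

end

lemma hom_eqI:
  assumes "group G" "\<phi> \<in> hom T G" "\<psi> \<in> hom T G" "X \<in> carrier T"
    and "\<And>a b. a \<in> carrier A \<Longrightarrow> b \<in> carrier B \<Longrightarrow> \<phi> (tens a b) = \<psi> (tens a b)"
  shows "\<phi> X = \<psi> X"
proof -
  interpret T: comm_group T by (rule tensor_comm_group)
  have o: "\<phi> \<one>\<^bsub>T\<^esub> = \<one>\<^bsub>G\<^esub>" "\<psi> \<one>\<^bsub>T\<^esub> = \<one>\<^bsub>G\<^esub>" using assms hom_one T.is_group by blast+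
  show ?thesis
    using assms(4) by (induction rule: tensor_induct)
      (use assms(5) o hom_mult[OF assms(2)] hom_mult[OF assms(3)] in \<open>auto simp: tens_closed\<close>)
qed

end

section \<open>Additive groups of types, and list sums in them\<close>

lemma additive_group_simps [simp]:
  "carrier (additive_group A) = A"
  "x \<otimes>\<^bsub>additive_group A\<^esub> y = x + y"
  "\<one>\<^bsub>additive_group A\<^esub> = 0"
  by (simp_all add: additive_group_def)

lemma comm_group_additive_group:
  assumes "0 \<in> A" "\<And>x y. x \<in> A \<Longrightarrow> y \<in> A \<Longrightarrow> x + y \<in> A" "\<And>x. x \<in> A \<Longrightarrow> - x \<in> A"
  shows "comm_group (additive_group A)"
  by (rule comm_groupI) (use assms in \<open>auto simp: add_ac intro: bexI[of _ "- x" for x]\<close>)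

lemma comm_group_additive_UNIV [simp]: "comm_group (additive_group UNIV)"
  by (rule comm_group_additive_group) auto

lemma group_additive_UNIV [simp]: "group (additive_group UNIV)"
  using comm_group_additive_UNIV comm_group_def by blast

lemma additive_hom_sum_list:
  fixes \<phi> :: "'a::ab_group_add \<Rightarrow> 'b::ab_group_add"
  assumes "\<And>x y. \<phi> (x + y) = \<phi> x + \<phi> y"
  shows "\<phi> (\<Sum>x\<leftarrow>xs. f x) = (\<Sum>x\<leftarrow>xs. \<phi> (f x))"
proof -
  have "\<phi> 0 = 0" using assms[of 0 0] by simp
  then show ?thesis by (induction xs) (auto simp: assms)
qed

lemma sum_list_swap:
  fixes f :: "'a \<Rightarrow> 'b \<Rightarrow> 'c::comm_monoid_add"
  shows "(\<Sum>x\<leftarrow>xs. \<Sum>y\<leftarrow>ys. f x y) = (\<Sum>y\<leftarrow>ys. \<Sum>x\<leftarrow>xs. f x y)"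
  by (induction xs) (auto simp: sum_list_addf)

context tensor_product
begin

lemma tensor_list:
  assumes "X \<in> carrier T"
  shows "\<exists>xs. set xs \<subseteq> AB \<and> X = foldr (\<lambda>(a, b) Y. tens a b \<otimes>\<^bsub>T\<^esub> Y) xs \<one>\<^bsub>T\<^esub>"
  using assms
proof (induction rule: tensor_induct)
  case one
  show ?case by (intro exI[of _ "[]"]) simp
next
  case (mult a b X)
  from mult(4) obtain xs where "set xs \<subseteq> AB" "X = foldr (\<lambda>(a, b) Y. tens a b \<otimes>\<^bsub>T\<^esub> Y) xs \<one>\<^bsub>T\<^esub>" by blast
  with mult show ?case by (intro exI[of _ "(a, b) # xs"]) simp
qed

lemma lift_eqI:
  assumes "comm_group G" "balanced A B D ra la G F" "balanced A B D ra la G F'"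
    and "\<And>a b. a \<in> carrier A \<Longrightarrow> b \<in> carrier B \<Longrightarrow> F a b = F' a b" "X \<in> carrier T"
  shows "tensor_lift G F X = tensor_lift G F' X"
proof (rule hom_eqI)
  show "group G" using assms(1) by (rule comm_group.axioms)
qed (use assms in \<open>simp_all add: lift_tens lift_hom\<close>)

lemma hom_lift:
  assumes "comm_group G" "group G'" "balanced A B D ra la G F" "\<phi> \<in> hom G G'" "\<psi> \<in> hom T G'"
    and "\<And>a b. a \<in> carrier A \<Longrightarrow> b \<in> carrier B \<Longrightarrow> \<phi> (F a b) = \<psi> (tens a b)" "X \<in> carrier T"
  shows "\<phi> (tensor_lift G F X) = \<psi> X"
proof -
  have "\<phi> \<circ> tensor_lift G F \<in> hom T G'"
    by (rule hom_compose[OF lift_hom[OF assms(1,3)] assms(4)])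
  from hom_eqI[OF assms(2) this assms(5,7)] show ?thesis
    by (simp add: lift_tens[OF assms(1,3)] assms(6))
qed

text \<open>Meant for F that depends additively on a parameter: the lift is then additive in that
  parameter, as balancedness of nested lifts requires.\<close>

lemma lift_mult:
  assumes "comm_group G" "balanced A B D ra la G F1" "balanced A B D ra la G F2"
    "balanced A B D ra la G F"
    and "\<And>a b. a \<in> carrier A \<Longrightarrow> b \<in> carrier B \<Longrightarrow> F a b = F1 a b \<otimes>\<^bsub>G\<^esub> F2 a b" "X \<in> carrier T"
  shows "tensor_lift G F X = tensor_lift G F1 X \<otimes>\<^bsub>G\<^esub> tensor_lift G F2 X"
proof -
  interpret G: comm_group G by fact
  note h = lift_hom[OF assms(1,2)] lift_hom[OF assms(1,3)]
  have "(\<lambda>X. tensor_lift G F1 X \<otimes>\<^bsub>G\<^esub> tensor_lift G F2 X) \<in> hom T G"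
    using h by (auto simp: hom_def Pi_iff G.m_ac)
  from hom_eqI[OF G.is_group lift_hom[OF assms(1,4)] this assms(6)] show ?thesis
    by (simp add: lift_tens[OF assms(1,2)] lift_tens[OF assms(1,3)] lift_tens[OF assms(1,4)] assms(5))
qed

end

section \<open>Sweedler sums\<close>

context hopf_algebra
begin

abbreviation "hbal \<equiv> balanced (additive_group UNIV) (additive_group UNIV) UNIV
  (\<lambda>a c. hscale H c a) (hscale H)"

abbreviation "U \<equiv> additive_group UNIV"

sublocale HH: tensor_product "additive_group UNIV" "additive_group UNIV" UNIV
  "\<lambda>a c. hscale H c a" "hscale H"
  rewrites "tensor (additive_group UNIV) (additive_group UNIV) UNIV (\<lambda>a c. hscale H c a) (hscale H) = HH H"
    and "pure_tensor (additive_group UNIV) (additive_group UNIV) UNIV (\<lambda>a c. hscale H c a) (hscale H) = hpure H"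
proof -
  show "tensor_product (additive_group UNIV) (additive_group UNIV) (UNIV :: 'k set)
    (\<lambda>a c. hscale H c a) (hscale H)"
    by (intro tensor_product.intro tensor_product_axioms.intro) auto
qed (simp_all add: HH_def hpure_def)

lemma hpure_simps:
  "hpure H (a + a') b = hpure H a b \<otimes>\<^bsub>HH H\<^esub> hpure H a' b"
  "hpure H a (b + b') = hpure H a b \<otimes>\<^bsub>HH H\<^esub> hpure H a b'"
  "hpure H (hscale H c a) b = hpure H a (hscale H c b)"
  using HH.tens_balanced by (auto simp: balanced_def)

lemma hpure_closed [simp]: "hpure H a b \<in> carrier (HH H)"
  using HH.tens_closed by simp

lemma hscale_commute: "hscale H c (hscale H d x) = hscale H d (hscale H c x)"
  by (simp add: mult.commute)

lemma HH_scale_balanced: "hbal (HH H) (\<lambda>a b. hpure H (hscale H c a) b)"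
  by (rule balancedI) (simp_all add: hpure_simps scale_right_distrib mult.commute)

lemma HH_scale_hom: "HH_scale H c \<in> hom (HH H) (HH H)"
  unfolding HH_scale_def by (rule HH.lift_hom[OF HH.tensor_comm_group HH_scale_balanced])

lemma HH_scale_closed [simp]: "X \<in> carrier (HH H) \<Longrightarrow> HH_scale H c X \<in> carrier (HH H)"
  using HH_scale_hom by (rule hom_in_carrier)

lemma HH_scale_hpure [simp]: "HH_scale H c (hpure H a b) = hpure H (hscale H c a) b"
  unfolding HH_scale_def by (simp add: HH.lift_tens[OF HH.tensor_comm_group HH_scale_balanced])

text \<open>Shows how a scalar applied to a coproduct reaches F; this supplies the scalar condition
  for nested lifts.\<close>

lemma lift_HH_scale:
  assumes "comm_group G" "hbal G F" "X \<in> carrier (HH H)"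
  shows "tensor_lift G F (HH_scale H c X) = tensor_lift G (\<lambda>a b. F (hscale H c a) b) X"
proof -
  have "hbal G (\<lambda>a b. F (hscale H c a) b)"
    using assms(2) by (auto simp: balanced_def scale_right_distrib mult.commute simp flip: scale_scale)
      (metis hscale_commute)
  note b = this
  have "group G" using assms(1) by (rule comm_group.axioms)
  from HH.hom_lift[OF HH.tensor_comm_group this HH_scale_balanced HH.lift_hom[OF assms(1,2)]
      HH.lift_hom[OF assms(1) b] _ assms(3)]
  show ?thesis
    by (simp add: HH_scale_def HH.lift_tens[OF assms(1,2)] HH.lift_tens[OF assms(1) b])
qed

sublocale HHH: tensor_product "additive_group UNIV" "HH H" UNIV "\<lambda>a c. hscale H c a" "HH_scale H"
  rewrites "tensor (additive_group UNIV) (HH H) UNIV (\<lambda>a c. hscale H c a) (HH_scale H) = HHH H"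
    and "pure_tensor (additive_group UNIV) (HH H) UNIV (\<lambda>a c. hscale H c a) (HH_scale H) = hpure3 H"
proof -
  show "tensor_product (additive_group UNIV) (HH H) UNIV (\<lambda>a c. hscale H c a) (HH_scale H)"
    by (intro tensor_product.intro tensor_product_axioms.intro HH.tensor_comm_group) auto
qed (simp_all add: HHH_def hpure3_def)

lemma hpure3_simps:
  "X \<in> carrier (HH H) \<Longrightarrow> hpure3 H (a + a') X = hpure3 H a X \<otimes>\<^bsub>HHH H\<^esub> hpure3 H a' X"
  "X \<in> carrier (HH H) \<Longrightarrow> Y \<in> carrier (HH H) \<Longrightarrow>
    hpure3 H a (X \<otimes>\<^bsub>HH H\<^esub> Y) = hpure3 H a X \<otimes>\<^bsub>HHH H\<^esub> hpure3 H a Y"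
  "X \<in> carrier (HH H) \<Longrightarrow> hpure3 H (hscale H c a) X = hpure3 H a (HH_scale H c X)"
  using HHH.tens_balanced by (auto simp: balanced_def)

lemma comult_closed [simp]: "comult H h \<in> carrier (HH H)"
  using hom_in_carrier[OF comult_hom] by simp

lemma comult_add: "comult H (g + h) = comult H g \<otimes>\<^bsub>HH H\<^esub> comult H h"
  using hom_mult[OF comult_hom] by simp

text \<open>The list carries neither signs nor multiplicities: a pure tensor may be repeated, and
  its inverse is again pure.\<close>

definition sweedler_pairs :: "'h \<Rightarrow> ('h \<times> 'h) list" where
  "sweedler_pairs h = (SOME xs. comult H h = foldr (\<lambda>(a, b) Y. hpure H a b \<otimes>\<^bsub>HH H\<^esub> Y) xs \<one>\<^bsub>HH H\<^esub>)"

lemma comult_sweedler_pairs: "comult H h = foldr (\<lambda>(a, b) Y. hpure H a b \<otimes>\<^bsub>HH H\<^esub> Y) (sweedler_pairs h) \<one>\<^bsub>HH H\<^esub>"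
  unfolding sweedler_pairs_def using someI_ex HH.tensor_list[OF comult_closed[of h]] by (smt (verit, best))

text \<open>\<open>sw F h\<close> is the Sweedler sum \<open>F h\<^sub>(\<^sub>1\<^sub>) h\<^sub>(\<^sub>2\<^sub>)\<close>; it depends on the choice in \<open>sweedler_pairs\<close> unless
  \<open>F\<close> is balanced.\<close>

definition sw :: "('h \<Rightarrow> 'h \<Rightarrow> 'g::ab_group_add) \<Rightarrow> 'h \<Rightarrow> 'g" where
  "sw F h = (\<Sum>(a, b)\<leftarrow>sweedler_pairs h. F a b)"

text \<open>The bridge from cosets to lists: a homomorphism on H \<otimes> H sees only the element
  that the chosen list represents. Every passage from \<open>comult\<close> or
  \<open>sweedler\<close> to \<open>sw\<close> rests on this.\<close>

lemma hom_comult: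
  assumes "\<psi> \<in> hom (HH H) (additive_group UNIV)"
  shows "\<psi> (comult H h) = sw (\<lambda>a b. \<psi> (hpure H a b)) h"
proof -
  have g: "group (HH H)" using HH.tensor_comm_group by (rule comm_group.axioms)
  have "foldr (\<lambda>(a, b) Y. hpure H a b \<otimes>\<^bsub>HH H\<^esub> Y) xs \<one>\<^bsub>HH H\<^esub> \<in> carrier (HH H) \<and>
    \<psi> (foldr (\<lambda>(a, b) Y. hpure H a b \<otimes>\<^bsub>HH H\<^esub> Y) xs \<one>\<^bsub>HH H\<^esub>) = (\<Sum>(a, b)\<leftarrow>xs. \<psi> (hpure H a b))" for xs
    using hom_mult[OF assms] hom_one[OF assms g] by (induction xs) auto
  from this[of "sweedler_pairs h"] comult_sweedler_pairs[of h] show ?thesis by (simp add: sw_def)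
qed

lemma hom_sweedler:
  assumes "comm_group G" "hbal G F" "\<phi> \<in> hom G (additive_group UNIV)"
  shows "\<phi> (sweedler H G F h) = sw (\<lambda>a b. \<phi> (F a b)) h"
  using hom_comult[of "\<phi> \<circ> tensor_lift G F" h] HH.lift_hom[OF assms(1,2)] assms
  by (simp add: sweedler_def hom_compose HH.lift_tens)

lemma lift_comult: "hbal U F \<Longrightarrow> tensor_lift U F (comult H h) = sw F h"
  using hom_comult[OF HH.lift_hom[OF comm_group_additive_UNIV, of F]]
  by (simp add: HH.lift_tens[OF comm_group_additive_UNIV])

lemma sweedler_sw: "hbal U F \<Longrightarrow> sweedler H U F h = sw F h"
  by (simp add: sweedler_def lift_comult)

text \<open>This lemma and the next three only rearrange fixed lists. Balancedness enters where the
  lists of different elements have to be related, as in \<open>sw_add\<close>,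
  \<open>sw_coassoc\<close> and \<open>sw_mult\<close>.\<close>

lemma sw_hom:
  assumes "\<And>x y. \<phi> (x + y) = \<phi> x + \<phi> y"
  shows "\<phi> (sw F h) = sw (\<lambda>a b. \<phi> (F a b)) h"
  unfolding sw_def by (simp add: additive_hom_sum_list[OF assms] case_prod_unfold)

lemma sw_cong: "(\<And>a b. F a b = G a b) \<Longrightarrow> sw F h = sw G h"
  by (simp add: sw_def)

lemma sw_plus: "sw (\<lambda>a b. F a b + G a b) h = sw F h + sw G h"
  by (simp add: sw_def case_prod_unfold sum_list_addf)

lemma sw_swap: "sw (\<lambda>a b. sw (F a b) g) h = sw (\<lambda>c d. sw (\<lambda>a b. F a b c d) h) g"
  by (simp add: sw_def case_prod_unfold sum_list_swap[of _ "sweedler_pairs h"])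

lemma sw_add: "hbal U F \<Longrightarrow> sw F (g + h) = sw F g + sw F h"
  using hom_mult[OF HH.lift_hom, of U F "comult H g" "comult H h"]
  by (simp add: comult_add flip: lift_comult)

lemma hbalU_iff:
  "hbal U F \<longleftrightarrow> (\<forall>a a' b. F (a + a') b = F a b + F a' b) \<and> (\<forall>a b b'. F a (b + b') = F a b + F a b')
     \<and> (\<forall>c a b. F (hscale H c a) b = F a (hscale H c b))"
  by (auto simp: balanced_def)

definition trilin :: "('h \<Rightarrow> 'h \<Rightarrow> 'h \<Rightarrow> 'g::ab_group_add) \<Rightarrow> bool" where
  "trilin T \<longleftrightarrow> (\<forall>a. hbal U (T a)) \<and> (\<forall>b. hbal U (\<lambda>a. T a b)) \<and> (\<forall>c. hbal U (\<lambda>a b. T a b c))"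

text \<open>A scalar passes from the first to the third argument through the second, so two scalar
  conditions serve all three pairs of variables.\<close>

lemma trilinI:
  assumes "\<And>a a' b c. T (a + a') b c = T a b c + T a' b c"
    and "\<And>a b b' c. T a (b + b') c = T a b c + T a b' c"
    and "\<And>a b c c'. T a b (c + c') = T a b c + T a b c'"
    and "\<And>k a b c. T (hscale H k a) b c = T a (hscale H k b) c"
    and "\<And>k a b c. T a (hscale H k b) c = T a b (hscale H k c)"
  shows "trilin T"
  using assms by (simp add: trilin_def hbalU_iff)

text \<open>T induces a homomorphism \<psi> on H \<otimes> (H \<otimes> H), and applying \<psi> to
  \<open>coassoc\<close> gives the claim. The facts \<open>b1\<close> to \<open>b4\<close> say that
  all the nested maps involved are balanced.\<close>

lemma sw_coassoc:
  fixes T :: "'h \<Rightarrow> 'h \<Rightarrow> 'h \<Rightarrow> 'g::ab_group_add"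
  assumes "trilin T"
  shows "sw (\<lambda>a b. sw (\<lambda>c d. T c d b) a) h = sw (\<lambda>a b. sw (\<lambda>c d. T a c d) b) h"
proof -
  note [simp] = HHH.tensor_comm_group HH.tensor_comm_group
  have Ta: "hbal U (T a)" for a using assms by (simp add: trilin_def)
  have T: "T (a + a') b c = T a b c + T a' b c" "T (hscale H k a) b c = T a (hscale H k b) c" for a a' b c k
    using assms by (simp_all add: trilin_def hbalU_iff)
  have pc: "hpure3 H a X \<in> carrier (HHH H)" if "X \<in> carrier (HH H)" for a X
    using HHH.tens_closed that by simp
  have b1: "hbal (HHH H) (\<lambda>c d. hpure3 H c (hpure H d b))" for b
    by (rule balancedI) (simp_all add: pc hpure3_simps hpure_simps(1))
  note l1 = HH.lift_hom[OF HHH.tensor_comm_group b1]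
  have b2: "hbal (HHH H) (\<lambda>a b. sweedler H (HHH H) (\<lambda>c d. hpure3 H c (hpure H d b)) a)"
    unfolding sweedler_def
  proof (rule balancedI)
    fix a b show "tensor_lift (HHH H) (\<lambda>c d. hpure3 H c (hpure H d b)) (comult H a) \<in> carrier (HHH H)"
      using hom_in_carrier[OF l1] by simp
  next
    fix a a' b show "tensor_lift (HHH H) (\<lambda>c d. hpure3 H c (hpure H d b)) (comult H (a \<otimes>\<^bsub>U\<^esub> a'))
      = tensor_lift (HHH H) (\<lambda>c d. hpure3 H c (hpure H d b)) (comult H a)
        \<otimes>\<^bsub>HHH H\<^esub> tensor_lift (HHH H) (\<lambda>c d. hpure3 H c (hpure H d b)) (comult H a')"
      using hom_mult[OF l1] by (simp add: comult_add)
  next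
    fix a b b' show "tensor_lift (HHH H) (\<lambda>c d. hpure3 H c (hpure H d (b \<otimes>\<^bsub>U\<^esub> b'))) (comult H a)
      = tensor_lift (HHH H) (\<lambda>c d. hpure3 H c (hpure H d b)) (comult H a)
        \<otimes>\<^bsub>HHH H\<^esub> tensor_lift (HHH H) (\<lambda>c d. hpure3 H c (hpure H d b')) (comult H a)"
      by (rule HH.lift_mult[OF _ b1 b1 b1]) (simp_all add: hpure_simps(2) hpure3_simps)
  next
    fix a b :: 'h and k :: 'k
    \<comment> \<open>The coproduct is k-linear, so the scalar k lands on the first factor of the
      coproduct of a; from there it moves across both tensor signs to b.\<close>
    have "hbal (HHH H) (\<lambda>c d. hpure3 H (hscale H k c) (hpure H d b))"
      by (rule balancedI) (simp_all add: pc hpure3_simps hpure_simps(1) scale_right_distrib mult.commute)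
    then show "tensor_lift (HHH H) (\<lambda>c d. hpure3 H c (hpure H d b)) (comult H (hscale H k a))
      = tensor_lift (HHH H) (\<lambda>c d. hpure3 H c (hpure H d (hscale H k b))) (comult H a)"
      unfolding comult_hscale lift_HH_scale[OF HHH.tensor_comm_group b1 comult_closed]
      by (intro HH.lift_eqI[OF _ _ b1]) (simp_all add: hpure3_simps hpure_simps(3))
  qed
  have b3: "hbal (HHH H) (\<lambda>a b. hpure3 H a (comult H b))"
    by (rule balancedI) (simp_all add: pc hpure3_simps comult_add comult_hscale)
  have b4: "balanced U (HH H) UNIV (\<lambda>a c. hscale H c a) (HH_scale H) U (\<lambda>a. tensor_lift U (T a))"
  proof (rule balancedI)
    fix a a' X assume "X \<in> carrier (HH H)"
    then show "tensor_lift U (T (a \<otimes>\<^bsub>U\<^esub> a')) X = tensor_lift U (T a) X \<otimes>\<^bsub>U\<^esub> tensor_lift U (T a') X"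
      by (intro HH.lift_mult[OF _ Ta Ta Ta]) (simp_all add: T)
  next
    fix a X Y assume "X \<in> carrier (HH H)" "Y \<in> carrier (HH H)"
    then show "tensor_lift U (T a) (X \<otimes>\<^bsub>HH H\<^esub> Y) = tensor_lift U (T a) X \<otimes>\<^bsub>U\<^esub> tensor_lift U (T a) Y"
      by (rule hom_mult[OF HH.lift_hom[OF comm_group_additive_UNIV Ta]])
  next
    fix a k X assume X: "X \<in> carrier (HH H)"
    have e: "T (hscale H k a) = (\<lambda>b. T a (hscale H k b))"
      by (intro ext T)
    with Ta[of "hscale H k a"] have "hbal U (\<lambda>b. T a (hscale H k b))" by simp
    with X show "tensor_lift U (T (hscale H k a)) X = tensor_lift U (T a) (HH_scale H k X)"
      by (simp add: lift_HH_scale[OF _ Ta] e)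
  qed simp
  define \<psi> where "\<psi> = tensor_lift U (\<lambda>a. tensor_lift U (T a))"
  have \<psi>: "\<psi> \<in> hom (HHH H) U" unfolding \<psi>_def by (rule HHH.lift_hom[OF comm_group_additive_UNIV b4])
  have p: "\<psi> (hpure3 H a X) = tensor_lift U (T a) X" if "X \<in> carrier (HH H)" for a X
    using that by (simp add: \<psi>_def HHH.lift_tens[OF comm_group_additive_UNIV b4])
  have "sw (\<lambda>a b. sw (\<lambda>c d. T c d b) a) h
    = \<psi> (sweedler H (HHH H) (\<lambda>a b. sweedler H (HHH H) (\<lambda>c d. hpure3 H c (hpure H d b)) a) h)"
    by (simp add: hom_sweedler[OF HHH.tensor_comm_group b2 \<psi>] hom_sweedler[OF HHH.tensor_comm_group b1 \<psi>] p
      HH.lift_tens[OF comm_group_additive_UNIV Ta])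
  also have "\<dots> = sw (\<lambda>a b. sw (\<lambda>c d. T a c d) b) h"
    unfolding coassoc by (simp add: hom_sweedler[OF HHH.tensor_comm_group b3 \<psi>] p lift_comult[OF Ta])
  finally show ?thesis .
qed

text \<open>The homomorphism induced by F is applied to \<open>comult_mult\<close>; as in
  \<open>sw_coassoc\<close>, the work lies in the balancedness of the nested lifts.\<close>

lemma sw_mult:
  fixes F :: "'h \<Rightarrow> 'h \<Rightarrow> 'g::ab_group_add"
  assumes F: "hbal U F"
  shows "sw F (g * h) = sw (\<lambda>a b. sw (\<lambda>c d. F (a * c) (b * d)) h) g"
proof -
  note [simp] = HH.tensor_comm_group
  have b1: "hbal (HH H) (\<lambda>c d. hpure H (a * c) (b * d))" for a b
    by (rule balancedI) (simp_all add: distrib_left hpure_simps flip: hscale_mult_right)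
  have b2: "hbal (HH H) (\<lambda>a b. tensor_lift (HH H) (\<lambda>c d. hpure H (a * c) (b * d)) X)"
    if X: "X \<in> carrier (HH H)" for X
  proof (rule balancedI)
    fix a b show "tensor_lift (HH H) (\<lambda>c d. hpure H (a * c) (b * d)) X \<in> carrier (HH H)"
      using hom_in_carrier[OF HH.lift_hom[OF HH.tensor_comm_group b1] X] .
  next
    fix a a' b show "tensor_lift (HH H) (\<lambda>c d. hpure H ((a \<otimes>\<^bsub>U\<^esub> a') * c) (b * d)) X
      = tensor_lift (HH H) (\<lambda>c d. hpure H (a * c) (b * d)) X
        \<otimes>\<^bsub>HH H\<^esub> tensor_lift (HH H) (\<lambda>c d. hpure H (a' * c) (b * d)) X"
      by (rule HH.lift_mult[OF _ b1 b1 b1 _ X]) (simp_all add: distrib_right hpure_simps)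
  next
    fix a b b' show "tensor_lift (HH H) (\<lambda>c d. hpure H (a * c) ((b \<otimes>\<^bsub>U\<^esub> b') * d)) X
      = tensor_lift (HH H) (\<lambda>c d. hpure H (a * c) (b * d)) X
        \<otimes>\<^bsub>HH H\<^esub> tensor_lift (HH H) (\<lambda>c d. hpure H (a * c) (b' * d)) X"
      by (rule HH.lift_mult[OF _ b1 b1 b1 _ X]) (simp_all add: distrib_right hpure_simps)
  next
    fix a b :: 'h and k :: 'k
    show "tensor_lift (HH H) (\<lambda>c d. hpure H (hscale H k a * c) (b * d)) X
      = tensor_lift (HH H) (\<lambda>c d. hpure H (a * c) (hscale H k b * d)) X"
      by (rule HH.lift_eqI[OF _ b1 b1 _ X]) (simp_all add: hpure_simps flip: hscale_mult_left)
  qed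
  define \<psi> where "\<psi> = tensor_lift U F"
  have \<psi>: "\<psi> \<in> hom (HH H) U" unfolding \<psi>_def by (rule HH.lift_hom[OF comm_group_additive_UNIV F])
  have p: "\<psi> (hpure H a b) = F a b" for a b
    by (simp add: \<psi>_def HH.lift_tens[OF comm_group_additive_UNIV F])
  have "sw F (g * h) = \<psi> (sweedler H (HH H) (\<lambda>a b. sweedler H (HH H) (\<lambda>c d. hpure H (a * c) (b * d)) h) g)"
    by (simp add: \<psi>_def lift_comult[OF F, symmetric] comult_mult HH_mult_def sweedler_def)
  also have "\<dots> = sw (\<lambda>a b. sw (\<lambda>c d. F (a * c) (b * d)) h) g"
    using hom_sweedler[OF HH.tensor_comm_group b2[OF comult_closed] \<psi>] hom_sweedler[OF HH.tensor_comm_group b1 \<psi>]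
    by (simp add: p sweedler_def)
  finally show ?thesis .
qed

lemma sw_one: "hbal U F \<Longrightarrow> sw F 1 = F 1 1"
  by (simp add: comult_one HH.lift_tens flip: lift_comult)

end

section \<open>The antipode\<close>

context hopf_algebra
begin

abbreviation "S \<equiv> antipode H"
abbreviation "\<epsilon> \<equiv> counit H"

lemma S_add: "S (a + b) = S a + S b" and S_scale: "S (hscale H c a) = hscale H c (S a)"
  using antipode_linear
  by (simp_all add: Vector_Spaces.linear_def module_hom_def module_hom_axioms_def)

lemma counit_add: "\<epsilon> (a + b) = \<epsilon> a + \<epsilon> b" and counit_scale: "\<epsilon> (hscale H c a) = c * \<epsilon> a"
  using counit_linear
  by (simp_all add: Vector_Spaces.linear_def module_hom_def module_hom_axioms_def)

lemmas scale_mult = hscale_mult_left[symmetric] hscale_mult_right[symmetric]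
lemmas lin_simps = S_add S_scale counit_add counit_scale scale_mult
  distrib_left distrib_right scale_left_distrib scale_right_distrib

text \<open>The additive map \<phi> is the surrounding expression: with it the counit axiom can be
  applied, in either direction, deep inside a product. The next three lemmas have the same form for
  the same reason.\<close>

lemma sw_counit_left:
  assumes "\<And>x y. \<phi> (x + y) = \<phi> x + \<phi> y"
  shows "sw (\<lambda>a b. \<phi> (hscale H (\<epsilon> a) b)) h = \<phi> h"
proof -
  have "hbal U (\<lambda>a b. hscale H (\<epsilon> a) b)" by (simp add: hbalU_iff lin_simps mult.commute)
  from sweedler_sw[OF this, of h] have "sw (\<lambda>a b. hscale H (\<epsilon> a) b) h = h" by (simp add: counit_left)
  then show ?thesis by (simp flip: sw_hom[of \<phi>, OF assms])
qed

lemma sw_counit_right: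
  assumes "\<And>x y. \<phi> (x + y) = \<phi> x + \<phi> y"
  shows "sw (\<lambda>a b. \<phi> (hscale H (\<epsilon> b) a)) h = \<phi> h"
proof -
  have "hbal U (\<lambda>a b. hscale H (\<epsilon> b) a)" by (simp add: hbalU_iff lin_simps mult.commute)
  from sweedler_sw[OF this, of h] have "sw (\<lambda>a b. hscale H (\<epsilon> b) a) h = h" by (simp add: counit_right)
  then show ?thesis by (simp flip: sw_hom[of \<phi>, OF assms])
qed

lemma sw_antipode_left:
  assumes "\<And>x y. \<phi> (x + y) = \<phi> x + \<phi> y"
  shows "sw (\<lambda>a b. \<phi> (S a * b)) h = \<phi> (hscale H (\<epsilon> h) 1)"
proof -
  have "hbal U (\<lambda>a b. S a * b)" by (simp add: hbalU_iff lin_simps)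
  from sweedler_sw[OF this, of h] have "sw (\<lambda>a b. S a * b) h = hscale H (\<epsilon> h) 1"
    by (simp add: antipode_left)
  then show ?thesis by (simp flip: sw_hom[of \<phi>, OF assms])
qed

lemma sw_antipode_right:
  assumes "\<And>x y. \<phi> (x + y) = \<phi> x + \<phi> y"
  shows "sw (\<lambda>a b. \<phi> (a * S b)) h = \<phi> (hscale H (\<epsilon> h) 1)"
proof -
  have "hbal U (\<lambda>a b. a * S b)" by (simp add: hbalU_iff lin_simps)
  from sweedler_sw[OF this, of h] have "sw (\<lambda>a b. a * S b) h = hscale H (\<epsilon> h) 1"
    by (simp add: antipode_right)
  then show ?thesis by (simp flip: sw_hom[of \<phi>, OF assms])
qed

lemma antipode_one: "S 1 = 1"
proof -
  have "hbal U (\<lambda>a b. S a * b)" by (simp add: hbalU_iff lin_simps)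
  from sw_one[OF this] show ?thesis
    using sw_antipode_left[of "\<lambda>x. x" 1] by (simp add: counit_one)
qed

text \<open>Convolution inverses are unique: as maps of the pair g, h, the left side is a left
  inverse of the product g * h and the right side is a right inverse. \<open>M\<close> is the
  integrand of the triple convolution, which collapses to one side or the other according to the
  bracketing.\<close>

lemma antipode_mult: "S (g * h) = S h * S g"
proof -
  define M where "M g1 g2 g3 h1 h2 h3 = S (g1 * h1) * (g2 * h2) * (S h3 * S g3)" for g1 g2 g3 h1 h2 h3
  have tri_h: "trilin (M g1 g2 g3)" for g1 g2 g3
    by (rule trilinI) (simp_all add: M_def lin_simps)
  have tri_g: "trilin (\<lambda>g1 g2 g3. sw (\<lambda>hl h3. sw (\<lambda>h1 h2. M g1 g2 g3 h1 h2 h3) hl) h)"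
    by (rule trilinI) (simp_all add: M_def lin_simps sw_plus)
  have "S (g * h) = sw (\<lambda>g1 gr. S (hscale H (\<epsilon> gr) g1 * h)) g"
    by (rule sw_counit_right[symmetric]) (simp add: lin_simps)
  also have "\<dots> = sw (\<lambda>g1 gr. sw (\<lambda>g2 g3. S (g1 * h) * (g2 * S g3)) gr) g"
    by (subst sw_antipode_right) (simp_all add: lin_simps)
  also have "\<dots> = sw (\<lambda>g1 gr. sw (\<lambda>g2 g3. sw (\<lambda>h1 hr. S (g1 * hscale H (\<epsilon> hr) h1) * (g2 * S g3)) h) gr) g"
    by (subst sw_counit_right) (simp_all add: lin_simps)
  also have "\<dots> = sw (\<lambda>g1 gr. sw (\<lambda>g2 g3. sw (\<lambda>h1 hr. S (g1 * h1) * g2 * (hscale H (\<epsilon> hr) 1) * S g3) h) gr) g"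
    by (simp add: lin_simps mult.assoc)
  also have "\<dots> = sw (\<lambda>g1 gr. sw (\<lambda>g2 g3. sw (\<lambda>h1 hr. sw (\<lambda>h2 h3. S (g1 * h1) * g2 * (h2 * S h3) * S g3) hr) h) gr) g"
    by (subst sw_antipode_right) (simp_all add: lin_simps)
  also have "\<dots> = sw (\<lambda>g1 gr. sw (\<lambda>g2 g3. sw (\<lambda>h1 hr. sw (\<lambda>h2 h3. M g1 g2 g3 h1 h2 h3) hr) h) gr) g"
    by (simp add: M_def mult.assoc)
  also have "\<dots> = sw (\<lambda>g1 gr. sw (\<lambda>g2 g3. sw (\<lambda>hl h3. sw (\<lambda>h1 h2. M g1 g2 g3 h1 h2 h3) hl) h) gr) g"
    by (simp add: sw_coassoc[OF tri_h])
  also have "\<dots> = sw (\<lambda>gl g3. sw (\<lambda>g1 g2. sw (\<lambda>hl h3. sw (\<lambda>h1 h2. M g1 g2 g3 h1 h2 h3) hl) h) gl) g"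
    by (rule sw_coassoc[OF tri_g, symmetric])
  \<comment> \<open>After the exchange the first two legs of g and of h are innermost. There
    \<open>sw_mult\<close> reads the double sum as a coproduct of gl * hl, to which the antipode
    axiom applies.\<close>
  also have "\<dots> = sw (\<lambda>gl g3. sw (\<lambda>hl h3. sw (\<lambda>g1 g2. sw (\<lambda>h1 h2. M g1 g2 g3 h1 h2 h3) hl) gl) h) g"
    by (subst sw_swap) (rule refl)
  also have "\<dots> = sw (\<lambda>gl g3. sw (\<lambda>hl h3. hscale H (\<epsilon> gl) 1 * (hscale H (\<epsilon> hl) 1 * (S h3 * S g3))) h) g"
  proof -
    have "sw (\<lambda>g1 g2. sw (\<lambda>h1 h2. M g1 g2 g3 h1 h2 h3) hl) gl
      = hscale H (\<epsilon> gl) 1 * (hscale H (\<epsilon> hl) 1 * (S h3 * S g3))" for gl g3 hl h3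
    proof -
      have "hbal U (\<lambda>a b. S a * b * (S h3 * S g3))" by (simp add: hbalU_iff lin_simps)
      from sw_mult[OF this, of gl hl] have "sw (\<lambda>g1 g2. sw (\<lambda>h1 h2. M g1 g2 g3 h1 h2 h3) hl) gl
        = sw (\<lambda>a b. S a * b * (S h3 * S g3)) (gl * hl)" by (simp add: M_def)
      also have "\<dots> = hscale H (\<epsilon> (gl * hl)) 1 * (S h3 * S g3)"
        by (subst sw_antipode_left) (simp_all add: lin_simps)
      finally show ?thesis by (simp add: counit_mult lin_simps)
    qed
    then show ?thesis by simp
  qed
  also have "\<dots> = sw (\<lambda>gl g3. sw (\<lambda>hl h3. S (hscale H (\<epsilon> hl) h3) * S (hscale H (\<epsilon> gl) g3)) h) g"
    by (simp add: lin_simps mult.commute)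
  also have "\<dots> = sw (\<lambda>gl g3. S h * S (hscale H (\<epsilon> gl) g3)) g"
    by (subst sw_counit_left) (simp_all add: lin_simps)
  also have "\<dots> = S h * S g"
    by (subst sw_counit_left) (simp_all add: lin_simps)
  finally show ?thesis .
qed

lemma hbal_ad: "hbal U (\<lambda>a b. a * x * S b)"
  by (simp add: hbalU_iff lin_simps)

lemma ad_act_sw: "ad_act H U (*) (*) h x = sw (\<lambda>a b. a * x * S b) h"
  by (simp add: ad_act_def sweedler_sw[OF hbal_ad])

text \<open>The action is associative because S reverses products: S (b * d) = S d * S b puts the
  factor of h inside that of g.\<close>

lemma adjoint_module: "left_module (adjoint_module H)"
proof -
  interpret abelian_group "adjoint_module H"
    by (rule abelian_groupI) (auto simp: adjoint_module_def add_ac intro: exI[of _ "- x" for x])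
  show ?thesis
  proof
    fix g h x
    have "sw (\<lambda>a b. a * x * S b) (g * h) = sw (\<lambda>a b. sw (\<lambda>c d. (a * c) * x * S (b * d)) h) g"
      by (rule sw_mult[OF hbal_ad])
    also have "\<dots> = sw (\<lambda>a b. sw (\<lambda>c d. a * (c * x * S d) * S b) h) g"
      by (simp add: antipode_mult mult.assoc)
    also have "\<dots> = sw (\<lambda>a b. a * sw (\<lambda>c d. c * x * S d) h * S b) g"
      by (subst sw_hom[where \<phi> = "\<lambda>y. a * y * S b" for a b]) (simp_all add: lin_simps)
    finally show "(g * h) \<odot>\<^bsub>adjoint_module H\<^esub> x
        = g \<odot>\<^bsub>adjoint_module H\<^esub> (h \<odot>\<^bsub>adjoint_module H\<^esub> x)"
      by (simp add: adjoint_module_def ad_act_sw)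
  qed (auto simp: adjoint_module_def ad_act_sw sw_add[OF hbal_ad] sw_one[OF hbal_ad]
      antipode_one lin_simps sw_plus)
qed

end

section \<open>Matrix coefficients\<close>

lemma functional_group_simps [simp]:
  "carrier (functional_group V F) = F"
  "f \<otimes>\<^bsub>functional_group V F\<^esub> g = (\<lambda>v\<in>carrier V. f v + g v)"
  "\<one>\<^bsub>functional_group V F\<^esub> = (\<lambda>v\<in>carrier V. 0)"
  by (simp_all add: functional_group_def)

context hopf_algebra
begin

lemma H_dual_iff:
  "\<xi> \<in> H_dual H \<longleftrightarrow> (\<forall>x y. \<xi> (x + y) = \<xi> x + \<xi> y) \<and> (\<forall>c x. \<xi> (hscale H c x) = c * \<xi> x)"
proof -
  have "vector_space ((*) :: 'k \<Rightarrow> 'k \<Rightarrow> 'k)" by unfold_locales (simp_all add: algebra_simps)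
  then show ?thesis
    using vector_space_axioms
    by (auto simp: H_dual_def Vector_Spaces.linear_def module_hom_def module_hom_axioms_def
      module_iff_vector_space)
qed

lemma comm_group_H_dual: "comm_group (additive_group (H_dual H))"
  by (rule comm_group_additive_group) (auto simp: H_dual_iff algebra_simps)

lemma hscale_one_mult: "hscale H c 1 * h = hscale H c h" "h * hscale H c 1 = hscale H c h"
  by (simp_all flip: hscale_mult_left hscale_mult_right)

text \<open>The element \<open>hscale H c 1\<close> is central in H, so scalars commute with the
  action.\<close>

lemma ksmult_act:
  assumes "left_module V" "v \<in> carrier V"
  shows "ksmult H V c (h \<odot>\<^bsub>V\<^esub> v) = hscale H c h \<odot>\<^bsub>V\<^esub> v" "h \<odot>\<^bsub>V\<^esub> ksmult H V c v = hscale H c h \<odot>\<^bsub>V\<^esub> v"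
  using assms by (simp_all add: ksmult_def hscale_one_mult flip: left_module.act_mult)

lemma dualD:
  assumes "f \<in> dual H V"
  shows "v \<in> carrier V \<Longrightarrow> w \<in> carrier V \<Longrightarrow> f (v \<oplus>\<^bsub>V\<^esub> w) = f v + f w"
    and "v \<in> carrier V \<Longrightarrow> f (ksmult H V c v) = c * f v"
    and "f \<in> extensional (carrier V)"
  using assms by (simp_all add: dual_def)

lemma comm_group_dual:
  assumes "left_module V"
  shows "comm_group (functional_group V (dual H V))"
proof -
  interpret left_module V by fact
  have [simp]: "v \<in> carrier V \<Longrightarrow> ksmult H V c v \<in> carrier V" for v c by (simp add: ksmult_def act_closed)
  show ?thesis
  proof (rule comm_groupI)
    fix f assume f: "f \<in> carrier (functional_group V (dual H V))"
    then have "(\<lambda>v\<in>carrier V. - f v) \<in> dual H V" by (simp add: dual_def)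
    then show "\<exists>g\<in>carrier (functional_group V (dual H V)).
      g \<otimes>\<^bsub>functional_group V (dual H V)\<^esub> f = \<one>\<^bsub>functional_group V (dual H V)\<^esub>"
      by (intro bexI[of _ "\<lambda>v\<in>carrier V. - f v"]) (auto intro!: restrict_ext)
    show "\<one>\<^bsub>functional_group V (dual H V)\<^esub> \<otimes>\<^bsub>functional_group V (dual H V)\<^esub> f = f"
      using f by (auto simp: dual_def intro!: extensionalityI[of _ "carrier V"])
  qed (auto simp: dual_def algebra_simps intro!: restrict_ext)
qed

end

text \<open>The value of \<open>beta\<close> on the pure tensor of v and f (see
  \<open>beta_pure\<close>).\<close>

definition matrix_coeff :: "('h, 'v) module \<Rightarrow> 'v \<Rightarrow> ('v \<Rightarrow> 'k) \<Rightarrow> 'h \<Rightarrow> 'k" where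
  "matrix_coeff V v f = (\<lambda>h. f (h \<odot>\<^bsub>V\<^esub> v))"

context finite_duality_category
begin

lemma star_dual: "V \<in> C \<Longrightarrow> f \<in> star V \<Longrightarrow> f \<in> dual H V"
  using subgroup.subset[OF star_subgroup, of V] by auto

lemma comm_group_star:
  assumes "V \<in> C" shows "comm_group (functional_group V (star V))"
proof -
  interpret d: comm_group "functional_group V (dual H V)"
    by (rule comm_group_dual[OF objects[OF assms]])
  have e: "functional_group V (star V) = (functional_group V (dual H V))\<lparr>carrier := star V\<rparr>"
    by (simp add: functional_group_def)
  have "group (functional_group V (star V))"
    unfolding e by (rule subgroup.subgroup_is_group[OF star_subgroup[OF assms] d.group_axioms])
  then show ?thesis
    by (rule group.group_comm_groupI) (auto simp: add.commute intro!: restrict_ext)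
qed

lemma D_tensor_product:
  assumes "V \<in> C"
  shows "tensor_product (add_monoid V) (functional_group V (star V)) (lmod_hom V V)
    (\<lambda>v \<phi>. \<phi> v) (transpose_map V)"
proof -
  interpret left_module V using objects[OF assms] .
  show ?thesis
    using star_transpose[OF assms assms] comm_group_star[OF assms] a_comm_group
    by (intro tensor_product.intro tensor_product_axioms.intro) (auto simp: lmod_hom_def)
qed

text \<open>Balanced over D(V) because an endomorphism commutes with H: f (h \<phi>(v)) = f
  (\<phi>(h v)).\<close>

lemma beta_balanced:
  assumes "V \<in> C"
  shows "balanced (add_monoid V) (functional_group V (star V)) (lmod_hom V V)
    (\<lambda>v \<phi>. \<phi> v) (transpose_map V) (additive_group (H_dual H)) (matrix_coeff V)"
proof -
  interpret left_module V using objects[OF assms] .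
  note d = dualD[OF star_dual[OF assms]]
  show ?thesis
  proof (rule balancedI)
    fix v f assume "v \<in> carrier (add_monoid V)" "f \<in> carrier (functional_group V (star V))"
    then show "matrix_coeff V v f \<in> carrier (additive_group (H_dual H))"
      by (simp add: H_dual_iff matrix_coeff_def act_add_left act_closed d
        flip: ksmult_act[OF left_module_axioms])
  qed (auto simp: matrix_coeff_def act_closed act_add_right d transpose_map_def lmod_hom_def fun_eq_iff)
qed

lemma beta_matrix_coeff: "beta H V = tensor_lift (additive_group (H_dual H)) (matrix_coeff V)"
  by (simp add: beta_def matrix_coeff_def[abs_def])

lemma beta_pure:
  "V \<in> C \<Longrightarrow> v \<in> carrier V \<Longrightarrow> f \<in> star V \<Longrightarrow> beta H V (D_pure V star v f) = matrix_coeff V v f"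
  unfolding beta_matrix_coeff D_pure_def
  by (subst tensor_product.lift_tens[OF D_tensor_product comm_group_H_dual beta_balanced]) auto

lemma beta_hom: "V \<in> C \<Longrightarrow> beta H V \<in> hom (D_tensor V star) (additive_group (H_dual H))"
  unfolding beta_matrix_coeff D_tensor_def
  by (rule tensor_product.lift_hom[OF D_tensor_product comm_group_H_dual beta_balanced])

lemma D_tensor_comm_group: "V \<in> C \<Longrightarrow> comm_group (D_tensor V star)"
  unfolding D_tensor_def by (rule tensor_product.tensor_comm_group[OF D_tensor_product])

lemma coeffs_zero: "V \<in> C \<Longrightarrow> 0 \<in> coeffs H star V"
  using hom_one[OF beta_hom, of V] D_tensor_comm_group[of V] comm_group_H_dual
  by (force simp: coeffs_def comm_group_def intro!: image_eqI[of _ _ "\<one>\<^bsub>D_tensor V star\<^esub>"]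
      dest: group.is_monoid monoid.one_closed)

lemma coeffs_add:
  assumes "V \<in> C" "x \<in> coeffs H star V" "y \<in> coeffs H star V"
  shows "x + y \<in> coeffs H star V"
proof -
  interpret comm_group "D_tensor V star" by (rule D_tensor_comm_group) fact
  from assms(2,3) obtain X Y where "X \<in> carrier (D_tensor V star)" "Y \<in> carrier (D_tensor V star)"
    "x = beta H V X" "y = beta H V Y" by (auto simp: coeffs_def)
  then show ?thesis
    using hom_mult[OF beta_hom[OF assms(1)], of X Y]
    by (auto simp: coeffs_def intro!: image_eqI[of _ _ "X \<otimes>\<^bsub>D_tensor V star\<^esub> Y"])
qed

abbreviation "HC \<equiv> coeffs_cat H C star"

lemma coeffs_subset: "V \<in> C \<Longrightarrow> coeffs H star V \<subseteq> HC"
  unfolding coeffs_cat_def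
proof (intro subsetI CollectI)
  fix x assume "V \<in> C" "x \<in> coeffs H star V"
  then show "\<exists>F g. x = sum g F \<and> finite F \<and> F \<subseteq> C \<and> (\<forall>V\<in>F. g V \<in> coeffs H star V)"
    by (intro exI[of _ "{V}"] exI[of _ "\<lambda>_. x"]) simp
qed

lemma HC_zero: "0 \<in> HC"
  using zero_object coeffs_zero coeffs_subset by blast

lemma HC_add:
  assumes "x \<in> HC" "y \<in> HC" shows "x + y \<in> HC"
proof -
  from assms obtain F g F' g' where x: "x = sum g F" "finite F" "F \<subseteq> C" "\<forall>V\<in>F. g V \<in> coeffs H star V"
    and y: "y = sum g' F'" "finite F'" "F' \<subseteq> C" "\<forall>V\<in>F'. g' V \<in> coeffs H star V"
    unfolding coeffs_cat_def by blast
  \<comment> \<open>The two index sets may overlap. Both families are extended by 0 to the union,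
    and on a common object the two coefficients add up within its \<open>coeffs\<close>.\<close>
  define k where "k V = (if V \<in> F then g V else 0) + (if V \<in> F' then g' V else 0)" for V
  have "x = (\<Sum>V\<in>F \<union> F'. if V \<in> F then g V else 0)"
    unfolding x(1) by (rule sum.mono_neutral_cong_left) (use x y in auto)
  moreover have "y = (\<Sum>V\<in>F \<union> F'. if V \<in> F' then g' V else 0)"
    unfolding y(1) by (rule sum.mono_neutral_cong_left) (use x y in auto)
  ultimately have "x + y = sum k (F \<union> F')" by (simp add: k_def sum.distrib)
  moreover have "k V \<in> coeffs H star V" if "V \<in> F \<union> F'" for V
    unfolding k_def by (rule coeffs_add) (use x y that coeffs_zero in auto)
  ultimately show ?thesis
    unfolding coeffs_cat_def using x y by (intro CollectI exI[of _ "F \<union> F'"] exI[of _ k]) auto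
qed

lemma matrix_coeff_HC:
  assumes "V \<in> C" "v \<in> carrier V" "f \<in> star V" shows "matrix_coeff V v f \<in> HC"
proof -
  have "D_pure V star v f \<in> carrier (D_tensor V star)"
    unfolding D_pure_def D_tensor_def
    using tensor_product.tens_closed[OF D_tensor_product] assms by simp
  then show ?thesis
    using beta_pure[OF assms] coeffs_subset[OF assms(1)] by (force simp: coeffs_def)
qed

text \<open>Each \<open>coeffs H star V\<close> is the image of a tensor product, so every element
  of \<open>HC\<close> is a finite sum of matrix coefficients. Closure of \<open>HC\<close> under
  both actions and under scalars is then checked on a single coefficient.\<close>

lemma HC_induct [consumes 1, case_names zero add]:
  assumes "b \<in> HC" and zero: "P 0"
    and add: "\<And>V v f b. V \<in> C \<Longrightarrow> v \<in> carrier V \<Longrightarrow> f \<in> star V \<Longrightarrow> P b \<Longrightarrow> P (matrix_coeff V v f + b)"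
  shows "P b"
proof -
  \<comment> \<open>Adding one element of \<open>coeffs H star V\<close> is itself an induction over
    the tensor product, carried out with b as a fixed remainder.\<close>
  have "P (x + b)" if "V \<in> C" "x \<in> coeffs H star V" "P b" for V x b
  proof -
    interpret D: comm_group "D_tensor V star" by (rule D_tensor_comm_group) fact
    from that(2) obtain X where X: "X \<in> carrier (D_tensor V star)" "x = beta H V X"
      by (auto simp: coeffs_def)
    have "P (beta H V X + b)"
    proof (rule tensor_product.tensor_induct[OF D_tensor_product[OF that(1)] X(1)[unfolded D_tensor_def]],
        fold D_tensor_def D_pure_def)
      have "beta H V \<one>\<^bsub>D_tensor V star\<^esub> = 0"
        using hom_one[OF beta_hom[OF that(1)] D.is_group] comm_group_H_dual
        by (simp add: comm_group_def)
      then show "P (beta H V \<one>\<^bsub>D_tensor V star\<^esub> + b)" using that by simp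
    next
      fix v f X
      assume v: "v \<in> carrier (add_monoid V)" and f: "f \<in> carrier (functional_group V (star V))"
        and X: "X \<in> carrier (D_tensor V star)" and P: "P (beta H V X + b)"
      have "D_pure V star v f \<in> carrier (D_tensor V star)"
        unfolding D_pure_def D_tensor_def by (rule tensor_product.tens_closed[OF D_tensor_product[OF that(1)] v f])
      then have "beta H V (D_pure V star v f \<otimes>\<^bsub>D_tensor V star\<^esub> X) = matrix_coeff V v f + beta H V X"
        using hom_mult[OF beta_hom[OF that(1)] _ X] beta_pure[OF that(1), of v f] v f by simp
      then show "P (beta H V (D_pure V star v f \<otimes>\<^bsub>D_tensor V star\<^esub> X) + b)"
        using add[OF that(1) _ _ P] v f by (simp add: add.assoc)
    qed
    with X show ?thesis by simp
  qed
  note step = this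
  from assms(1) obtain F g where F: "b = sum g F" "finite F" "F \<subseteq> C" "\<forall>V\<in>F. g V \<in> coeffs H star V"
    unfolding coeffs_cat_def by blast
  have "P (sum g F)"
    using F(2-4) by (induction F rule: finite_induct) (auto simp: zero intro!: step)
  with F show ?thesis by simp
qed

lemma HC_linear: "b \<in> HC \<Longrightarrow> b \<in> H_dual H"
proof (induction rule: HC_induct)
  case zero show ?case by (simp add: H_dual_iff)
next
  case (add V v f b)
  have "matrix_coeff V v f \<in> H_dual H"
    using balancedD(1)[OF beta_balanced[OF add(1)], of v f] add by simp
  with add(4) show ?case by (auto simp: H_dual_iff algebra_simps)
qed

lemma HC_D:
  assumes "b \<in> HC"
  shows "b (x + y) = b x + b y" "b (hscale H c x) = c * b x"
  using HC_linear[OF assms] by (simp_all add: H_dual_iff)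

text \<open>On matrix coefficients the left action moves the vector, by the action on V. The right
  action in \<open>dual_right_HC\<close> moves the functional, and there \<open>star_ract\<close>
  keeps it in \<open>star V\<close>.\<close>

lemma dual_left_HC: "b \<in> HC \<Longrightarrow> dual_left g b \<in> HC"
proof (induction rule: HC_induct)
  case zero show ?case using HC_zero by (simp add: dual_left_def zero_fun_def)
next
  case (add V v f b)
  interpret left_module V using objects add by simp
  have "dual_left g (matrix_coeff V v f + b) = matrix_coeff V (g \<odot>\<^bsub>V\<^esub> v) f + dual_left g b"
    using add by (auto simp: dual_left_def matrix_coeff_def act_mult)
  moreover have "\<dots> \<in> HC" using add by (intro HC_add matrix_coeff_HC act_closed)
  ultimately show ?case by (simp only:)
qed

lemma dual_right_HC: "b \<in> HC \<Longrightarrow> dual_right b g \<in> HC"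
proof (induction rule: HC_induct)
  case zero show ?case using HC_zero by (simp add: dual_right_def zero_fun_def)
next
  case (add V v f b)
  interpret left_module V using objects add by simp
  have "dual_right (matrix_coeff V v f + b) g = matrix_coeff V v (dual_ract V f g) + dual_right b g"
    using add by (auto simp: dual_right_def matrix_coeff_def act_mult dual_ract_def act_closed)
  moreover have "\<dots> \<in> HC" using add by (intro HC_add matrix_coeff_HC star_ract)
  ultimately show ?case by (simp only:)
qed

lemma scale_HC: "b \<in> HC \<Longrightarrow> (\<lambda>x. c * b x) \<in> HC"
proof (induction rule: HC_induct)
  case zero show ?case using HC_zero by (simp add: zero_fun_def)
next
  case (add V v f b)
  interpret left_module V using objects add by simp
  have "(\<lambda>x. c * (matrix_coeff V v f + b) x) = matrix_coeff V (ksmult H V c v) f + (\<lambda>x. c * b x)"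
  proof
    fix x
    have "c * f (x \<odot>\<^bsub>V\<^esub> v) = f (ksmult H V c (x \<odot>\<^bsub>V\<^esub> v))"
      using add by (simp add: dualD(2)[OF star_dual] act_closed)
    also have "\<dots> = f (x \<odot>\<^bsub>V\<^esub> ksmult H V c v)"
      by (simp only: ksmult_act[OF left_module_axioms add(2)])
    finally show "c * (matrix_coeff V v f + b) x = (matrix_coeff V (ksmult H V c v) f + (\<lambda>x. c * b x)) x"
      by (simp add: matrix_coeff_def distrib_left)
  qed
  moreover have "\<dots> \<in> HC"
    unfolding ksmult_def using add by (intro HC_add matrix_coeff_HC act_closed)
  ultimately show ?case by (simp only:)
qed

lemma HC_uminus: "b \<in> HC \<Longrightarrow> - b \<in> HC"
  using scale_HC[of b "-1"] by (simp add: fun_Compl_def)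

lemma comm_group_HC: "comm_group (additive_group HC)"
  by (rule comm_group_additive_group) (auto intro: HC_zero HC_add HC_uminus)

section \<open>The diamond action on matrix coefficients\<close>

lemma hbal_diamond:
  assumes "b \<in> HC"
  shows "hbal (additive_group HC) (\<lambda>h1 h2. dual_right (dual_left (S (S h2)) b) (S h1))"
  by (rule balancedI, simp add: dual_left_HC dual_right_HC assms)
    (auto simp: dual_left_def dual_right_def lin_simps HC_D[OF assms])

abbreviation "dia \<equiv> diamond_act H (additive_group HC) dual_left dual_right"

text \<open>Evaluation at x is additive, so a Sweedler sum of functions becomes one of scalars and
  identities for the diamond action can be checked pointwise.\<close>

lemma dia_apply:
  assumes "b \<in> HC" shows "dia h b x = sw (\<lambda>a c. b (S a * x * S (S c))) h"
proof -
  have "(\<lambda>f. f x) \<in> hom (additive_group HC) (additive_group UNIV)" by (auto intro: homI)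
  from hom_sweedler[OF comm_group_HC hbal_diamond[OF assms] this]
  show ?thesis by (simp add: diamond_act_def dual_left_def dual_right_def)
qed

lemma dia_closed: "b \<in> HC \<Longrightarrow> dia h b \<in> HC"
  unfolding diamond_act_def sweedler_def
  using hom_in_carrier[OF HH.lift_hom[OF comm_group_HC hbal_diamond] comult_closed] by simp

lemma hbal_dia_apply: "b \<in> HC \<Longrightarrow> hbal U (\<lambda>a c. b (S a * x * S (S c)))"
  by (simp add: hbalU_iff lin_simps HC_D)

lemma diamond_module: "left_module (diamond_module H C star)"
proof -
  interpret abelian_group "diamond_module H C star"
    by (rule abelian_groupI)
      (auto simp: diamond_module_def add_ac HC_zero HC_add intro: bexI[OF _ HC_uminus])
  show ?thesis
  proof
    fix g h b assume b': "b \<in> carrier (diamond_module H C star)"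
    then have b: "b \<in> HC" by (simp add: diamond_module_def)
    then show "h \<odot>\<^bsub>diamond_module H C star\<^esub> b \<in> carrier (diamond_module H C star)"
      by (simp add: diamond_module_def dia_closed)
    show "(g + h) \<odot>\<^bsub>diamond_module H C star\<^esub> b
      = g \<odot>\<^bsub>diamond_module H C star\<^esub> b \<oplus>\<^bsub>diamond_module H C star\<^esub> h \<odot>\<^bsub>diamond_module H C star\<^esub> b"
      by (auto simp: diamond_module_def dia_apply[OF b] sw_add[OF hbal_dia_apply[OF b]])
    show "(g * h) \<odot>\<^bsub>diamond_module H C star\<^esub> b
      = g \<odot>\<^bsub>diamond_module H C star\<^esub> (h \<odot>\<^bsub>diamond_module H C star\<^esub> b)"
    proof -
      \<comment> \<open>S reverses products and S^2 preserves them, so on both sides of x the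
        factors of h end up outside those of g.\<close>
      have "dia (g * h) b x = dia g (dia h b) x" for x
        unfolding dia_apply[OF b] dia_apply[OF dia_closed[OF b]] sw_mult[OF hbal_dia_apply[OF b]]
        by (simp add: antipode_mult mult.assoc)
      then show ?thesis by (simp add: diamond_module_def fun_eq_iff)
    qed
    show "1 \<odot>\<^bsub>diamond_module H C star\<^esub> b = b"
      by (simp add: diamond_module_def fun_eq_iff dia_apply b sw_one[OF hbal_dia_apply[OF b]] antipode_one)
    fix c assume "c \<in> carrier (diamond_module H C star)"
    then have c: "c \<in> HC" by (simp add: diamond_module_def)
    show "h \<odot>\<^bsub>diamond_module H C star\<^esub> (b \<oplus>\<^bsub>diamond_module H C star\<^esub> c)
      = h \<odot>\<^bsub>diamond_module H C star\<^esub> b \<oplus>\<^bsub>diamond_module H C star\<^esub> h \<odot>\<^bsub>diamond_module H C star\<^esub> c"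
      by (simp add: diamond_module_def fun_eq_iff dia_apply b c HC_add sw_plus)
  qed
qed

text \<open>Invariance of b means b (x * y) = b (y * x). So S^2(h2) can be moved to the front of
  S(h1) x, and S^2(h2) S(h1) = S(h1 S(h2)) collapses by the antipode axiom.\<close>

lemma dia_invariant:
  assumes "b \<in> bimod_invariants HC dual_left dual_right"
  shows "dia h b = (\<lambda>x. \<epsilon> h * b x)"
proof
  fix x
  have b: "b \<in> HC" and comm: "b (x * y) = b (y * x)" for x y
    using assms by (auto simp: bimod_invariants_def dual_left_def dual_right_def fun_eq_iff)
  have "dia h b x = sw (\<lambda>a c. b (S (a * S c) * x)) h"
    using comm[of "S a * x" "S (S c)" for a c] by (simp add: dia_apply[OF b] antipode_mult mult.assoc)
  also have "\<dots> = b (S (hscale H (\<epsilon> h) 1) * x)"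
    by (rule sw_antipode_right) (simp add: lin_simps HC_D[OF b])
  also have "\<dots> = \<epsilon> h * b x"
    by (simp add: S_scale antipode_one HC_D[OF b] flip: hscale_mult_left)
  finally show "dia h b x = \<epsilon> h * b x" .
qed

end

section \<open>Equivariance\<close>

locale completed_category = finite_duality_category H C star + completed_square H C star K
  for H :: "('k::field, 'h::ring_1) hopf" and C :: "('h, 'v) module set"
    and star :: "('h, 'v) module \<Rightarrow> ('v \<Rightarrow> 'k) set" and K :: "('k, 'h, 'c::ring_1) completion"
begin

definition E :: "'h \<Rightarrow> 'h \<Rightarrow> 'c" where "E a b = incl K (hpure H a b)"

lemma E_simps:
  "E (a + a') b = E a b + E a' b" "E a (b + b') = E a b + E a b'"
  "E (hscale H c a) b = E a (hscale H c b)" "E a b * E a' b' = E (a * a') (b * b')"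
proof -
  show "E (a + a') b = E a b + E a' b" "E a (b + b') = E a b + E a b'"
    using hom_mult[OF incl_hom] by (simp_all add: E_def hpure_simps)
  show "E (hscale H c a) b = E a (hscale H c b)" by (simp add: E_def hpure_simps)
  have "HH_mult H (hpure H a b) (hpure H a' b') = hpure H (a * a') (b * b')"
  proof -
    have b1: "hbal (HH H) (\<lambda>c d. hpure H (a * c) (b * d))" for a b
      by (rule balancedI) (simp_all add: distrib_left hpure_simps flip: hscale_mult_right)
    have b2: "hbal (HH H) (\<lambda>a b. tensor_lift (HH H) (\<lambda>c d. hpure H (a * c) (b * d)) (hpure H a' b'))"
      unfolding HH.lift_tens[OF HH.tensor_comm_group b1, simplified]
      by (rule balancedI) (simp_all add: distrib_right hpure_simps flip: hscale_mult_left)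
    show ?thesis
      unfolding HH_mult_def
      by (subst HH.lift_tens[OF HH.tensor_comm_group b2]) (simp_all add: HH.lift_tens[OF HH.tensor_comm_group b1])
  qed
  then show "E a b * E a' b' = E (a * a') (b * b')" by (simp add: E_def flip: incl_mult)
qed

lemma E_scale_right: "E a (hscale H c b) = cscale K c (E a b)"
  using incl_scale[of "hpure H a b" c] by (simp add: E_def hpure_simps)

definition \<Delta> :: "'h \<Rightarrow> 'c" where "\<Delta> h = incl K (comult H h)"

lemma \<Delta>_sw: "\<Delta> h = sw E h"
  using hom_comult[OF incl_hom] by (simp add: \<Delta>_def E_def[abs_def])

lemma \<Delta>_simps: "\<Delta> (g + h) = \<Delta> g + \<Delta> h" "\<Delta> (hscale H c h) = cscale K c (\<Delta> h)"
  using hom_mult[OF incl_hom] incl_scale[of "comult H h" c]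
  by (simp_all add: \<Delta>_def comult_add comult_hscale)

text \<open>As rewrite rules these carry a scalar from the first slot of \<open>E\<close> to the
  second and from there out to a leading \<open>cscale\<close>, a normal form that decides the
  scalar conditions for maps into the completion.\<close>

lemmas c_simps = E_simps(1,2) \<Delta>_simps E_scale_right E_simps(3)
  cscale_mult_left[symmetric] cscale_mult_right[symmetric]

text \<open>This is S(h1) h2 \<otimes> h3 = 1 \<otimes> h: after rebracketing, the antipode axiom
  collapses the first slot and the counit axiom absorbs the scalar left over.\<close>

lemma sw_S_\<Delta>: "sw (\<lambda>a b. E (S a) 1 * \<Delta> b) h = E 1 h"
proof -
  have t: "trilin (\<lambda>a c d. E (S a * c) d)"
    by (rule trilinI) (simp_all add: lin_simps c_simps)
  have "sw (\<lambda>a b. E (S a) 1 * \<Delta> b) h = sw (\<lambda>a b. sw (\<lambda>c d. E (S a * c) d) b) h"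
    by (simp add: \<Delta>_sw sw_hom[where \<phi> = "\<lambda>y. E x 1 * y" for x] distrib_left E_simps)
  also have "\<dots> = sw (\<lambda>a b. sw (\<lambda>c d. E (S c * d) b) a) h"
    by (rule sw_coassoc[OF t, symmetric])
  also have "\<dots> = sw (\<lambda>a b. E 1 (hscale H (\<epsilon> a) b)) h"
  proof (rule sw_cong)
    fix a b
    have "sw (\<lambda>c d. E (S c * d) b) a = E (hscale H (\<epsilon> a) 1) b"
      by (rule sw_antipode_left) (simp add: c_simps)
    then show "sw (\<lambda>c d. E (S c * d) b) a = E 1 (hscale H (\<epsilon> a) b)"
      by (simp only: E_simps)
  qed
  also have "\<dots> = E 1 h" by (rule sw_counit_left) (simp add: c_simps)
  finally show ?thesis .
qed

lemma A_setD:
  assumes "P \<in> A_set H K"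
  shows "P * sw (\<lambda>a b. E (S (S a)) b) h = \<Delta> h * P"
proof -
  have b: "hbal (HH H) (\<lambda>a b. hpure H (S (S a)) b)"
    by (rule balancedI) (simp_all add: lin_simps hpure_simps)
  from hom_sweedler[OF HH.tensor_comm_group this incl_hom]
  have "incl K (sweedler H (HH H) (\<lambda>a b. hpure H (S (S a)) b) h) = sw (\<lambda>a b. E (S (S a)) b) h"
    by (simp add: E_def)
  moreover have "P * incl K (sweedler H (HH H) (\<lambda>a b. hpure H (S (S a)) b) h) = \<Delta> h * P"
    using assms by (simp add: A_set_def \<Delta>_def)
  ultimately show ?thesis by (simp only:)
qed

lemma A_set_SS:
  assumes "P \<in> A_set H K"
  shows "P * E (S (S h)) 1 = sw (\<lambda>a b. \<Delta> a * P * E 1 (S b)) h"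
proof -
  have t: "trilin (\<lambda>a c d. P * E (S (S a)) (c * S d))"
    by (rule trilinI) (simp_all add: lin_simps c_simps)
  have "P * E (S (S h)) 1 = sw (\<lambda>a b. P * E (S (S (hscale H (\<epsilon> b) a))) 1) h"
    by (rule sw_counit_right[symmetric]) (simp add: lin_simps c_simps)
  \<comment> \<open>The counit value is expanded as h2 S(h3) in the second slot, so that after
    rebracketing h2 joins S^2(h1) to form the twisted coproduct that P intertwines.\<close>
  also have "\<dots> = sw (\<lambda>a b. sw (\<lambda>c d. P * E (S (S a)) (c * S d)) b) h"
    by (subst sw_antipode_right) (simp_all add: lin_simps c_simps)
  also have "\<dots> = sw (\<lambda>a b. sw (\<lambda>c d. P * E (S (S c)) (d * S b)) a) h"
    by (rule sw_coassoc[OF t, symmetric])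
  also have "\<dots> = sw (\<lambda>a b. \<Delta> a * P * E 1 (S b)) h"
  proof (rule sw_cong)
    fix a b
    have "\<Delta> a * P * E 1 (S b) = P * sw (\<lambda>c d. E (S (S c)) d) a * E 1 (S b)"
      by (simp only: A_setD[OF assms])
    also have "\<dots> = sw (\<lambda>c d. P * E (S (S c)) d * E 1 (S b)) a"
      by (rule sw_hom) (simp add: lin_simps)
    finally show "sw (\<lambda>c d. P * E (S (S c)) (d * S b)) a = \<Delta> a * P * E 1 (S b)"
      by (simp add: mult.assoc E_simps)
  qed
  finally show ?thesis .
qed

lemma A_set_diamond:
  assumes "P \<in> A_set H K"
  shows "sw (\<lambda>a b. E (S a) 1 * P * E (S (S b)) 1) h = sw (\<lambda>a b. E 1 a * P * E 1 (S b)) h"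
proof -
  have t: "trilin (\<lambda>a c d. E (S a) 1 * \<Delta> c * P * E 1 (S d))"
    by (rule trilinI) (simp_all add: lin_simps c_simps)
  have "sw (\<lambda>a b. E (S a) 1 * P * E (S (S b)) 1) h
    = sw (\<lambda>a b. sw (\<lambda>c d. E (S a) 1 * \<Delta> c * P * E 1 (S d)) b) h"
    by (simp add: mult.assoc A_set_SS[OF assms] sw_hom[where \<phi> = "\<lambda>y. E x 1 * y" for x] distrib_left)
  also have "\<dots> = sw (\<lambda>a b. sw (\<lambda>c d. E (S c) 1 * \<Delta> d * P * E 1 (S b)) a) h"
    by (rule sw_coassoc[OF t, symmetric])
  also have "\<dots> = sw (\<lambda>a b. E 1 a * P * E 1 (S b)) h"
    by (simp add: sw_hom[where \<phi> = "\<lambda>y. y * P * E 1 x" for x, symmetric] distrib_right sw_S_\<Delta>)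
  finally show ?thesis .
qed

lemma slice_plus: "f \<in> HC \<Longrightarrow> slice K f (X + Y) = slice K f X + slice K f Y"
  using slice_linear[of f] by (simp add: Vector_Spaces.linear_def module_hom_def module_hom_axioms_def)

lemma Phi_dia:
  assumes "P \<in> A_set H K" "f \<in> HC"
  shows "Phi K P (dia h f) = sw (\<lambda>a b. a * Phi K P f * S b) h"
proof -
  have "(\<lambda>g. slice K g P) \<in> hom (additive_group HC) (additive_group UNIV)"
    by (auto intro!: homI simp: slice_add)
  from hom_sweedler[OF comm_group_HC hbal_diamond[OF assms(2)] this, of h]
  have "Phi K P (dia h f) = sw (\<lambda>a b. slice K (dual_right (dual_left (S (S b)) f) (S a)) P) h"
    by (simp add: Phi_def diamond_act_def)
  \<comment> \<open>\<open>slice_mult\<close> produces the two actions on f in the opposite order.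
    Both orders amount to the same substitution in the argument of f, up to associativity.\<close>
  also have "\<dots> = sw (\<lambda>a b. slice K f (E (S a) 1 * P * E (S (S b)) 1)) h"
    by (simp add: E_def slice_mult[OF assms(2)]) (simp add: dual_left_def dual_right_def mult.assoc)
  also have "\<dots> = sw (\<lambda>a b. slice K f (E 1 a * P * E 1 (S b))) h"
    using A_set_diamond[OF assms(1), of h]
    by (simp add: sw_hom[of "slice K f", symmetric] slice_plus assms(2))
  also have "\<dots> = sw (\<lambda>a b. a * Phi K P f * S b) h"
    by (simp add: E_def slice_mult[OF assms(2)]) (simp add: dual_left_def dual_right_def Phi_def)
  finally show ?thesis .
qed

lemma Phi_add: "f \<in> HC \<Longrightarrow> g \<in> HC \<Longrightarrow> Phi K P (f + g) = Phi K P f + Phi K P g"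
  by (simp add: Phi_def slice_add)

lemma Phi_lmod_hom:
  assumes "P \<in> A_set H K"
  shows "Phi K P \<in> lmod_hom (diamond_module H C star) (adjoint_module H)"
  by (auto simp: lmod_hom_def diamond_module_def adjoint_module_def Phi_add Phi_dia[OF assms] ad_act_sw)

lemma Phi_center:
  assumes "P \<in> A_set H K" "f \<in> bimod_invariants HC dual_left dual_right"
  shows "Phi K P f \<in> ring_center"
proof -
  define z where "z = Phi K P f"
  have f: "f \<in> HC" using assms(2) by (simp add: bimod_invariants_def)
  have ad: "sw (\<lambda>a b. a * z * S b) h = hscale H (\<epsilon> h) z" for h
    using Phi_dia[OF assms(1) f, of h] slice_scale[OF f, of "\<epsilon> h" P]
    by (simp add: dia_invariant[OF assms(2)] z_def Phi_def)
  have "h * z = z * h" for h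
  proof -
    have t: "trilin (\<lambda>a c d. a * z * (S c * d))"
      by (rule trilinI) (simp_all add: lin_simps)
    have "h * z = sw (\<lambda>a b. hscale H (\<epsilon> b) a * z) h"
      by (rule sw_counit_right[symmetric]) (simp add: lin_simps)
    also have "\<dots> = sw (\<lambda>a b. sw (\<lambda>c d. a * z * (S c * d)) b) h"
      by (subst sw_antipode_left) (simp_all add: lin_simps)
    also have "\<dots> = sw (\<lambda>a b. sw (\<lambda>c d. c * z * (S d * b)) a) h"
      by (rule sw_coassoc[OF t, symmetric])
    also have "\<dots> = sw (\<lambda>a b. sw (\<lambda>c d. c * z * S d) a * b) h"
      by (simp add: sw_hom[where \<phi> = "\<lambda>y. y * x" for x] distrib_right mult.assoc)
    also have "\<dots> = sw (\<lambda>a b. z * hscale H (\<epsilon> a) b) h"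
      by (simp add: ad lin_simps)
    also have "\<dots> = z * h" by (rule sw_counit_left) (simp add: lin_simps)
    finally show ?thesis .
  qed
  then have "\<forall>x. z * x = x * z" by metis
  then show ?thesis unfolding ring_center_def z_def by blast
qed

end

section \<open>Dual bases and traces\<close>

lemma hom_finprod_comm_group:
  assumes "comm_group G" "comm_group G'" "\<phi> \<in> hom G G'" "f \<in> A \<rightarrow> carrier G" "finite A"
  shows "\<phi> (finprod G f A) = finprod G' (\<lambda>i. \<phi> (f i)) A"
proof -
  interpret G: comm_group G by fact
  interpret G': comm_group G' by fact
  show ?thesis
    using assms(5,4)
  proof (induction A rule: finite_induct)
    case empty
    show ?case using hom_one[OF assms(3) G.group_axioms G'.group_axioms] by simp
  next
    case (insert x A)
    then have "(\<lambda>i. \<phi> (f i)) \<in> A \<rightarrow> carrier G'" "\<phi> (f x) \<in> carrier G'"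
      using hom_in_carrier[OF assms(3)] by auto
    with insert show ?case by (simp add: hom_mult[OF assms(3)])
  qed
qed

lemma (in comm_group) finprod_swap:
  assumes "finite A" "finite B" "\<And>i j. i \<in> A \<Longrightarrow> j \<in> B \<Longrightarrow> f i j \<in> carrier G"
  shows "(\<Otimes>i\<in>A. \<Otimes>j\<in>B. f i j) = (\<Otimes>j\<in>B. \<Otimes>i\<in>A. f i j)"
  using assms(1,3)
proof (induction A rule: finite_induct)
  case empty then show ?case by simp
next
  case (insert x A)
  have "(\<Otimes>i\<in>insert x A. \<Otimes>j\<in>B. f i j) = (\<Otimes>j\<in>B. f x j) \<otimes> (\<Otimes>j\<in>B. \<Otimes>i\<in>A. f i j)"
    using insert by (simp add: Pi_iff finprod_closed)
  also have "\<dots> = (\<Otimes>j\<in>B. f x j \<otimes> (\<Otimes>i\<in>A. f i j))"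
    using insert by (intro finprod_multf[symmetric]) (auto intro!: finprod_closed)
  also have "\<dots> = (\<Otimes>j\<in>B. \<Otimes>i\<in>insert x A. f i j)"
    using insert by (intro finprod_cong') (auto simp: Pi_iff intro!: finprod_closed)
  finally show ?case .
qed

lemma finprod_additive_group:
  assumes "comm_group (additive_group B)" "finite A" "f \<in> A \<rightarrow> B"
  shows "finprod (additive_group B) f A = sum f A"
proof -
  interpret comm_group "additive_group B" by fact
  show ?thesis
    using assms(2,3) by (induction A rule: finite_induct) (auto simp: finprod_insert)
qed

lemma finsum_hom:
  assumes "abelian_group V" "abelian_group W" "\<phi> \<in> carrier V \<rightarrow> carrier W"
    and "\<And>v w. v \<in> carrier V \<Longrightarrow> w \<in> carrier V \<Longrightarrow> \<phi> (v \<oplus>\<^bsub>V\<^esub> w) = \<phi> v \<oplus>\<^bsub>W\<^esub> \<phi> w"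
    and "finite A" "f \<in> A \<rightarrow> carrier V"
  shows "\<phi> (\<Oplus>\<^bsub>V\<^esub>i\<in>A. f i) = (\<Oplus>\<^bsub>W\<^esub>i\<in>A. \<phi> (f i))"
  unfolding finsum_def
  by (rule hom_finprod_comm_group)
    (use assms in \<open>auto intro!: homI abelian_group.a_comm_group\<close>)

text \<open>Generalizes \<open>dual_bases\<close> to arbitrary finite index sets, so that a basis of
  an extension can be indexed by the disjoint sum \<open>I <+> J\<close>.\<close>

definition dual_family :: "('k::field, 'h::ring_1) hopf \<Rightarrow> ('h, 'v) module \<Rightarrow> 'i set
    \<Rightarrow> ('i \<Rightarrow> 'v) \<Rightarrow> ('i \<Rightarrow> 'v \<Rightarrow> 'k) \<Rightarrow> bool" where
  "dual_family H V I e f \<longleftrightarrow> finite I \<and> e \<in> I \<rightarrow> carrier V \<and> f \<in> I \<rightarrow> dual H V \<and>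
     (\<forall>i\<in>I. \<forall>j\<in>I. f i (e j) = (if i = j then 1 else 0)) \<and>
     (\<forall>v\<in>carrier V. v = (\<Oplus>\<^bsub>V\<^esub>i\<in>I. ksmult H V (f i v) (e i)))"

lemma dual_familyD:
  assumes "dual_family H V I e f"
  shows "finite I" "e \<in> I \<rightarrow> carrier V" "f \<in> I \<rightarrow> dual H V"
    and "i \<in> I \<Longrightarrow> j \<in> I \<Longrightarrow> f i (e j) = (if i = j then 1 else 0)"
    and "v \<in> carrier V \<Longrightarrow> v = (\<Oplus>\<^bsub>V\<^esub>i\<in>I. ksmult H V (f i v) (e i))"
  using assms unfolding dual_family_def by blast+

lemma dual_bases_iff: "dual_bases H V n e f \<longleftrightarrow> dual_family H V {..<n} e f"
  by (auto simp: dual_bases_def dual_family_def)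

locale hopf_module = hopf_algebra H + left_module V
  for H :: "('k::field, 'h::ring_1) hopf" and V :: "('h, 'v) module" (structure)
begin

abbreviation "ks \<equiv> ksmult H V"

lemma ks_closed [simp]: "v \<in> carrier V \<Longrightarrow> ks c v \<in> carrier V"
  by (simp add: ksmult_def act_closed)

lemma ks_simps:
  "v \<in> carrier V \<Longrightarrow> ks (c + d) v = ks c v \<oplus> ks d v"
  "v \<in> carrier V \<Longrightarrow> w \<in> carrier V \<Longrightarrow> ks c (v \<oplus> w) = ks c v \<oplus> ks c w"
  "v \<in> carrier V \<Longrightarrow> ks c (ks d v) = ks (c * d) v"
  "v \<in> carrier V \<Longrightarrow> ks 1 v = v"
  by (simp_all add: ksmult_def act_add_left act_add_right act_one scale_left_distrib hscale_one_mult
      mult.commute flip: act_mult)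

lemma ks_zero [simp]: "v \<in> carrier V \<Longrightarrow> ks 0 v = \<zero>"
  using ks_simps(1)[of v 0 0] by (simp add: add.l_cancel_one)

lemma ks_zero_right [simp]: "ks c \<zero> = \<zero>"
  using ks_simps(2)[of \<zero> \<zero> c] by (simp add: add.l_cancel_one)

lemma ks_finsum:
  "finite I \<Longrightarrow> x \<in> I \<rightarrow> carrier V \<Longrightarrow> ks c (\<Oplus>i\<in>I. x i) = (\<Oplus>i\<in>I. ks c (x i))"
  by (rule finsum_hom) (auto simp: ks_simps abelian_group_axioms)

lemma lincomb_closed [simp]: "e \<in> I \<rightarrow> carrier V \<Longrightarrow> (\<Oplus>i\<in>I. ks (c i) (e i)) \<in> carrier V"
  by (rule finsum_closed) (auto intro!: ks_closed)

lemma lincomb_add: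
  assumes "e \<in> I \<rightarrow> carrier V"
  shows "(\<Oplus>i\<in>I. ks (c i) (e i)) \<oplus> (\<Oplus>i\<in>I. ks (d i) (e i)) = (\<Oplus>i\<in>I. ks (c i + d i) (e i))"
proof -
  have "(\<Oplus>i\<in>I. ks (c i + d i) (e i)) = (\<Oplus>i\<in>I. ks (c i) (e i) \<oplus> ks (d i) (e i))"
    using assms by (intro finsum_cong') (auto simp: ks_simps Pi_iff)
  also have "\<dots> = (\<Oplus>i\<in>I. ks (c i) (e i)) \<oplus> (\<Oplus>i\<in>I. ks (d i) (e i))"
    using assms by (intro finsum_addf) (auto intro!: ks_closed)
  finally show ?thesis ..
qed

lemma lincomb_scale:
  assumes "finite I" "e \<in> I \<rightarrow> carrier V"
  shows "ks k (\<Oplus>i\<in>I. ks (c i) (e i)) = (\<Oplus>i\<in>I. ks (k * c i) (e i))"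
proof -
  have "ks k (\<Oplus>i\<in>I. ks (c i) (e i)) = (\<Oplus>i\<in>I. ks k (ks (c i) (e i)))"
    using assms by (intro ks_finsum) (auto intro!: ks_closed)
  also have "\<dots> = (\<Oplus>i\<in>I. ks (k * c i) (e i))"
    using assms by (intro finsum_cong') (auto simp: ks_simps Pi_iff)
  finally show ?thesis .
qed

lemma lincomb_delta:
  assumes "finite I" "e \<in> I \<rightarrow> carrier V" "j \<in> I"
  shows "(\<Oplus>i\<in>I. ks (if i = j then 1 else 0) (e i)) = e j"
proof -
  have "(\<Oplus>i\<in>I. ks (if i = j then 1 else 0) (e i)) = (\<Oplus>i\<in>I. if j = i then e i else \<zero>)"
    using assms by (intro finsum_cong') (auto simp: ks_simps Pi_iff)
  also have "\<dots> = e j"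
    using finsum_singleton[OF assms(3,1), of e] assms(2) by simp
  finally show ?thesis .
qed

lemma dual_lincomb:
  assumes "f \<in> dual H V" "finite I" "e \<in> I \<rightarrow> carrier V"
  shows "f (\<Oplus>i\<in>I. ks (c i) (e i)) = (\<Sum>i\<in>I. c i * f (e i))"
proof -
  have "f (\<Oplus>i\<in>I. ks (c i) (e i)) = finprod (additive_group UNIV) (\<lambda>i. f (ks (c i) (e i))) I"
    unfolding finsum_def
    by (rule hom_finprod_comm_group)
      (use assms in \<open>auto simp: dualD a_comm_group intro!: homI ks_closed\<close>)
  also have "\<dots> = (\<Sum>i\<in>I. c i * f (e i))"
    using assms by (auto simp: finprod_additive_group dualD Pi_iff intro!: sum.cong)
  finally show ?thesis .
qed

lemma dual_zero: "f \<in> dual H V \<Longrightarrow> f \<zero> = 0"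
  using dualD(2)[of f V \<zero> 0] by simp

lemma restrict_dualI:
  assumes "\<And>v w. v \<in> carrier V \<Longrightarrow> w \<in> carrier V \<Longrightarrow> g (v \<oplus> w) = g v + g w"
    and "\<And>c v. v \<in> carrier V \<Longrightarrow> g (ks c v) = c * g v"
  shows "restrict g (carrier V) \<in> dual H V"
  using assms by (simp add: dual_def)

definition spanning :: "'i set \<Rightarrow> ('i \<Rightarrow> 'v) \<Rightarrow> bool" where
  "spanning I e \<longleftrightarrow> finite I \<and> e \<in> I \<rightarrow> carrier V \<and>
     (\<forall>v\<in>carrier V. \<exists>c. v = (\<Oplus>i\<in>I. ks (c i) (e i)))"

text \<open>A vanishing combination with \<open>c j \<noteq> 0\<close> is subtracted from any other combination so as to kill
  the coefficient at \<open>j\<close>.\<close>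

lemma spanning_remove:
  assumes "spanning I e" "(\<Oplus>i\<in>I. ks (c i) (e i)) = \<zero>" "j \<in> I" "c j \<noteq> 0"
  shows "spanning (I - {j}) e"
proof -
  have I: "finite I" "e \<in> I \<rightarrow> carrier V" using assms(1) unfolding spanning_def by blast+
  have "\<exists>d. v = (\<Oplus>i\<in>I - {j}. ks (d i) (e i))" if v: "v \<in> carrier V" for v
  proof -
    obtain b where b: "v = (\<Oplus>i\<in>I. ks (b i) (e i))" using assms(1) v by (auto simp: spanning_def)
    define d where "d i = b i + - b j / c j * c i" for i
    have "v = v \<oplus> ks (- b j / c j) (\<Oplus>i\<in>I. ks (c i) (e i))"
      using v by (simp add: assms(2))
    also have "\<dots> = (\<Oplus>i\<in>I. ks (d i) (e i))"
      unfolding lincomb_scale[OF I] b lincomb_add[OF I(2)] d_def ..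
    also have "\<dots> = (\<Oplus>i\<in>insert j (I - {j}). ks (d i) (e i))"
      using assms(3) by (simp add: insert_absorb)
    also have "\<dots> = ks (d j) (e j) \<oplus> (\<Oplus>i\<in>I - {j}. ks (d i) (e i))"
      using I assms(3) by (intro finsum_insert) (auto intro!: ks_closed)
    also have "d j = 0" using assms(4) by (simp add: d_def)
    also have "ks 0 (e j) \<oplus> (\<Oplus>i\<in>I - {j}. ks (d i) (e i)) = (\<Oplus>i\<in>I - {j}. ks (d i) (e i))"
    proof -
      have "e \<in> I - {j} \<rightarrow> carrier V" "e j \<in> carrier V" using I assms(3) by auto
      then show ?thesis by simp
    qed
    finally show ?thesis by blast
  qed
  with I show ?thesis unfolding spanning_def by blast
qed

text \<open>\<open>fin_dim\<close> provides a spanning family only. One of least size is independent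
  by \<open>spanning_remove\<close>; its coordinates are then unique, hence linear in the vector,
  and these coordinate functions are the dual family.\<close>

lemma dual_family_exists:
  assumes "fin_dim H V"
  shows "\<exists>(I::nat set) e f. dual_family H V I e f"
proof -
  have "\<exists>n (I::nat set) e. spanning I e \<and> card I = n"
    using assms by (auto simp: fin_dim_def spanning_def)
  then obtain n where n: "\<exists>(I::nat set) e. spanning I e \<and> card I = n"
    and least: "\<And>m. m < n \<Longrightarrow> \<not> (\<exists>(I::nat set) e. spanning I e \<and> card I = m)"
    using exists_least_iff[of "\<lambda>n. \<exists>(I::nat set) e. spanning I e \<and> card I = n"] by blast
  from n obtain I :: "nat set" and e where I: "spanning I e" "card I = n" by blast
  then have fin: "finite I" and e: "e \<in> I \<rightarrow> carrier V" unfolding spanning_def by blast+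
  have indep: "c j = 0" if "(\<Oplus>i\<in>I. ks (c i) (e i)) = \<zero>" "j \<in> I" for c j
  proof (rule ccontr)
    assume "c j \<noteq> 0"
    then have "spanning (I - {j}) e" by (rule spanning_remove[OF I(1) that])
    moreover have "card (I - {j}) < n" using I(2) fin that(2) by (metis card_Diff1_less)
    ultimately show False using least by blast
  qed
  have inj: "c j = d j" if "(\<Oplus>i\<in>I. ks (c i) (e i)) = (\<Oplus>i\<in>I. ks (d i) (e i))" "j \<in> I" for c d j
  proof -
    have "(\<Oplus>i\<in>I. ks (c i + - 1 * d i) (e i))
      = (\<Oplus>i\<in>I. ks (d i) (e i)) \<oplus> ks (- 1) (\<Oplus>i\<in>I. ks (d i) (e i))"
      unfolding lincomb_scale[OF fin e] lincomb_add[OF e, symmetric] that(1) ..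
    also have "\<dots> = ks (1 + - 1) (\<Oplus>i\<in>I. ks (d i) (e i))"
      by (simp only: ks_simps(1,4)[OF lincomb_closed[OF e]])
    also have "\<dots> = \<zero>" using e by simp
    finally show ?thesis using indep[of "\<lambda>i. c i + - 1 * d i" j] that(2) by simp
  qed
  obtain co where co: "\<And>v. v \<in> carrier V \<Longrightarrow> v = (\<Oplus>i\<in>I. ks (co v i) (e i))"
    using I(1) unfolding spanning_def by metis
  define f where "f i = (\<lambda>v\<in>carrier V. co v i)" for i
  have "f i \<in> dual H V" if "i \<in> I" for i
    unfolding f_def
  proof (rule restrict_dualI)
    fix v w assume vw: "v \<in> carrier V" "w \<in> carrier V"
    then have "(\<Oplus>i\<in>I. ks (co (v \<oplus> w) i) (e i)) = (\<Oplus>i\<in>I. ks (co v i + co w i) (e i))"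
      using co[of v] co[of w] co[of "v \<oplus> w"] by (simp flip: lincomb_add[OF e])
    then show "co (v \<oplus> w) i = co v i + co w i" by (rule inj[OF _ that])
  next
    fix c v assume v: "v \<in> carrier V"
    then have "(\<Oplus>i\<in>I. ks (co (ks c v) i) (e i)) = (\<Oplus>i\<in>I. ks (c * co v i) (e i))"
      using co[of v] co[of "ks c v"] by (simp flip: lincomb_scale[OF fin e])
    then show "co (ks c v) i = c * co v i" by (rule inj[OF _ that])
  qed
  moreover have "f i (e j) = (if i = j then 1 else 0)" if "i \<in> I" "j \<in> I" for i j
  proof -
    have ej: "e j \<in> carrier V" using e that by auto
    note lincomb_delta[OF fin e that(2)]
    then show ?thesis
      using co[OF ej] inj[of "co (e j)" "\<lambda>i. if i = j then 1 else 0" i] ej that by (simp add: f_def)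
  qed
  moreover have "v = (\<Oplus>i\<in>I. ks (f i v) (e i))" if "v \<in> carrier V" for v
    using co[OF that] that by (simp add: f_def)
  ultimately show ?thesis
    using fin e unfolding dual_family_def by (intro exI[of _ I] exI[of _ e] exI[of _ f]) blast
qed

lemma dual_family_reindex:
  assumes "dual_family H V I e f" "bij_betw g J I"
  shows "dual_family H V J (\<lambda>j. e (g j)) (\<lambda>j. f (g j))"
proof -
  have g: "inj_on g J" "g ` J = I" using assms(2) by (auto simp: bij_betw_def)
  have "(\<Oplus>i\<in>I. ks (f i v) (e i)) = (\<Oplus>j\<in>J. ks (f (g j) v) (e (g j)))" for v
    unfolding g(2)[symmetric] using assms(1) g
    by (intro finsum_reindex) (auto dest: dual_familyD(2) intro!: ks_closed)
  note c = this
  show ?thesis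
    unfolding dual_family_def
  proof (intro conjI ballI)
    show "finite J" using bij_betw_finite[OF assms(2)] dual_familyD(1)[OF assms(1)] by blast
    fix v assume "v \<in> carrier V"
    then show "v = (\<Oplus>j\<in>J. ks (f (g j) v) (e (g j)))"
      unfolding c[symmetric] by (rule dual_familyD(5)[OF assms(1)])
  qed (use dual_familyD(2-4)[OF assms(1)] g in \<open>auto simp: inj_on_eq_iff\<close>)
qed

lemma dual_family_matrix:
  assumes "dual_family H V I e f" "x \<in> carrier V" "g \<in> dual H V"
  shows "g x = (\<Sum>j\<in>I. f j x * g (e j))"
proof -
  have "g x = g (\<Oplus>i\<in>I. ks (f i x) (e i))"
    using dual_familyD(5)[OF assms(1,2)] by (rule arg_cong)
  also have "\<dots> = (\<Sum>j\<in>I. f j x * g (e j))"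
    using assms by (intro dual_lincomb dual_familyD(1,2)[OF assms(1)])
  finally show ?thesis .
qed

lemma ract_dual: "f \<in> dual H V \<Longrightarrow> (\<lambda>v\<in>carrier V. f (x \<odot> v)) \<in> dual H V"
  by (rule restrict_dualI)
    (simp_all add: act_add_right act_closed dualD ksmult_act[OF left_module_axioms]
      flip: ksmult_act(1)[OF left_module_axioms])

text \<open>Inserting the dual basis between x and y expands each trace into a double sum, and
  exchanging the two summation indices exchanges x and y.\<close>

lemma trace_commute:
  assumes "dual_family H V I e f"
  shows "(\<Sum>i\<in>I. f i ((x * y) \<odot> e i)) = (\<Sum>i\<in>I. f i ((y * x) \<odot> e i))"
proof -
  have e: "e i \<in> carrier V" "f i \<in> dual H V" if "i \<in> I" for i
    using dual_familyD(2,3)[OF assms] that by auto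
  have *: "(\<Sum>i\<in>I. f i ((x * y) \<odot> e i)) = (\<Sum>i\<in>I. \<Sum>j\<in>I. f j (y \<odot> e i) * f i (x \<odot> e j))" for x y
  proof (rule sum.cong[OF refl])
    fix i assume i: "i \<in> I"
    have "f i ((x * y) \<odot> e i) = (\<lambda>v\<in>carrier V. f i (x \<odot> v)) (y \<odot> e i)"
      using e i by (simp add: act_mult act_closed)
    also have "\<dots> = (\<Sum>j\<in>I. f j (y \<odot> e i) * (\<lambda>v\<in>carrier V. f i (x \<odot> v)) (e j))"
      using e i by (intro dual_family_matrix[OF assms] ract_dual act_closed)
    finally show "f i ((x * y) \<odot> e i) = (\<Sum>j\<in>I. f j (y \<odot> e i) * f i (x \<odot> e j))"
      using e by (simp cong: sum.cong)
  qed
  show ?thesis unfolding * by (subst sum.swap) (simp add: mult.commute)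
qed

end

lemma lmod_homD:
  assumes "\<phi> \<in> lmod_hom V W"
  shows "v \<in> carrier V \<Longrightarrow> \<phi> v \<in> carrier W"
    and "v \<in> carrier V \<Longrightarrow> w \<in> carrier V \<Longrightarrow> \<phi> (v \<oplus>\<^bsub>V\<^esub> w) = \<phi> v \<oplus>\<^bsub>W\<^esub> \<phi> w"
    and "v \<in> carrier V \<Longrightarrow> \<phi> (h \<odot>\<^bsub>V\<^esub> v) = h \<odot>\<^bsub>W\<^esub> \<phi> v"
    and "v \<in> carrier V \<Longrightarrow> \<phi> (ksmult H V c v) = ksmult H W c (\<phi> v)"
  using assms by (auto simp: lmod_hom_def ksmult_def)

context hopf_algebra
begin

lemma lmod_hom_lincomb:
  assumes "left_module V" "left_module W" "\<phi> \<in> lmod_hom V W" "finite I" "e \<in> I \<rightarrow> carrier V"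
  shows "\<phi> (\<Oplus>\<^bsub>V\<^esub>i\<in>I. ksmult H V (c i) (e i)) = (\<Oplus>\<^bsub>W\<^esub>i\<in>I. ksmult H W (c i) (\<phi> (e i)))"
proof -
  interpret V: hopf_module H V using hopf_algebra_axioms assms(1) by (rule hopf_module.intro)
  interpret W: hopf_module H W using hopf_algebra_axioms assms(2) by (rule hopf_module.intro)
  have "\<phi> (\<Oplus>\<^bsub>V\<^esub>i\<in>I. ksmult H V (c i) (e i)) = (\<Oplus>\<^bsub>W\<^esub>i\<in>I. \<phi> (ksmult H V (c i) (e i)))"
    by (rule finsum_hom) (use assms in \<open>auto intro!: V.ks_closed V.abelian_group_axioms W.abelian_group_axioms simp: lmod_homD\<close>)
  also have "\<dots> = (\<Oplus>\<^bsub>W\<^esub>i\<in>I. ksmult H W (c i) (\<phi> (e i)))"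
    using assms(5) by (intro W.finsum_cong') (auto simp: lmod_homD[OF assms(3)] Pi_iff)
  finally show ?thesis .
qed

text \<open>A dual basis of the middle term consists of the image of one of the sub and a lift \<open>e''\<close> of one
  of the quotient. Here \<open>s\<close> is the resulting \<open>\<bbbk>\<close>-linear section of \<open>p\<close> and \<open>q\<close> the retraction of
  \<open>\<iota>\<close> with \<open>\<iota> q + s p = 1\<close>.\<close>

lemma dual_family_short_exact:
  assumes modules: "left_module X" "left_module V" "left_module W"
    and ex: "short_exact X \<iota> V p W"
    and X: "dual_family H X I e f" and W: "dual_family H W J e' f'"
  obtains E F where "dual_family H V (I <+> J) E F"
    "\<And>h. (\<Sum>k\<in>I <+> J. F k (h \<odot>\<^bsub>V\<^esub> E k))
      = (\<Sum>i\<in>I. f i (h \<odot>\<^bsub>X\<^esub> e i)) + (\<Sum>j\<in>J. f' j (h \<odot>\<^bsub>W\<^esub> e' j))"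
proof -
  interpret X: hopf_module H X using hopf_algebra_axioms modules(1) by (rule hopf_module.intro)
  interpret V: hopf_module H V using hopf_algebra_axioms modules(2) by (rule hopf_module.intro)
  interpret W: hopf_module H W using hopf_algebra_axioms modules(3) by (rule hopf_module.intro)
  have \<iota>: "\<iota> \<in> lmod_hom X V" and p: "p \<in> lmod_hom V W" and inj: "inj_on \<iota> (carrier X)"
    and surj: "p ` carrier V = carrier W"
    and exact: "\<iota> ` carrier X = {v \<in> carrier V. p v = \<zero>\<^bsub>W\<^esub>}"
    using ex by (auto simp: short_exact_def)
  note \<iota>D = lmod_homD[OF \<iota>] and pD = lmod_homD[OF p]
  note XD = dual_familyD[OF X] and WD = dual_familyD[OF W]
  have e: "e i \<in> carrier X" "f i \<in> dual H X" if "i \<in> I" for i using XD(2,3) that by auto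
  have e': "e' j \<in> carrier W" "f' j \<in> dual H W" if "j \<in> J" for j using WD(2,3) that by auto
  have "\<forall>j\<in>J. \<exists>v. v \<in> carrier V \<and> p v = e' j"
  proof
    fix j assume "j \<in> J"
    then have "e' j \<in> p ` carrier V" using e'(1) surj by simp
    then obtain v where "e' j = p v" "v \<in> carrier V" by (rule imageE)
    then show "\<exists>v. v \<in> carrier V \<and> p v = e' j" by (intro exI[of _ v]) simp
  qed
  from bchoice[OF this] obtain e'' where "\<forall>j\<in>J. e'' j \<in> carrier V \<and> p (e'' j) = e' j" ..
  then have e'': "\<And>j. j \<in> J \<Longrightarrow> e'' j \<in> carrier V" "\<And>j. j \<in> J \<Longrightarrow> p (e'' j) = e' j" by simp_all
  then have e''Pi: "e'' \<in> J \<rightarrow> carrier V" by auto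
  have \<iota>0: "\<iota> \<zero>\<^bsub>X\<^esub> = \<zero>\<^bsub>V\<^esub>" using \<iota>D(4)[of "\<zero>\<^bsub>X\<^esub>" H 0] \<iota>D(1)[of "\<zero>\<^bsub>X\<^esub>"] by simp
  have p\<iota>: "p (\<iota> u) = \<zero>\<^bsub>W\<^esub>" if "u \<in> carrier X" for u using exact that by blast
  define s where "s w = (\<Oplus>\<^bsub>V\<^esub>j\<in>J. ksmult H V (f' j w) (e'' j))" for w
  have s_closed [simp]: "s w \<in> carrier V" for w
    unfolding s_def by (rule V.lincomb_closed[OF e''Pi])
  have s_add: "s (w \<oplus>\<^bsub>W\<^esub> w') = s w \<oplus>\<^bsub>V\<^esub> s w'" if "w \<in> carrier W" "w' \<in> carrier W" for w w'
    unfolding s_def V.lincomb_add[OF e''Pi]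
    using that e' e'' by (intro V.finsum_cong') (auto simp: dualD intro!: V.ks_closed)
  have s_ks: "s (ksmult H W c w) = ksmult H V c (s w)" if "w \<in> carrier W" for w c
    unfolding s_def V.lincomb_scale[OF WD(1) e''Pi]
    using that e' e'' by (intro V.finsum_cong') (auto simp: dualD intro!: V.ks_closed)
  have s_zero: "s \<zero>\<^bsub>W\<^esub> = \<zero>\<^bsub>V\<^esub>" using s_ks[of "\<zero>\<^bsub>W\<^esub>" 0] by simp
  have ps: "p (s w) = w" if "w \<in> carrier W" for w
  proof -
    have "p (s w) = (\<Oplus>\<^bsub>W\<^esub>j\<in>J. ksmult H W (f' j w) (p (e'' j)))"
      unfolding s_def by (rule lmod_hom_lincomb[OF modules(2,3) p WD(1) e''Pi])
    also have "\<dots> = (\<Oplus>\<^bsub>W\<^esub>j\<in>J. ksmult H W (f' j w) (e' j))"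
      using e' e'' by (intro W.finsum_cong') (auto intro!: W.ks_closed)
    also have "\<dots> = w" using WD(5)[OF that] by (rule sym)
    finally show ?thesis .
  qed
  have s_e': "s (e' l) = e'' l" if "l \<in> J" for l
  proof -
    have "s (e' l) = (\<Oplus>\<^bsub>V\<^esub>j\<in>J. ksmult H V (if j = l then 1 else 0) (e'' j))"
      unfolding s_def using WD(4)[OF _ that] e'' by (intro V.finsum_cong') (auto intro!: V.ks_closed)
    also have "\<dots> = e'' l" by (rule V.lincomb_delta[OF WD(1) e''Pi that])
    finally show ?thesis .
  qed
  have cancel: "v \<oplus>\<^bsub>V\<^esub> ksmult H V (- 1) v = \<zero>\<^bsub>V\<^esub>" if "v \<in> carrier V" for v
    using that V.ks_simps(1)[OF that, of 1 "- 1"] by (simp add: V.ks_simps(4))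
  \<comment> \<open>This is v - s (p v), the projection to the kernel of p along the section s. By
    exactness it takes values in the image of \<iota>, which yields q.\<close>
  define r where "r v = v \<oplus>\<^bsub>V\<^esub> ksmult H V (- 1) (s (p v))" for v
  have r_closed: "r v \<in> carrier V" if "v \<in> carrier V" for v using that by (simp add: r_def)
  have r_add: "r (v \<oplus>\<^bsub>V\<^esub> w) = r v \<oplus>\<^bsub>V\<^esub> r w" if "v \<in> carrier V" "w \<in> carrier V" for v w
    using that by (simp add: r_def pD s_add V.ks_simps V.a_ac)
  have r_ks: "r (ksmult H V c v) = ksmult H V c (r v)" if "v \<in> carrier V" for v c
    using that by (simp add: r_def pD s_ks V.ks_simps mult.commute)
  have pr: "p (r v) = \<zero>\<^bsub>W\<^esub>" if "v \<in> carrier V" for v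
  proof -
    have "p (r v) = p v \<oplus>\<^bsub>W\<^esub> ksmult H W (- 1) (p v)"
      using that by (simp add: r_def pD ps)
    also have "\<dots> = ksmult H W (1 + - 1) (p v)"
      using that by (simp only: W.ks_simps(1,4) pD(1))
    finally show ?thesis using that pD(1) by simp
  qed
  have "\<forall>v\<in>carrier V. \<exists>u. u \<in> carrier X \<and> \<iota> u = r v"
  proof
    fix v assume "v \<in> carrier V"
    then have "r v \<in> \<iota> ` carrier X" unfolding exact using r_closed pr by blast
    then obtain u where "r v = \<iota> u" "u \<in> carrier X" by (rule imageE)
    then show "\<exists>u. u \<in> carrier X \<and> \<iota> u = r v" by (intro exI[of _ u]) simp
  qed
  from bchoice[OF this] obtain q where "\<forall>v\<in>carrier V. q v \<in> carrier X \<and> \<iota> (q v) = r v" ..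
  then have q: "\<And>v. v \<in> carrier V \<Longrightarrow> q v \<in> carrier X"
    "\<And>v. v \<in> carrier V \<Longrightarrow> \<iota> (q v) = r v" by simp_all
  \<comment> \<open>The map q is chosen pointwise; its linearity and its values are obtained by
    applying the injective \<iota>, since \<iota> q = r is already known to be linear.\<close>
  have \<iota>_eqD: "u = u'" if "\<iota> u = \<iota> u'" "u \<in> carrier X" "u' \<in> carrier X" for u u'
    using inj_onD[OF inj] that by blast
  have q_add: "q (v \<oplus>\<^bsub>V\<^esub> w) = q v \<oplus>\<^bsub>X\<^esub> q w" if "v \<in> carrier V" "w \<in> carrier V" for v w
    by (rule \<iota>_eqD) (use that in \<open>simp_all add: q \<iota>D r_add\<close>)
  have q_ks: "q (ksmult H V c v) = ksmult H X c (q v)" if "v \<in> carrier V" for v c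
    by (rule \<iota>_eqD) (use that in \<open>simp_all add: q \<iota>D r_ks\<close>)
  have q\<iota>: "q (\<iota> u) = u" if "u \<in> carrier X" for u
    by (rule \<iota>_eqD) (use that in \<open>simp_all add: q \<iota>D r_def p\<iota> s_zero\<close>)
  have qe'': "q (e'' j) = \<zero>\<^bsub>X\<^esub>" if "j \<in> J" for j
    by (rule \<iota>_eqD) (use that in \<open>simp_all add: q e'' r_def s_e' cancel \<iota>0\<close>)
  have decomp: "v = \<iota> (q v) \<oplus>\<^bsub>V\<^esub> s (p v)" if "v \<in> carrier V" for v
  proof -
    have "\<iota> (q v) \<oplus>\<^bsub>V\<^esub> s (p v) = v \<oplus>\<^bsub>V\<^esub> (s (p v) \<oplus>\<^bsub>V\<^esub> ksmult H V (- 1) (s (p v)))"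
      using that by (simp add: q r_def V.a_ac)
    then show ?thesis using that by (simp add: cancel)
  qed
  \<comment> \<open>The dual functionals are the f i composed with q and the f' j composed with p.
    The pairing matrix is the identity because q \<iota> = 1, p \<iota> = 0, q kills every e'' j,
    and p (e'' j) = e' j.\<close>
  define E where "E = case_sum (\<lambda>i. \<iota> (e i)) e''"
  define F where "F = case_sum (\<lambda>i. \<lambda>v\<in>carrier V. f i (q v)) (\<lambda>j. \<lambda>v\<in>carrier V. f' j (p v))"
  have E_Pi: "E \<in> I <+> J \<rightarrow> carrier V" using e \<iota>D(1) e'' by (auto simp: E_def)
  have F_Pi: "F \<in> I <+> J \<rightarrow> dual H V"
    unfolding F_def
    by (auto intro!: V.restrict_dualI simp: q_add q_ks dualD[OF e(2)] dualD[OF e'(2)] q pD)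
  have "dual_family H V (I <+> J) E F"
    unfolding dual_family_def
  proof (intro conjI ballI E_Pi F_Pi)
    show "finite (I <+> J)" using XD(1) WD(1) by simp
    fix k l assume "k \<in> I <+> J" "l \<in> I <+> J"
    then show "F k (E l) = (if k = l then 1 else 0)"
      by (auto simp: E_def F_def e e' e'' \<iota>D q\<iota> p\<iota> qe'' XD(4) WD(4) X.dual_zero W.dual_zero split: if_splits)
  next
    fix v assume v: "v \<in> carrier V"
    have "(\<Oplus>\<^bsub>V\<^esub>k\<in>I <+> J. ksmult H V (F k v) (E k))
      = (\<Oplus>\<^bsub>V\<^esub>k\<in>Inl ` I. ksmult H V (F k v) (E k)) \<oplus>\<^bsub>V\<^esub> (\<Oplus>\<^bsub>V\<^esub>k\<in>Inr ` J. ksmult H V (F k v) (E k))"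
      unfolding Plus_def
      by (rule V.finsum_Un_disjoint) (use XD(1) WD(1) E_Pi in \<open>auto intro!: V.ks_closed\<close>)
    also have "(\<Oplus>\<^bsub>V\<^esub>k\<in>Inl ` I. ksmult H V (F k v) (E k))
      = (\<Oplus>\<^bsub>V\<^esub>i\<in>I. ksmult H V (F (Inl i) v) (E (Inl i)))"
      by (rule V.finsum_reindex) (use E_Pi in \<open>auto intro!: V.ks_closed\<close>)
    also have "\<dots> = (\<Oplus>\<^bsub>V\<^esub>i\<in>I. ksmult H V (f i (q v)) (\<iota> (e i)))"
      using v by (simp add: E_def F_def)
    also have "\<dots> = \<iota> (\<Oplus>\<^bsub>X\<^esub>i\<in>I. ksmult H X (f i (q v)) (e i))"
      by (rule lmod_hom_lincomb[OF modules(1,2) \<iota> XD(1,2), symmetric])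
    also have "(\<Oplus>\<^bsub>X\<^esub>i\<in>I. ksmult H X (f i (q v)) (e i)) = q v"
      using XD(5)[OF q(1)[OF v]] by (rule sym)
    also have "(\<Oplus>\<^bsub>V\<^esub>k\<in>Inr ` J. ksmult H V (F k v) (E k))
      = (\<Oplus>\<^bsub>V\<^esub>j\<in>J. ksmult H V (F (Inr j) v) (E (Inr j)))"
      by (rule V.finsum_reindex) (use E_Pi in \<open>auto intro!: V.ks_closed\<close>)
    also have "\<dots> = s (p v)" using v by (simp add: E_def F_def s_def)
    finally have "(\<Oplus>\<^bsub>V\<^esub>k\<in>I <+> J. ksmult H V (F k v) (E k)) = \<iota> (q v) \<oplus>\<^bsub>V\<^esub> s (p v)" .
    from trans[OF decomp[OF v] this[symmetric]]
    show "v = (\<Oplus>\<^bsub>V\<^esub>k\<in>I <+> J. ksmult H V (F k v) (E k))" .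
  qed
  moreover have "(\<Sum>k\<in>I <+> J. F k (h \<odot>\<^bsub>V\<^esub> E k))
      = (\<Sum>i\<in>I. f i (h \<odot>\<^bsub>X\<^esub> e i)) + (\<Sum>j\<in>J. f' j (h \<odot>\<^bsub>W\<^esub> e' j))" for h
  proof -
    \<comment> \<open>Only k-linearity of q has been established, but \<iota> is H-linear, so q (h
      \<iota>(u)) = q (\<iota>(h u)) = h u. Diagonal entries on the quotient side use H-linearity of
      p.\<close>
    have "F (Inl i) (h \<odot>\<^bsub>V\<^esub> E (Inl i)) = f i (h \<odot>\<^bsub>X\<^esub> e i)" if "i \<in> I" for i
      using that by (simp add: E_def F_def e q\<iota> \<iota>D(1) V.act_closed X.act_closed flip: \<iota>D(3))
    moreover have "F (Inr j) (h \<odot>\<^bsub>V\<^esub> E (Inr j)) = f' j (h \<odot>\<^bsub>W\<^esub> e' j)" if "j \<in> J" for j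
      using that by (simp add: E_def F_def e'' pD V.act_closed)
    ultimately show ?thesis using XD(1) WD(1) by (simp add: sum.Plus)
  qed
  ultimately show thesis by (rule that)
qed

end

section \<open>The canonical element and its image z_V\<close>

context finite_duality_category
begin

lemma hopf_module: "V \<in> C \<Longrightarrow> hopf_module H V"
  using hopf_algebra_axioms objects by (rule hopf_module.intro)

text \<open>Expand each e i in the basis e', move the coefficients f' j (e i) across the tensor
  sign, exchange the two sums, and recombine: the sum over i of f' j (e i) times f i is f'
  j.\<close>

lemma canonical_elem_unique:
  assumes V: "V \<in> C" and fd: "fin_dim H V"
    and b: "dual_family H V I e f" and b': "dual_family H V J e' f'"
  shows "(\<Otimes>\<^bsub>D_tensor V star\<^esub>i\<in>I. D_pure V star (e i) (f i))
    = (\<Otimes>\<^bsub>D_tensor V star\<^esub>j\<in>J. D_pure V star (e' j) (f' j))"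
proof -
  interpret V: hopf_module H V by (rule hopf_module[OF V])
  interpret T: tensor_product "add_monoid V" "functional_group V (star V)" "lmod_hom V V"
    "\<lambda>v \<phi>. \<phi> v" "transpose_map V" by (rule D_tensor_product[OF V])
  let ?D = "D_tensor V star" and ?S = "functional_group V (star V)"
  interpret D: comm_group ?D by (rule D_tensor_comm_group[OF V])
  have star: "star V = dual H V" using star_full_iff[OF V] fd by simp
  have bal: "balanced (add_monoid V) ?S (lmod_hom V V) (\<lambda>v \<phi>. \<phi> v) (transpose_map V) ?D (D_pure V star)"
    using T.tens_balanced by (simp add: D_tensor_def D_pure_def[abs_def])
  have e: "e i \<in> carrier V" "f i \<in> star V" if "i \<in> I" for i
    using dual_familyD(2,3)[OF b] that star by auto
  have e': "e' j \<in> carrier V" "f' j \<in> star V" if "j \<in> J" for j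
    using dual_familyD(2,3)[OF b'] that star by auto
  \<comment> \<open>Multiplication by a scalar is an H-endomorphism, hence an element of D(V), and
    the relations of the tensor product over D(V) allow it to be moved to the functional.\<close>
  have ks: "ksmult H V c \<in> lmod_hom V V" for c
    by (auto simp: lmod_hom_def V.ks_simps ksmult_act[OF V.left_module_axioms])
  have closed: "D_pure V star v g \<in> carrier ?D" if "v \<in> carrier V" "g \<in> star V" for v g
    using balancedD(1)[OF bal] that by simp
  have sc: "transpose_map V (ksmult H V c) g \<in> star V" if "g \<in> star V" for c g
    using star_transpose[OF V V ks that] .
  have "(\<Otimes>\<^bsub>?D\<^esub>i\<in>I. D_pure V star (e i) (f i))
    = (\<Otimes>\<^bsub>?D\<^esub>i\<in>I. \<Otimes>\<^bsub>?D\<^esub>j\<in>J. D_pure V star (e' j) (transpose_map V (ksmult H V (f' j (e i))) (f i)))"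
  proof (rule D.finprod_cong')
    fix i assume i: "i \<in> I"
    have h: "(\<lambda>v. D_pure V star v (f i)) \<in> hom (add_monoid V) ?D"
      by (rule homI) (use balancedD(1,2)[OF bal] e(2)[OF i] in auto)
    have "D_pure V star (e i) (f i)
      = D_pure V star (finprod (add_monoid V) (\<lambda>j. ksmult H V (f' j (e i)) (e' j)) J) (f i)"
      using dual_familyD(5)[OF b' e(1)[OF i]] unfolding finsum_def by (rule arg_cong)
    also have "\<dots> = (\<Otimes>\<^bsub>?D\<^esub>j\<in>J. D_pure V star (ksmult H V (f' j (e i)) (e' j)) (f i))"
      by (rule hom_finprod_comm_group[OF V.a_comm_group D.comm_group_axioms h])
        (use e' dual_familyD(1)[OF b'] in auto)
    also have "\<dots> = (\<Otimes>\<^bsub>?D\<^esub>j\<in>J. D_pure V star (e' j) (transpose_map V (ksmult H V (f' j (e i))) (f i)))"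
      by (rule D.finprod_cong')
        (use balancedD(4)[OF bal, simplified, OF _ ks] e' e(2)[OF i] closed sc in auto)
    finally show "D_pure V star (e i) (f i)
      = (\<Otimes>\<^bsub>?D\<^esub>j\<in>J. D_pure V star (e' j) (transpose_map V (ksmult H V (f' j (e i))) (f i)))" .
  qed (use e e' closed sc in \<open>auto intro!: D.finprod_closed\<close>)
  also have "\<dots> = (\<Otimes>\<^bsub>?D\<^esub>j\<in>J. \<Otimes>\<^bsub>?D\<^esub>i\<in>I. D_pure V star (e' j) (transpose_map V (ksmult H V (f' j (e i))) (f i)))"
    by (rule D.finprod_swap) (use e e' closed sc dual_familyD(1)[OF b] dual_familyD(1)[OF b'] in auto)
  also have "\<dots> = (\<Otimes>\<^bsub>?D\<^esub>j\<in>J. D_pure V star (e' j) (f' j))"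
  proof (rule D.finprod_cong')
    fix j assume j: "j \<in> J"
    let ?g = "\<lambda>i. transpose_map V (ksmult H V (f' j (e i))) (f i)"
    note S = comm_group_star[OF V]
    have g: "?g \<in> I \<rightarrow> carrier ?S" using sc e by auto
    have h: "D_pure V star (e' j) \<in> hom ?S ?D"
      by (rule homI) (use balancedD(1,3)[OF bal] e'(1)[OF j] in auto)
    have "(\<Otimes>\<^bsub>?D\<^esub>i\<in>I. D_pure V star (e' j) (?g i)) = D_pure V star (e' j) (finprod ?S ?g I)"
      by (rule hom_finprod_comm_group[OF S D.comm_group_axioms h g dual_familyD(1)[OF b], symmetric])
    \<comment> \<open>Functionals are extensional, so it is enough to compare values on the carrier,
      where the product in \<open>?S\<close> becomes an ordinary sum.\<close>
    also have "finprod ?S ?g I = f' j"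
    proof (rule extensionalityI)
      have "finprod ?S ?g I \<in> carrier ?S" by (rule T.B.finprod_closed[OF g])
      then show "finprod ?S ?g I \<in> extensional (carrier V)" using star dualD(3) by auto
      show "f' j \<in> extensional (carrier V)" using e'(2)[OF j] star dualD(3) by auto
      fix v assume v: "v \<in> carrier V"
      have ev: "(\<lambda>f. f v) \<in> hom ?S (additive_group UNIV)" using v by (auto intro!: homI)
      have "finprod ?S ?g I v = (\<Sum>i\<in>I. ?g i v)"
        using hom_finprod_comm_group[OF S comm_group_additive_UNIV ev g dual_familyD(1)[OF b]]
          finprod_additive_group[OF comm_group_additive_UNIV dual_familyD(1)[OF b]] by simp
      also have "\<dots> = (\<Sum>i\<in>I. f i v * f' j (e i))"
        using e(2) star v by (intro sum.cong) (auto simp: transpose_map_def dualD)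
      also have "\<dots> = f' j v"
        using V.dual_family_matrix[OF b v, of "f' j"] e'(2)[OF j] star by simp
      finally show "finprod ?S ?g I v = f' j v" .
    qed
    finally show "(\<Otimes>\<^bsub>?D\<^esub>i\<in>I. D_pure V star (e' j) (?g i)) = D_pure V star (e' j) (f' j)" .
  qed (use e' closed in auto)
  finally show ?thesis .
qed

lemma fin_dim_dual_bases:
  assumes "V \<in> C" "fin_dim H V"
  shows "\<exists>n e f. dual_bases H V n e f"
proof -
  interpret V: hopf_module H V by (rule hopf_module[OF assms(1)])
  obtain I :: "nat set" and e f where b: "dual_family H V I e f"
    using V.dual_family_exists[OF assms(2)] by blast
  obtain g where "bij_betw g {..<card I} I"
    using ex_bij_betw_nat_finite[OF dual_familyD(1)[OF b]] by (auto simp: lessThan_atLeast0)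
  from V.dual_family_reindex[OF b this] show ?thesis unfolding dual_bases_iff by blast
qed

text \<open>Existence and uniqueness resolve the \<open>THE\<close> in
  \<open>canonical_elem\<close>. Any finite index set is allowed, so the trace on an extension can
  be read off its block basis.\<close>

lemma z_elem_dual_family:
  assumes V: "V \<in> C" and fd: "fin_dim H V" and b: "dual_family H V I e f"
  shows "z_elem H star V = (\<Sum>i\<in>I. matrix_coeff V (e i) (f i))"
proof -
  have star: "star V = dual H V" using star_full_iff[OF V] fd by simp
  interpret D: comm_group "D_tensor V star" by (rule D_tensor_comm_group[OF V])
  have e: "e i \<in> carrier V" "f i \<in> star V" if "i \<in> I" for i
    using dual_familyD(2,3)[OF b] that star by auto
  obtain n0 e0 f0 where b0: "dual_bases H V n0 e0 f0" using fin_dim_dual_bases[OF V fd] by blast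
  have "canonical_elem H star V = (\<Otimes>\<^bsub>D_tensor V star\<^esub>i\<in>I. D_pure V star (e i) (f i))"
    unfolding canonical_elem_def
  proof (rule the_equality)
    show "\<exists>n e' f'. dual_bases H V n e' f' \<and>
      (\<Otimes>\<^bsub>D_tensor V star\<^esub>i\<in>I. D_pure V star (e i) (f i))
      = (\<Otimes>\<^bsub>D_tensor V star\<^esub>i\<in>{..<n}. D_pure V star (e' i) (f' i))"
      using b0 canonical_elem_unique[OF V fd b b0[unfolded dual_bases_iff]] by blast
    fix Y assume "\<exists>n e f. dual_bases H V n e f \<and> Y = (\<Otimes>\<^bsub>D_tensor V star\<^esub>i\<in>{..<n}. D_pure V star (e i) (f i))"
    then show "Y = (\<Otimes>\<^bsub>D_tensor V star\<^esub>i\<in>I. D_pure V star (e i) (f i))"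
      using canonical_elem_unique[OF V fd _ b] unfolding dual_bases_iff by blast
  qed
  then have "z_elem H star V = beta H V (\<Otimes>\<^bsub>D_tensor V star\<^esub>i\<in>I. D_pure V star (e i) (f i))"
    by (simp add: z_elem_def)
  also have "\<dots> = finprod (additive_group (H_dual H)) (\<lambda>i. beta H V (D_pure V star (e i) (f i))) I"
    by (rule hom_finprod_comm_group[OF D.comm_group_axioms comm_group_H_dual beta_hom[OF V]])
      (use e tensor_product.tens_closed[OF D_tensor_product[OF V]] dual_familyD(1)[OF b]
        in \<open>auto simp: D_tensor_def D_pure_def\<close>)
  also have "\<dots> = (\<Sum>i\<in>I. beta H V (D_pure V star (e i) (f i)))"
    using e matrix_coeff_HC[OF V] dual_familyD(1)[OF b]
    by (intro finprod_additive_group comm_group_H_dual) (auto simp: beta_pure[OF V] intro!: HC_linear)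
  also have "\<dots> = (\<Sum>i\<in>I. matrix_coeff V (e i) (f i))"
    using e by (simp add: beta_pure[OF V])
  finally show ?thesis .
qed

lemma z_elem_apply:
  "V \<in> C \<Longrightarrow> fin_dim H V \<Longrightarrow> dual_family H V I e f \<Longrightarrow>
   z_elem H star V h = (\<Sum>i\<in>I. f i (h \<odot>\<^bsub>V\<^esub> e i))"
proof -
  have "(\<Sum>i\<in>I. g i) h = (\<Sum>i\<in>I. g i h)" for g :: "_ \<Rightarrow> 'h \<Rightarrow> 'k"
    by (induction I rule: infinite_finite_induct) auto
  then show "V \<in> C \<Longrightarrow> fin_dim H V \<Longrightarrow> dual_family H V I e f \<Longrightarrow> ?thesis"
    by (simp add: z_elem_dual_family matrix_coeff_def)
qed

lemma HC_sum: "(\<And>i. i \<in> I \<Longrightarrow> g i \<in> HC) \<Longrightarrow> sum g I \<in> HC"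
proof (induction I rule: infinite_finite_induct)
  case (insert i I)
  then have "g i + sum g I \<in> HC" by (intro HC_add) auto
  then show ?case by (simp only: sum.insert[OF insert(1,2)])
qed (simp_all add: HC_zero)

lemma z_elem_invariant:
  assumes "V \<in> C" "fin_dim H V"
  shows "z_elem H star V \<in> bimod_invariants HC dual_left dual_right"
proof -
  interpret V: hopf_module H V by (rule hopf_module[OF assms(1)])
  obtain I :: "nat set" and e f where b: "dual_family H V I e f"
    using V.dual_family_exists[OF assms(2)] by blast
  have star: "star V = dual H V" using star_full_iff assms by simp
  have "(\<Sum>i\<in>I. matrix_coeff V (e i) (f i)) \<in> HC"
    using dual_familyD(1)[OF b] dual_familyD(2,3)[OF b] star
    by (intro HC_sum matrix_coeff_HC assms(1)) auto
  then show ?thesis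
    using V.trace_commute[OF b]
    by (simp add: z_elem_dual_family[OF assms b, symmetric] bimod_invariants_def dual_left_def
        dual_right_def z_elem_apply[OF assms b])
qed

lemma z_elem_short_exact:
  assumes "X \<in> C" "V \<in> C" "W \<in> C" "fin_dim H X" "fin_dim H V" "fin_dim H W" "short_exact X \<iota> V p W"
  shows "z_elem H star V = z_elem H star X + z_elem H star W"
proof -
  obtain I :: "nat set" and e f where b: "dual_family H X I e f"
    using hopf_module.dual_family_exists[OF hopf_module] assms by blast
  obtain J :: "nat set" and e' f' where b': "dual_family H W J e' f'"
    using hopf_module.dual_family_exists[OF hopf_module] assms by blast
  obtain E F where d: "dual_family H V (I <+> J) E F"
    and t: "\<And>h. (\<Sum>k\<in>I <+> J. F k (h \<odot>\<^bsub>V\<^esub> E k))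
      = (\<Sum>i\<in>I. f i (h \<odot>\<^bsub>X\<^esub> e i)) + (\<Sum>j\<in>J. f' j (h \<odot>\<^bsub>W\<^esub> e' j))"
    by (rule dual_family_short_exact[OF objects[OF assms(1)] objects[OF assms(2)] objects[OF assms(3)]
          assms(7) b b']) (rule that)
  have "z_elem H star V h = (z_elem H star X + z_elem H star W) h" for h
    by (simp add: z_elem_apply[OF assms(2,5) d] t z_elem_apply[OF assms(1,4) b]
        z_elem_apply[OF assms(3,6) b'])
  then show ?thesis by (rule ext)
qed

end

section \<open>The Grothendieck group\<close>

lemma free_Abelian_group_hom_eqI:
  assumes "group G" "\<phi> \<in> hom (free_Abelian_group S) G" "\<psi> \<in> hom (free_Abelian_group S) G"
    and eq: "\<And>a. a \<in> S \<Longrightarrow> \<phi> (frag_of a) = \<psi> (frag_of a)" and x: "Poly_Mapping.keys x \<subseteq> S"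
  shows "\<phi> x = \<psi> x"
proof -
  interpret G: group G by fact
  interpret free: group "free_Abelian_group S" by simp
  interpret p: group_hom "free_Abelian_group S" G \<phi> by unfold_locales fact
  interpret q: group_hom "free_Abelian_group S" G \<psi> by unfold_locales fact
  have d: "\<phi> (a - b) = \<phi> a \<otimes>\<^bsub>G\<^esub> inv\<^bsub>G\<^esub> \<phi> b" "\<psi> (a - b) = \<psi> a \<otimes>\<^bsub>G\<^esub> inv\<^bsub>G\<^esub> \<psi> b"
    if "Poly_Mapping.keys a \<subseteq> S" "Poly_Mapping.keys b \<subseteq> S" for a b
    using p.hom_mult[of a "- b"] q.hom_mult[of a "- b"] p.hom_inv[of b] q.hom_inv[of b] that by simp_all
  show ?thesis
    by (rule free_Abelian_group_induct[OF x]) (use p.hom_one q.hom_one in \<open>auto simp: d eq\<close>)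
qed

text \<open>Existence: the extension of c to the free group kills \<open>K0_null\<close> because c
  is additive on short exact sequences. Uniqueness: the classes generate, and extensionality fixes
  the values outside the carrier.\<close>

lemma K0_hom_exists_unique:
  assumes G: "comm_group (additive_group A)" and c: "\<And>V. V \<in> E \<Longrightarrow> c V \<in> A"
    and additive: "\<And>U V W i p. U \<in> E \<Longrightarrow> V \<in> E \<Longrightarrow> W \<in> E \<Longrightarrow> short_exact U i V p W \<Longrightarrow> c V = c U + c W"
  shows "\<exists>!ch. ch \<in> hom (K0 E) (additive_group A) \<and> ch \<in> extensional (carrier (K0 E)) \<and>
    (\<forall>V\<in>E. ch (K0_class E V) = c V)"
proof (rule ex_ex1I)
  interpret free: comm_group "free_Abelian_group E" by (rule abelian_free_Abelian_group)
  interpret A: comm_group "additive_group A" by (rule G)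
  have null: "subgroup (K0_null E) (free_Abelian_group E)"
    unfolding K0_null_def
  proof (rule free.generate_is_subgroup, rule subsetI, elim CollectE exE conjE)
    fix x U V W assume "x = frag_of V - frag_of U - frag_of W" "U \<in> E" "V \<in> E" "W \<in> E"
    then show "x \<in> carrier (free_Abelian_group E)"
      using keys_diff[of "frag_of V - frag_of U" "frag_of W"] keys_diff[of "frag_of V" "frag_of U"] by auto
  qed
  then have normal: "K0_null E \<lhd> free_Abelian_group E" by (simp add: free.normal_iff_subgroup)
  obtain k where k: "k \<in> hom (free_Abelian_group E) (additive_group A)" "\<And>V. V \<in> E \<Longrightarrow> k (frag_of V) = c V"
    using A.free_Abelian_group_universal[of c E] c by auto
  interpret k: group_hom "free_Abelian_group E" "additive_group A" k by unfold_locales (rule k)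
  have inv: "inv\<^bsub>additive_group A\<^esub> x = - x" if "x \<in> A" for x
    using A.l_inv[of x] that by (simp add: eq_neg_iff_add_eq_0)
  have kdiff: "k (x - y) = k x - k y" if "Poly_Mapping.keys x \<subseteq> E" "Poly_Mapping.keys y \<subseteq> E" for x y
    using k.hom_mult[of x "- y"] k.hom_inv[of y] inv[of "k y"] k.hom_closed[of y] that by simp
  have "K0_null E \<subseteq> kernel (free_Abelian_group E) (additive_group A) k"
    unfolding K0_null_def
  proof (rule free.generate_subgroup_incl[OF _ k.subgroup_kernel], rule subsetI, elim CollectE exE conjE)
    fix x U V W i p assume x: "x = frag_of V - frag_of U - frag_of W"
      and E: "U \<in> E" "V \<in> E" "W \<in> E" and ex: "short_exact U i V p W"
    have 1: "Poly_Mapping.keys (frag_of V - frag_of U) \<subseteq> E"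
      using keys_diff[of "frag_of V" "frag_of U"] E by auto
    have "Poly_Mapping.keys x \<subseteq> E"
      using x keys_diff[of "frag_of V - frag_of U" "frag_of W"] 1 E by auto
    moreover have "k x = 0"
      unfolding x using E by (simp add: kdiff[OF 1] kdiff k(2) additive[OF E ex])
    ultimately show "x \<in> kernel (free_Abelian_group E) (additive_group A) k" by (simp add: kernel_def)
  qed
  then have k0: "k x = 0" if "x \<in> K0_null E" for x using that by (auto simp: kernel_def)
  \<comment> \<open>Constancy of k on cosets is what lets it factor through the quotient.\<close>
  have "k x = k y" if xy: "x \<in> carrier (free_Abelian_group E)" "y \<in> carrier (free_Abelian_group E)"
    and eq: "K0_null E #>\<^bsub>free_Abelian_group E\<^esub> x = K0_null E #>\<^bsub>free_Abelian_group E\<^esub> y" for x y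
  proof -
    have "x \<in> K0_null E #>\<^bsub>free_Abelian_group E\<^esub> y" using free.rcos_self[OF xy(1) null] eq by simp
    then obtain n where n: "n \<in> K0_null E" "x = n + y" unfolding r_coset_def by auto
    then have "n \<in> carrier (free_Abelian_group E)" using subgroup.subset[OF null] by blast
    then show ?thesis using n k.hom_mult[of n y] xy(2) k0[OF n(1)] by simp
  qed
  then obtain g where g: "g \<in> hom (K0 E) (additive_group A)"
    "\<And>x. x \<in> carrier (free_Abelian_group E) \<Longrightarrow> g (K0_null E #>\<^bsub>free_Abelian_group E\<^esub> x) = k x"
    using FactGroup_universal[OF k(1) normal] unfolding K0_def by blast
  have cls: "K0_class E V \<in> carrier (K0 E)" if "V \<in> E" for V
    using that by (auto simp: K0_class_def K0_def carrier_FactGroup)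
  have K0: "group (K0 E)" unfolding K0_def by (rule normal.factorgroup_is_group[OF normal])
  show "\<exists>ch. ch \<in> hom (K0 E) (additive_group A) \<and> ch \<in> extensional (carrier (K0 E)) \<and>
    (\<forall>V\<in>E. ch (K0_class E V) = c V)"
  proof (intro exI[of _ "restrict g (carrier (K0 E))"] conjI ballI)
    show "restrict g (carrier (K0 E)) \<in> hom (K0 E) (additive_group A)"
      using group.hom_restrict[OF K0 g(1)] by simp
    fix V assume V: "V \<in> E"
    then show "restrict g (carrier (K0 E)) (K0_class E V) = c V"
      using g(2)[of "frag_of V"] k(2)[OF V] cls[OF V] by (simp add: K0_class_def)
  qed simp
  fix ch ch'
  assume ch: "ch \<in> hom (K0 E) (additive_group A) \<and> ch \<in> extensional (carrier (K0 E)) \<and>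
      (\<forall>V\<in>E. ch (K0_class E V) = c V)"
    and ch': "ch' \<in> hom (K0 E) (additive_group A) \<and> ch' \<in> extensional (carrier (K0 E)) \<and>
      (\<forall>V\<in>E. ch' (K0_class E V) = c V)"
  have proj: "(\<lambda>x. K0_null E #>\<^bsub>free_Abelian_group E\<^esub> x) \<in> hom (free_Abelian_group E) (K0 E)"
    unfolding K0_def by (rule normal.r_coset_hom_Mod[OF normal])
  show "ch = ch'"
  proof (rule extensionalityI[of _ "carrier (K0 E)"])
    fix X assume "X \<in> carrier (K0 E)"
    then obtain x where x: "Poly_Mapping.keys x \<subseteq> E" "X = K0_null E #>\<^bsub>free_Abelian_group E\<^esub> x"
      by (auto simp: K0_def carrier_FactGroup)
    have "(ch \<circ> (\<lambda>x. K0_null E #>\<^bsub>free_Abelian_group E\<^esub> x)) x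
      = (ch' \<circ> (\<lambda>x. K0_null E #>\<^bsub>free_Abelian_group E\<^esub> x)) x"
    proof (rule free_Abelian_group_hom_eqI[OF A.group_axioms _ _ _ x(1)])
      fix V assume "V \<in> E"
      then show "(ch \<circ> (\<lambda>x. K0_null E #>\<^bsub>free_Abelian_group E\<^esub> x)) (frag_of V)
        = (ch' \<circ> (\<lambda>x. K0_null E #>\<^bsub>free_Abelian_group E\<^esub> x)) (frag_of V)"
        using ch ch' by (simp add: K0_class_def)
    qed (use ch ch' hom_compose[OF proj] in blast)+
    then show "ch X = ch' X" by (simp add: x(2))
  qed (use ch ch' in blast)+
qed

lemma comm_group_ring_center: "comm_group (additive_group ring_center)"
  by (rule comm_group_additive_group) (auto simp: ring_center_def algebra_simps)

theorem theorem1p5: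
  fixes H :: "('k::field, 'h::ring_1) hopf"
    and C :: "('h, 'v) module set"
    and star :: "('h, 'v) module \<Rightarrow> ('v \<Rightarrow> 'k) set"
    and K :: "('k, 'h, 'c::ring_1) completion"
    and P :: 'c
  assumes "hopf_algebra H"
    and "finite_duality_category H C star"
    and "completed_square H C star K"
    and "P \<in> A_set H K"
  shows "left_module (diamond_module H C star) \<and> left_module (adjoint_module H) \<and>
    Phi K P \<in> lmod_hom (diamond_module H C star) (adjoint_module H) \<and>
    Phi K P ` bimod_invariants (coeffs_cat H C star) dual_left dual_right \<subseteq> ring_center \<and>
    (\<exists>!ch. ch \<in> hom (K0 (fin_objects H C)) (additive_group ring_center) \<and>
      ch \<in> extensional (carrier (K0 (fin_objects H C))) \<and>
      (\<forall>V\<in>fin_objects H C. ch (K0_class (fin_objects H C) V) = Phi K P (z_elem H star V)))"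
proof -
  interpret completed_category H C star K
    using assms(2,3) by (rule completed_category.intro)
  have z: "z_elem H star V \<in> bimod_invariants HC dual_left dual_right" if "V \<in> fin_objects H C" for V
    using that z_elem_invariant by (simp add: fin_objects_def)
  then have zHC: "z_elem H star V \<in> HC" if "V \<in> fin_objects H C" for V
    using that by (simp add: bimod_invariants_def)
  have "\<exists>!ch. ch \<in> hom (K0 (fin_objects H C)) (additive_group ring_center) \<and>
      ch \<in> extensional (carrier (K0 (fin_objects H C))) \<and>
      (\<forall>V\<in>fin_objects H C. ch (K0_class (fin_objects H C) V) = Phi K P (z_elem H star V))"
  proof (rule K0_hom_exists_unique[OF comm_group_ring_center])
    fix V assume "V \<in> fin_objects H C"
    then show "Phi K P (z_elem H star V) \<in> ring_center" by (intro Phi_center[OF assms(4)] z)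
  next
    fix U V W i p
    assume *: "U \<in> fin_objects H C" "V \<in> fin_objects H C" "W \<in> fin_objects H C" "short_exact U i V p W"
    then have "z_elem H star V = z_elem H star U + z_elem H star W"
      by (intro z_elem_short_exact[of U V W i p]) (simp_all add: fin_objects_def)
    with * show "Phi K P (z_elem H star V) = Phi K P (z_elem H star U) + Phi K P (z_elem H star W)"
      by (simp only: Phi_add[OF zHC zHC])
  qed
  then show ?thesis
    using diamond_module adjoint_module Phi_lmod_hom[OF assms(4)] Phi_center[OF assms(4)] by blast
qed

end
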